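(* Let $\mathfrak{a}$ be an ideal in a ring $A$. Then $\mathfrak{a}$ is strongly idempotent if and only if the torsion class $\mathsf{T}_{\mathfrak{a}}$ is weakly stable.
   Context: Rings are unital associative algebras over a fixed commutative base ring; $\mathsf{M}(A)$ is the category of left $A$-modules and $\mathsf{D}(A)$ its derived category. An ideal $\mathfrak{a}$ in $A$ is strongly idempotent if the canonical morphism $A/\mathfrak{a}\otimes_A^{\mathrm{L}}A/\mathfrak{a}\to A/\mathfrak{a}$, induced from the multiplication $A/\mathfrak{a}\otimes_A A/\mathfrak{a}\to A/\mathfrak{a}$, is an isomorphism in $\mathsf{D}(A)$. A torsion class in $\mathsf{M}(A)$ is a class of modules closed under submodules, extensions, quotients and arbitrary direct sums. Its torsion functor $\Gamma_{\mathsf{T}}$ sends a module $M$ to the largest submodule of $M$ lying in $\mathsf{T}$. The torsion class $\mathsf{T}$ is weakly stable if for every injective $A$-module $E$ the module $\Gamma_{\mathsf{T}}(E)$ is right $\Gamma_{\mathsf{T}}$-acyclic, i.e. $\mathrm{R}^i\Gamma_{\mathsf{T}}(\Gamma_{\mathsf{T}}(E))=0$ for all $i\geq 1$. For an ideal $\mathfrak{a}$, $\mathsf{T}_{\mathfrak{a}}$ denotes the class of all $M\in\mathsf{M}(A)$ such that for every $m\in M$ there is $n\in\mathbb{N}$ with $\mathfrak{a}^n m=0$. In general this need not be a torsion class unless $\mathfrak{a}$ is finitely generated as a left ideal. When $\mathfrak{a}$ is idempotent ($\mathfrak{a}=\mathfrak{a}^2$), finite generation is irrelevant: $\mathsf{T}_{\mathfrak{a}}$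 is the class of modules $M$ with $\mathfrak{a}M=0$, and its torsion functor is $\mathrm{Hom}_A(A/\mathfrak{a},-)$.
   Formalization: The right side also requires a = a² and that T_a is a torsion class, since the claim fails for A = Z, a = (2); for idempotent a it is the stated equivalence. Modules range over one arbitrary carrier type, large enough for resolutions; every module fits into such a type. *)

theory Defs
  imports "HOL-Algebra.Algebra"
begin

section \<open>Left modules over a noncommutative ring\<close>

text \<open>
  The library locale \<^locale>\<open>module\<close> requires the base ring to be commutative; its record type is
  reused here (as in the library, the fields \<^const>\<open>monoid.mult\<close> and \<^const>\<open>monoid.one\<close> of a
  module are irrelevant). A base ring, over which all rings are algebras, is not mentioned: ideals,
  modules, tensor products and derived functors depend only on the underlying ring.
\<close>

locale left_module = R?: ring R + M?: abelian_group M
  for R :: "('a, 'r) ring_scheme" (structure) and M :: "('a, 'm, 's) module_scheme" (structure) +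
  assumes smult_closed: "\<lbrakk>a \<in> carrier R; x \<in> carrier M\<rbrakk> \<Longrightarrow> a \<odot>\<^bsub>M\<^esub> x \<in> carrier M"
    and smult_l_distr: "\<lbrakk>a \<in> carrier R; b \<in> carrier R; x \<in> carrier M\<rbrakk> \<Longrightarrow>
      (a \<oplus> b) \<odot>\<^bsub>M\<^esub> x = a \<odot>\<^bsub>M\<^esub> x \<oplus>\<^bsub>M\<^esub> b \<odot>\<^bsub>M\<^esub> x"
    and smult_r_distr: "\<lbrakk>a \<in> carrier R; x \<in> carrier M; y \<in> carrier M\<rbrakk> \<Longrightarrow>
      a \<odot>\<^bsub>M\<^esub> (x \<oplus>\<^bsub>M\<^esub> y) = a \<odot>\<^bsub>M\<^esub> x \<oplus>\<^bsub>M\<^esub> a \<odot>\<^bsub>M\<^esub> y"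
    and smult_assoc: "\<lbrakk>a \<in> carrier R; b \<in> carrier R; x \<in> carrier M\<rbrakk> \<Longrightarrow>
      (a \<otimes> b) \<odot>\<^bsub>M\<^esub> x = a \<odot>\<^bsub>M\<^esub> (b \<odot>\<^bsub>M\<^esub> x)"
    and smult_one: "x \<in> carrier M \<Longrightarrow> \<one> \<odot>\<^bsub>M\<^esub> x = x"

definition lin_hom ::
  "('a, 'r) ring_scheme \<Rightarrow> ('a, 'm, 's) module_scheme \<Rightarrow> ('a, 'n, 't) module_scheme \<Rightarrow> ('m \<Rightarrow> 'n) set"
  where "lin_hom R M N = {h \<in> carrier M \<rightarrow> carrier N.
    (\<forall>x\<in>carrier M. \<forall>y\<in>carrier M. h (x \<oplus>\<^bsub>M\<^esub> y) = h x \<oplus>\<^bsub>N\<^esub> h y) \<and>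
    (\<forall>a\<in>carrier R. \<forall>x\<in>carrier M. h (a \<odot>\<^bsub>M\<^esub> x) = a \<odot>\<^bsub>N\<^esub> h x)}"

definition lin_kernel ::
  "('a, 'm, 's) module_scheme \<Rightarrow> ('a, 'n, 't) module_scheme \<Rightarrow> ('m \<Rightarrow> 'n) \<Rightarrow> 'm set"
  where "lin_kernel M N h = {x \<in> carrier M. h x = \<zero>\<^bsub>N\<^esub>}"

definition quotient_module :: "('a, 'm) module \<Rightarrow> 'm set \<Rightarrow> ('a, 'm set) module"
  where "quotient_module M N = \<lparr>carrier = a_rcosets\<^bsub>M\<^esub> N, monoid.mult = undefined, monoid.one = undefined,
    ring.zero = N, ring.add = set_add M, smult = (\<lambda>a Z. \<Union>x\<in>Z. N +>\<^bsub>M\<^esub> (a \<odot>\<^bsub>M\<^esub> x))\<rparr>"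

definition zero_module :: "('a, 'm, 's) module_scheme \<Rightarrow> bool"
  where "zero_module M \<longleftrightarrow> carrier M = {\<zero>\<^bsub>M\<^esub>}"


section \<open>The universe of modules\<close>

text \<open>
  The category of modules is represented by the modules whose carrier is a set of elements of a
  type \<^typ>\<open>'m\<close>. Besides being nontrivial, \<^typ>\<open>'m\<close> has to satisfy a closure condition on its
  cardinality \<open>\<mu>\<close>, namely \<open>\<mu>\<close> to the power \<open>max (\<aleph>\<^sub>0) |'a|\<close> equals \<open>\<mu>\<close>, where \<^typ>\<open>'a\<close> is
  the type of the ring elements. It guarantees that the universe contains the free modules on sets
  of at most \<open>\<mu>\<close> generators, the cyclic modules, and with each module an injective module into which
  it embeds; so projective and injective resolutions exist, and projectivity and injectivity inside
  the universe are the absolute notions. Every type embeds into such a type, as shown below.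
\<close>

definition module_universe :: "'a itself \<Rightarrow> 'm itself \<Rightarrow> bool"
  where "module_universe _ _ \<longleftrightarrow>
    (\<exists>x y :: 'm. x \<noteq> y) \<and> (\<exists>\<phi> :: (nat \<Rightarrow> 'a \<Rightarrow> 'm) \<Rightarrow> 'm. inj \<phi>)"

lemma module_universe_example:
  "module_universe TYPE('a) TYPE((nat + 'a) list \<Rightarrow> 'n \<times> bool)"
  "\<exists>\<iota> :: 'n \<Rightarrow> (nat + 'a) list \<Rightarrow> 'n \<times> bool. inj \<iota>"
proof -
  define \<phi> :: "(nat \<Rightarrow> 'a \<Rightarrow> (nat + 'a) list \<Rightarrow> 'n \<times> bool) \<Rightarrow> (nat + 'a) list \<Rightarrow> 'n \<times> bool"
    where "\<phi> = (\<lambda>F w. F (projl (w ! 0)) (projr (w ! 1)) (drop 2 w))"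
  have "inj \<phi>"
  proof (rule injI, intro ext)
    fix F G n a w
    assume "\<phi> F = \<phi> G"
    from fun_cong[OF this, of "Inl n # Inr a # w"] show "F n a w = G n a w"
      by (simp add: \<phi>_def)
  qed
  moreover have "(\<lambda>_. (undefined, True)) \<noteq> (\<lambda>_ :: (nat + 'a) list. (undefined :: 'n, False))"
    by (simp add: fun_eq_iff)
  ultimately show "module_universe TYPE('a) TYPE((nat + 'a) list \<Rightarrow> 'n \<times> bool)"
    unfolding module_universe_def by blast
  show "\<exists>\<iota> :: 'n \<Rightarrow> (nat + 'a) list \<Rightarrow> 'n \<times> bool. inj \<iota>"
    by (rule exI[of _ "\<lambda>x _. (x, True)"]) (simp add: inj_on_def fun_eq_iff)
qed

definition injective_module :: "('a, 'r) ring_scheme \<Rightarrow> ('a, 'm) module \<Rightarrow> bool"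
  where "injective_module R E \<longleftrightarrow> left_module R E \<and>
    (\<forall>(M :: ('a, 'm) module) (N :: ('a, 'm) module) f g.
      left_module R M \<and> left_module R N \<and>
      f \<in> lin_hom R M N \<and> inj_on f (carrier M) \<and> g \<in> lin_hom R M E \<longrightarrow>
      (\<exists>h\<in>lin_hom R N E. \<forall>x\<in>carrier M. h (f x) = g x))"

definition projective_module :: "('a, 'r) ring_scheme \<Rightarrow> ('a, 'm) module \<Rightarrow> bool"
  where "projective_module R P \<longleftrightarrow> left_module R P \<and>
    (\<forall>(M :: ('a, 'm) module) (N :: ('a, 'm) module) f g.
      left_module R M \<and> left_module R N \<and>
      f \<in> lin_hom R M N \<and> f ` carrier M = carrier N \<and> g \<in> lin_hom R P N \<longrightarrow>
      (\<exists>h\<in>lin_hom R P M. \<forall>x\<in>carrier P. f (h x) = g x))"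


section \<open>Cochain complexes and quasi-isomorphisms\<close>

record ('a, 'm) cochain =
  obj :: "int \<Rightarrow> ('a, 'm) module"
  diff :: "int \<Rightarrow> 'm \<Rightarrow> 'm"

definition is_complex :: "('a, 'r) ring_scheme \<Rightarrow> ('a, 'm) cochain \<Rightarrow> bool"
  where "is_complex R C \<longleftrightarrow> (\<forall>n. left_module R (obj C n) \<and>
    diff C n \<in> lin_hom R (obj C n) (obj C (n + 1)) \<and>
    (\<forall>x\<in>carrier (obj C n). diff C (n + 1) (diff C n x) = \<zero>\<^bsub>obj C (n + 2)\<^esub>))"

definition cocycles :: "('a, 'm) cochain \<Rightarrow> int \<Rightarrow> 'm set"
  where "cocycles C n = lin_kernel (obj C n) (obj C (n + 1)) (diff C n)"

definition coboundaries :: "('a, 'm) cochain \<Rightarrow> int \<Rightarrow> 'm set"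
  where "coboundaries C n = diff C (n - 1) ` carrier (obj C (n - 1))"

definition cohomology :: "('a, 'm) cochain \<Rightarrow> int \<Rightarrow> ('a, 'm set) module"
  where "cohomology C n = quotient_module ((obj C n)\<lparr>carrier := cocycles C n\<rparr>) (coboundaries C n)"

definition chain_map ::
  "('a, 'r) ring_scheme \<Rightarrow> ('a, 'm) cochain \<Rightarrow> ('a, 'n) cochain \<Rightarrow> (int \<Rightarrow> 'm \<Rightarrow> 'n) \<Rightarrow> bool"
  where "chain_map R C D f \<longleftrightarrow> is_complex R C \<and> is_complex R D \<and>
    (\<forall>n. f n \<in> lin_hom R (obj C n) (obj D n) \<and>
      (\<forall>x\<in>carrier (obj C n). f (n + 1) (diff C n x) = diff D n (f n x)))"

definition cohomology_map :: "('a, 'n) cochain \<Rightarrow> (int \<Rightarrow> 'm \<Rightarrow> 'n) \<Rightarrow> int \<Rightarrow> 'm set \<Rightarrow> 'n set"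
  where "cohomology_map D f n Z = (\<Union>x\<in>Z. coboundaries D n +>\<^bsub>obj D n\<^esub> f n x)"

text \<open>
  A chain map becomes an isomorphism in the derived category precisely when it is a
  quasi-isomorphism.
\<close>

definition quasi_iso ::
  "('a, 'r) ring_scheme \<Rightarrow> ('a, 'm) cochain \<Rightarrow> ('a, 'n) cochain \<Rightarrow> (int \<Rightarrow> 'm \<Rightarrow> 'n) \<Rightarrow> bool"
  where "quasi_iso R C D f \<longleftrightarrow> chain_map R C D f \<and>
    (\<forall>n. bij_betw (cohomology_map D f n) (carrier (cohomology C n)) (carrier (cohomology D n)))"

definition stalk_complex :: "('a, 'm) module \<Rightarrow> ('a, 'm) cochain"
  where "stalk_complex M = \<lparr>obj = (\<lambda>n. if n = 0 then M else M\<lparr>carrier := {\<zero>\<^bsub>M\<^esub>}\<rparr>),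
    diff = (\<lambda>_ _. \<zero>\<^bsub>M\<^esub>)\<rparr>"

definition injective_resolution ::
  "('a, 'r) ring_scheme \<Rightarrow> ('a, 'm) module \<Rightarrow> ('a, 'm) cochain \<Rightarrow> (int \<Rightarrow> 'm \<Rightarrow> 'm) \<Rightarrow> bool"
  where "injective_resolution R M I \<eta> \<longleftrightarrow> (\<forall>n. injective_module R (obj I n)) \<and>
    (\<forall>n<0. zero_module (obj I n)) \<and> quasi_iso R (stalk_complex M) I \<eta>"

definition projective_resolution ::
  "('a, 'r) ring_scheme \<Rightarrow> ('a, 'n) module \<Rightarrow> ('a, 'm) cochain \<Rightarrow> (int \<Rightarrow> 'm \<Rightarrow> 'n) \<Rightarrow> bool"
  where "projective_resolution R M P \<epsilon> \<longleftrightarrow> (\<forall>n. projective_module R (obj P n)) \<and>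
    (\<forall>n>0. zero_module (obj P n)) \<and> quasi_iso R P (stalk_complex M) \<epsilon>"


section \<open>Torsion classes and weak stability\<close>

definition direct_sum_of ::
  "('a, 'r) ring_scheme \<Rightarrow> ('a, 'm) module \<Rightarrow> 'i set \<Rightarrow> ('i \<Rightarrow> ('a, 'm) module) \<Rightarrow>
    ('i \<Rightarrow> 'm \<Rightarrow> 'm) \<Rightarrow> bool"
  where "direct_sum_of R M I N \<iota> \<longleftrightarrow> left_module R M \<and>
    (\<forall>i\<in>I. left_module R (N i) \<and> \<iota> i \<in> lin_hom R (N i) M) \<and>
    (\<forall>m\<in>carrier M. \<exists>!x. x \<in> (\<Pi>\<^sub>E i\<in>I. carrier (N i)) \<and> finite {i\<in>I. x i \<noteq> \<zero>\<^bsub>N i\<^esub>} \<and>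
      m = (\<Oplus>\<^bsub>M\<^esub>i\<in>{i\<in>I. x i \<noteq> \<zero>\<^bsub>N i\<^esub>}. \<iota> i (x i)))"

text \<open>
  Closure is stated up to isomorphism. The index sets of direct sums are subsets of \<^typ>\<open>'m\<close>; this
  is no restriction, because the nonzero summands of a module in the universe contain distinct
  nonzero elements of it.
\<close>

definition torsion_class :: "('a, 'r) ring_scheme \<Rightarrow> ('a, 'm) module set \<Rightarrow> bool"
  where "torsion_class R T \<longleftrightarrow>
    (\<forall>M\<in>T. left_module R M) \<and>
    (\<forall>M\<in>T. \<forall>N f. left_module R N \<and> f \<in> lin_hom R N M \<and> inj_on f (carrier N) \<longrightarrow> N \<in> T) \<and>
    (\<forall>M\<in>T. \<forall>N f. left_module R N \<and> f \<in> lin_hom R M N \<and> f ` carrier M = carrier N \<longrightarrow> N \<in> T) \<and>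
    (\<forall>L\<in>T. \<forall>N\<in>T. \<forall>M f g. left_module R M \<and>
      f \<in> lin_hom R L M \<and> inj_on f (carrier L) \<and>
      g \<in> lin_hom R M N \<and> g ` carrier M = carrier N \<and>
      f ` carrier L = lin_kernel M N g \<longrightarrow> M \<in> T) \<and>
    (\<forall>M (I :: 'm set) N \<iota>. direct_sum_of R M I N \<iota> \<and> (\<forall>i\<in>I. N i \<in> T) \<longrightarrow> M \<in> T)"

definition torsion_submodule ::
  "('a, 'r) ring_scheme \<Rightarrow> ('a, 'm) module set \<Rightarrow> ('a, 'm) module \<Rightarrow> ('a, 'm) module"
  where "torsion_submodule R T M =
    M\<lparr>carrier := (GREATEST N. submodule N R M \<and> M\<lparr>carrier := N\<rparr> \<in> T)\<rparr>"

definition torsion_subcomplex ::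
  "('a, 'r) ring_scheme \<Rightarrow> ('a, 'm) module set \<Rightarrow> ('a, 'm) cochain \<Rightarrow> ('a, 'm) cochain"
  where "torsion_subcomplex R T C = \<lparr>obj = (\<lambda>n. torsion_submodule R T (obj C n)), diff = diff C\<rparr>"

definition chosen_injective_resolution ::
  "('a, 'r) ring_scheme \<Rightarrow> ('a, 'm) module \<Rightarrow> ('a, 'm) cochain"
  where "chosen_injective_resolution R M = (SOME I. \<exists>\<eta>. injective_resolution R M I \<eta>)"

definition right_derived_torsion ::
  "('a, 'r) ring_scheme \<Rightarrow> ('a, 'm) module set \<Rightarrow> int \<Rightarrow> ('a, 'm) module \<Rightarrow> ('a, 'm set) module"
  where "right_derived_torsion R T i M =
    cohomology (torsion_subcomplex R T (chosen_injective_resolution R M)) i"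

definition right_torsion_acyclic ::
  "('a, 'r) ring_scheme \<Rightarrow> ('a, 'm) module set \<Rightarrow> ('a, 'm) module \<Rightarrow> bool"
  where "right_torsion_acyclic R T M \<longleftrightarrow> (\<forall>i\<ge>1. zero_module (right_derived_torsion R T i M))"

definition weakly_stable :: "('a, 'r) ring_scheme \<Rightarrow> ('a, 'm) module set \<Rightarrow> bool"
  where "weakly_stable R T \<longleftrightarrow>
    (\<forall>E. injective_module R E \<longrightarrow> right_torsion_acyclic R T (torsion_submodule R T E))"

primrec ideal_pow :: "('a, 'r) ring_scheme \<Rightarrow> 'a set \<Rightarrow> nat \<Rightarrow> 'a set"
  where
    "ideal_pow R \<aa> 0 = carrier R"
  | "ideal_pow R \<aa> (Suc n) = ideal_prod R \<aa> (ideal_pow R \<aa> n)"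

definition ideal_torsion_class :: "('a, 'r) ring_scheme \<Rightarrow> 'a set \<Rightarrow> ('a, 'm) module set"
  where "ideal_torsion_class R \<aa> = {M. left_module R M \<and>
    (\<forall>m\<in>carrier M. \<exists>n. \<forall>x\<in>ideal_pow R \<aa> n. x \<odot>\<^bsub>M\<^esub> m = \<zero>\<^bsub>M\<^esub>)}"

definition idempotent_ideal :: "('a, 'r) ring_scheme \<Rightarrow> 'a set \<Rightarrow> bool"
  where "idempotent_ideal R \<aa> \<longleftrightarrow> ideal_prod R \<aa> \<aa> = \<aa>"


section \<open>Tensor products\<close>

record ('a, 'b) bimodule = "('a, 'b) module" +
  rsmult :: "'b \<Rightarrow> 'a \<Rightarrow> 'b"

text \<open>
  The tensor product is the free abelian group on pairs modulo the subgroup generated by the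
  additivity and balancing relations.
\<close>

definition tensor_relations ::
  "('a, 'r) ring_scheme \<Rightarrow> ('a, 'b) bimodule \<Rightarrow> ('a, 'm) module \<Rightarrow> ('b \<times> 'm \<Rightarrow>\<^sub>0 int) set"
  where "tensor_relations R B P =
    {frag_of (x \<oplus>\<^bsub>B\<^esub> y, p) - frag_of (x, p) - frag_of (y, p) | x y p.
       x \<in> carrier B \<and> y \<in> carrier B \<and> p \<in> carrier P} \<union>
    {frag_of (x, p \<oplus>\<^bsub>P\<^esub> q) - frag_of (x, p) - frag_of (x, q) | x p q.
       x \<in> carrier B \<and> p \<in> carrier P \<and> q \<in> carrier P} \<union>
    {frag_of (rsmult B x a, p) - frag_of (x, a \<odot>\<^bsub>P\<^esub> p) | x a p.
       x \<in> carrier B \<and> a \<in> carrier R \<and> p \<in> carrier P}"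

definition tensor_group ::
  "('a, 'r) ring_scheme \<Rightarrow> ('a, 'b) bimodule \<Rightarrow> ('a, 'm) module \<Rightarrow> ('b \<times> 'm \<Rightarrow>\<^sub>0 int) set monoid"
  where "tensor_group R B P = (let F = free_Abelian_group (carrier B \<times> carrier P)
    in F Mod generate F (tensor_relations R B P))"

definition pure_tensor ::
  "('a, 'r) ring_scheme \<Rightarrow> ('a, 'b) bimodule \<Rightarrow> ('a, 'm) module \<Rightarrow> 'b \<Rightarrow> 'm \<Rightarrow> ('b \<times> 'm \<Rightarrow>\<^sub>0 int) set"
  where "pure_tensor R B P x p = (let F = free_Abelian_group (carrier B \<times> carrier P)
    in generate F (tensor_relations R B P) #>\<^bsub>F\<^esub> frag_of (x, p))"

text \<open>
  The additive map out of a tensor product induced by a biadditive balanced map \<open>\<beta>\<close> into an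
  abelian group \<open>G\<close>; it is evaluated on representatives.
\<close>

definition tensor_lift ::
  "('c, 'g) ring_scheme \<Rightarrow> ('b \<Rightarrow> 'm \<Rightarrow> 'c) \<Rightarrow> ('b \<times> 'm \<Rightarrow>\<^sub>0 int) set \<Rightarrow> 'c"
  where "tensor_lift G \<beta> Z = the_elem ((\<lambda>c. \<Oplus>\<^bsub>G\<^esub>z\<in>Poly_Mapping.keys c.
    [Poly_Mapping.lookup c z] \<cdot>\<^bsub>G\<^esub> \<beta> (fst z) (snd z)) ` Z)"

definition tensor_ab ::
  "('a, 'r) ring_scheme \<Rightarrow> ('a, 'b) bimodule \<Rightarrow> ('a, 'm) module \<Rightarrow> (('b \<times> 'm \<Rightarrow>\<^sub>0 int) set) ring"
  where "tensor_ab R B P = \<lparr>carrier = carrier (tensor_group R B P), monoid.mult = undefined,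
    monoid.one = undefined, ring.zero = \<one>\<^bsub>tensor_group R B P\<^esub>, ring.add = monoid.mult (tensor_group R B P)\<rparr>"

definition tensor_module ::
  "('a, 'r) ring_scheme \<Rightarrow> ('a, 'b) bimodule \<Rightarrow> ('a, 'm) module \<Rightarrow> ('a, ('b \<times> 'm \<Rightarrow>\<^sub>0 int) set) module"
  where "tensor_module R B P = \<lparr>carrier = carrier (tensor_ab R B P), monoid.mult = undefined,
    monoid.one = undefined, ring.zero = \<zero>\<^bsub>tensor_ab R B P\<^esub>, ring.add = ring.add (tensor_ab R B P),
    smult = (\<lambda>a. tensor_lift (tensor_ab R B P) (\<lambda>x p. pure_tensor R B P (a \<odot>\<^bsub>B\<^esub> x) p))\<rparr>"

definition tensor_map ::
  "('a, 'r) ring_scheme \<Rightarrow> ('a, 'b) bimodule \<Rightarrow> ('a, 'n) module \<Rightarrow> ('m \<Rightarrow> 'n) \<Rightarrow>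
    ('b \<times> 'm \<Rightarrow>\<^sub>0 int) set \<Rightarrow> ('b \<times> 'n \<Rightarrow>\<^sub>0 int) set"
  where "tensor_map R B Q h = tensor_lift (tensor_ab R B Q) (\<lambda>x p. pure_tensor R B Q x (h p))"

definition tensor_complex ::
  "('a, 'r) ring_scheme \<Rightarrow> ('a, 'b) bimodule \<Rightarrow> ('a, 'm) cochain \<Rightarrow>
    ('a, ('b \<times> 'm \<Rightarrow>\<^sub>0 int) set) cochain"
  where "tensor_complex R B C = \<lparr>obj = (\<lambda>n. tensor_module R B (obj C n)),
    diff = (\<lambda>n. tensor_map R B (obj C (n + 1)) (diff C n))\<rparr>"


section \<open>Strongly idempotent ideals\<close>

definition quotient_left :: "('a, 'r) ring_scheme \<Rightarrow> 'a set \<Rightarrow> ('a, 'a set) module"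
  where "quotient_left R \<aa> = \<lparr>carrier = carrier (R Quot \<aa>), monoid.mult = monoid.mult (R Quot \<aa>),
    monoid.one = \<one>\<^bsub>R Quot \<aa>\<^esub>, ring.zero = \<zero>\<^bsub>R Quot \<aa>\<^esub>, ring.add = ring.add (R Quot \<aa>),
    smult = (\<lambda>r Z. (\<aa> +>\<^bsub>R\<^esub> r) \<otimes>\<^bsub>R Quot \<aa>\<^esub> Z)\<rparr>"

definition quotient_bimodule :: "('a, 'r) ring_scheme \<Rightarrow> 'a set \<Rightarrow> ('a, 'a set) bimodule"
  where "quotient_bimodule R \<aa> = \<lparr>carrier = carrier (R Quot \<aa>), monoid.mult = monoid.mult (R Quot \<aa>),
    monoid.one = \<one>\<^bsub>R Quot \<aa>\<^esub>, ring.zero = \<zero>\<^bsub>R Quot \<aa>\<^esub>, ring.add = ring.add (R Quot \<aa>),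
    smult = smult (quotient_left R \<aa>), rsmult = (\<lambda>Z r. Z \<otimes>\<^bsub>R Quot \<aa>\<^esub> (\<aa> +>\<^bsub>R\<^esub> r))\<rparr>"

definition quotient_mult ::
  "('a, 'r) ring_scheme \<Rightarrow> 'a set \<Rightarrow> ('a set \<times> 'a set \<Rightarrow>\<^sub>0 int) set \<Rightarrow> 'a set"
  where "quotient_mult R \<aa> = tensor_lift (R Quot \<aa>) (\<lambda>Z Y. Z \<otimes>\<^bsub>R Quot \<aa>\<^esub> Y)"

text \<open>
  The type argument is the universe in which the projective resolution is taken.
\<close>

definition chosen_projective_resolution ::
  "'m itself \<Rightarrow> ('a, 'r) ring_scheme \<Rightarrow> ('a, 'n) module \<Rightarrow> ('a, 'm) cochain \<times> (int \<Rightarrow> 'm \<Rightarrow> 'n)"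
  where "chosen_projective_resolution _ R M = (SOME (P, \<epsilon>). projective_resolution R M P \<epsilon>)"

definition derived_tensor ::
  "'m itself \<Rightarrow> ('a, 'r) ring_scheme \<Rightarrow> ('a, 'b) bimodule \<Rightarrow> ('a, 'n) module \<Rightarrow>
    ('a, ('b \<times> 'm \<Rightarrow>\<^sub>0 int) set) cochain"
  where "derived_tensor U R B M = tensor_complex R B (fst (chosen_projective_resolution U R M))"

text \<open>
  The canonical morphism from the derived to the underived tensor product, induced by the
  augmentation \<open>\<epsilon>\<close>, is followed by the multiplication of the quotient ring. Outside degree 0 the
  target vanishes.
\<close>

definition canonical_mult ::
  "'m itself \<Rightarrow> ('a, 'r) ring_scheme \<Rightarrow> 'a set \<Rightarrow>
    int \<Rightarrow> ('a set \<times> 'm \<Rightarrow>\<^sub>0 int) set \<Rightarrow> 'a set"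
  where "canonical_mult U R \<aa> n Z = quotient_mult R \<aa>
    (tensor_map R (quotient_bimodule R \<aa>) (obj (stalk_complex (quotient_left R \<aa>)) n)
      (snd (chosen_projective_resolution U R (quotient_left R \<aa>)) n) Z)"

definition strongly_idempotent :: "'m itself \<Rightarrow> ('a, 'r) ring_scheme \<Rightarrow> 'a set \<Rightarrow> bool"
  where "strongly_idempotent U R \<aa> \<longleftrightarrow>
    quasi_iso R (derived_tensor U R (quotient_bimodule R \<aa>) (quotient_left R \<aa>))
      (stalk_complex (quotient_left R \<aa>)) (canonical_mult U R \<aa>)"

end

theory Submission
  imports Defs
begin

text \<open>
  Let \<open>B\<close> be the quotient of \<open>R\<close> by the ideal \<open>\<aa>\<close>, and \<open>T\<close> the class of modules killed by \<open>\<aa>\<close>. The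
  conceptual reason for the theorem is the adjunction
  \<open>RHom\<^sub>R(B, Hom\<^sub>R(B, E)) \<cong> Hom\<^sub>R(B \<otimes>\<^sup>L B, E)\<close> for injective \<open>E\<close>. When \<open>\<aa>\<close> is idempotent, the torsion
  functor of \<open>T\<close> is \<open>Hom\<^sub>R(B, -)\<close>, so the left side computes its derived functors on the torsion part
  of \<open>E\<close>; and there are enough injective modules to detect whether \<open>B \<otimes>\<^sup>L B\<close> has cohomology outside
  degree 0. Both conditions thus say that \<open>Tor\<^sub>i(B, B) = 0\<close> for \<open>i \<ge> 1\<close>.

  The proof works without double complexes or a theory of derived functors. Let \<open>P\<close> be a projective
  resolution of \<open>B\<close> with syzygies \<open>\<Omega>\<^sub>k \<subseteq> P\<^sub>k\<close>; here \<open>\<Omega>\<^sub>0\<close> is the kernel of the augmentation of \<open>P\<^sub>0\<close>.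
  Both sides of the equivalence are compared with the same elementary statement:

    (*) \<open>\<Omega>\<^sub>k \<inter> \<aa>P\<^sub>k = \<aa>\<Omega>\<^sub>k\<close> for all \<open>k \<ge> 0\<close>.

  On the tensor side, \<open>B \<otimes> P\<^sub>k\<close> is \<open>P\<^sub>k / \<aa>P\<^sub>k\<close> (lemmas \<open>unit_tensor_surj\<close>, \<open>unit_tensor_kernel\<close>), and
  exactness of these quotients in negative degrees is (*); the canonical map is always an isomorphism
  on cohomology in degree 0 (\<open>tensor_quasi_iso_iff\<close>).

  On the torsion side, let \<open>I\<close> be an injective resolution of \<open>N\<close>, the torsion submodule of an injective
  module \<open>E\<close>, with cocycles \<open>Z\<^sup>n\<close>. The cohomology of the torsion subcomplex vanishes in degree \<open>n + 1\<close> iff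
  homomorphisms \<open>B \<rightarrow> Z\<^sup>n\<^sup>+\<^sup>1\<close> lift to \<open>I\<^sup>n\<close>. This is a statement \<open>Ext\<^sup>1(B, Z\<^sup>n) = 0\<close>, which can be expressed
  either by lifting along an injective module or by extending homomorphisms from a submodule of a
  projective module. Switching between the two descriptions (\<open>hom_lifts_iff_extends\<close> and
  \<open>hom_extends_iff_lifts\<close>) moves one step down the injective and one step down the projective
  resolution at a time, until only \<open>N\<close> and \<open>\<Omega>\<^sub>n \<subseteq> P\<^sub>n\<close> are left: every homomorphism \<open>\<Omega>\<^sub>n \<rightarrow> N\<close> extends to
  \<open>P\<^sub>n\<close> (\<open>derived_torsion_zero_iff\<close>). As \<open>N\<close> is the part of \<open>E\<close> killed by \<open>\<aa>\<close>, such a homomorphism is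
  one from \<open>\<Omega>\<^sub>n / \<aa>\<Omega>\<^sub>n\<close> to \<open>E\<close>, and an extension is one from \<open>P\<^sub>n / \<aa>P\<^sub>n\<close> to \<open>E\<close>. So all of them extend, for
  all injective \<open>E\<close>, iff \<open>\<Omega>\<^sub>n / \<aa>\<Omega>\<^sub>n \<rightarrow> P\<^sub>n / \<aa>P\<^sub>n\<close> is injective, which is (*) again.

  Finally (*) for \<open>k = 0\<close> forces \<open>\<aa>\<close> to be idempotent, and for idempotent \<open>\<aa>\<close> the class \<open>T\<close> is a torsion
  class.

  Since both derived functors are defined through chosen resolutions, resolutions must be shown to exist
  within the given universe. Projective modules are obtained as free modules, injective ones as
  \<open>Hom\<^sub>\<int>(R, D)\<close> for a divisible group \<open>D\<close>; the closure condition on the universe is what makes room for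
  them.
\<close>

section \<open>Modules, submodules and linear maps\<close>

lemma (in abelian_group) diff_eq_zero_iff [simp]:
  assumes "x \<in> carrier G" "y \<in> carrier G"
  shows "x \<ominus> y = \<zero> \<longleftrightarrow> x = y"
proof
  assume "x \<ominus> y = \<zero>"
  then have "\<ominus> (\<ominus> y) = x" using assms by (intro minus_equality) (simp_all add: a_minus_def)
  then show "x = y" using assms by simp
qed (use assms in \<open>simp add: a_minus_def r_neg\<close>)

lemma (in abelian_group) diff_self [simp]: "x \<in> carrier G \<Longrightarrow> x \<ominus> x = \<zero>"
  by simp

lemma (in abelian_group) diff_zero [simp]: "x \<in> carrier G \<Longrightarrow> x \<ominus> \<zero> = x"
  by (simp add: a_minus_def)

lemma (in abelian_group) diff_add_diff:
  assumes "x \<in> carrier G" "y \<in> carrier G" "z \<in> carrier G"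
  shows "(x \<ominus> y) \<oplus> (y \<ominus> z) = x \<ominus> z"
  using assms by (simp add: a_minus_def a_assoc r_neg1)

lemma (in abelian_group) diff_diff_left:
  assumes "x \<in> carrier G" "y \<in> carrier G" "z \<in> carrier G"
  shows "(x \<ominus> z) \<ominus> (x \<ominus> y) = y \<ominus> z"
proof -
  have ab: "(b \<oplus> a) \<ominus> a = b" if "a \<in> carrier G" "b \<in> carrier G" for a b
    unfolding a_minus_def using that by (subst a_assoc) (simp_all add: r_neg)
  have "x \<ominus> z = (y \<ominus> z) \<oplus> (x \<ominus> y)"
    by (subst a_comm) (use assms diff_add_diff in simp_all)
  then show ?thesis using ab assms by simp
qed

lemma (in abelian_group) diff_diff_self:
  assumes "x \<in> carrier G" "y \<in> carrier G" shows "x \<ominus> (x \<ominus> y) = y"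
  using diff_diff_left[OF assms zero_closed] assms by simp

lemma (in abelian_group) add_diff_left:
  assumes "x \<in> carrier G" "y \<in> carrier G" shows "(x \<oplus> y) \<ominus> x = y"
proof -
  have "(x \<oplus> y) \<ominus> x = (y \<oplus> x) \<oplus> \<ominus> x" using assms by (simp add: a_minus_def a_comm)
  also have "\<dots> = y" using assms by (simp add: a_assoc r_neg)
  finally show ?thesis .
qed

context left_module
begin

lemmas [simp, intro] = smult_closed
lemmas [simp] = smult_one

lemma smult_l_null [simp]:
  assumes "x \<in> carrier M" shows "\<zero> \<odot>\<^bsub>M\<^esub> x = \<zero>\<^bsub>M\<^esub>"
proof -
  have "\<zero> \<odot>\<^bsub>M\<^esub> x \<oplus>\<^bsub>M\<^esub> \<zero> \<odot>\<^bsub>M\<^esub> x = \<zero> \<odot>\<^bsub>M\<^esub> x"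
    using smult_l_distr[of \<zero> \<zero> x] assms by simp
  then show ?thesis using assms by (metis M.add.r_cancel_one' R.zero_closed smult_closed)
qed

lemma smult_r_null [simp]:
  assumes "a \<in> carrier R" shows "a \<odot>\<^bsub>M\<^esub> \<zero>\<^bsub>M\<^esub> = \<zero>\<^bsub>M\<^esub>"
proof -
  have "a \<odot>\<^bsub>M\<^esub> \<zero>\<^bsub>M\<^esub> \<oplus>\<^bsub>M\<^esub> a \<odot>\<^bsub>M\<^esub> \<zero>\<^bsub>M\<^esub> = a \<odot>\<^bsub>M\<^esub> \<zero>\<^bsub>M\<^esub>"
    using smult_r_distr[of a "\<zero>\<^bsub>M\<^esub>" "\<zero>\<^bsub>M\<^esub>"] assms by simp
  then show ?thesis using assms by (metis M.add.r_cancel_one' M.zero_closed smult_closed)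
qed

lemma smult_l_minus:
  assumes "a \<in> carrier R" "x \<in> carrier M" shows "(\<ominus> a) \<odot>\<^bsub>M\<^esub> x = \<ominus>\<^bsub>M\<^esub> (a \<odot>\<^bsub>M\<^esub> x)"
proof -
  have "(\<ominus> a) \<odot>\<^bsub>M\<^esub> x \<oplus>\<^bsub>M\<^esub> a \<odot>\<^bsub>M\<^esub> x = \<zero>\<^bsub>M\<^esub>"
    using smult_l_distr[of "\<ominus> a" a x] assms by (simp add: R.l_neg)
  then show ?thesis using assms by (simp add: M.minus_equality)
qed

lemma smult_r_minus:
  assumes "a \<in> carrier R" "x \<in> carrier M" shows "a \<odot>\<^bsub>M\<^esub> (\<ominus>\<^bsub>M\<^esub> x) = \<ominus>\<^bsub>M\<^esub> (a \<odot>\<^bsub>M\<^esub> x)"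
proof -
  have "a \<odot>\<^bsub>M\<^esub> (\<ominus>\<^bsub>M\<^esub> x) \<oplus>\<^bsub>M\<^esub> a \<odot>\<^bsub>M\<^esub> x = \<zero>\<^bsub>M\<^esub>"
    using smult_r_distr[of a "\<ominus>\<^bsub>M\<^esub> x" x] assms by (simp add: M.l_neg)
  then show ?thesis using assms by (simp add: M.minus_equality)
qed

lemma smult_r_diff:
  assumes "a \<in> carrier R" "x \<in> carrier M" "y \<in> carrier M"
  shows "a \<odot>\<^bsub>M\<^esub> (x \<ominus>\<^bsub>M\<^esub> y) = a \<odot>\<^bsub>M\<^esub> x \<ominus>\<^bsub>M\<^esub> a \<odot>\<^bsub>M\<^esub> y"
  using assms by (simp add: a_minus_def smult_r_distr smult_r_minus)

lemma finsum_smult_r: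
  assumes "finite A" "a \<in> carrier R" "f \<in> A \<rightarrow> carrier M"
  shows "a \<odot>\<^bsub>M\<^esub> (\<Oplus>\<^bsub>M\<^esub>i\<in>A. f i) = (\<Oplus>\<^bsub>M\<^esub>i\<in>A. a \<odot>\<^bsub>M\<^esub> f i)"
  using assms by (induction A rule: finite_induct) (auto simp: Pi_def smult_r_distr)

lemma submoduleI:
  assumes "H \<subseteq> carrier M" "\<zero>\<^bsub>M\<^esub> \<in> H"
    and add: "\<And>x y. \<lbrakk>x \<in> H; y \<in> H\<rbrakk> \<Longrightarrow> x \<oplus>\<^bsub>M\<^esub> y \<in> H"
    and smult: "\<And>a x. \<lbrakk>a \<in> carrier R; x \<in> H\<rbrakk> \<Longrightarrow> a \<odot>\<^bsub>M\<^esub> x \<in> H"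
  shows "submodule H R M"
proof -
  have "\<ominus>\<^bsub>M\<^esub> x \<in> H" if "x \<in> H" for x
    using smult[of "\<ominus> \<one>" x] that smult_l_minus[of \<one> x] assms(1) by auto
  then show ?thesis
    using assms by unfold_locales (auto simp flip: a_inv_def)
qed

end

lemma left_moduleI:
  fixes R (structure) and M (structure)
  assumes "ring R" "abelian_group M"
    and "\<And>a x. \<lbrakk>a \<in> carrier R; x \<in> carrier M\<rbrakk> \<Longrightarrow> a \<odot>\<^bsub>M\<^esub> x \<in> carrier M"
    and "\<And>a b x. \<lbrakk>a \<in> carrier R; b \<in> carrier R; x \<in> carrier M\<rbrakk> \<Longrightarrow>
      (a \<oplus> b) \<odot>\<^bsub>M\<^esub> x = a \<odot>\<^bsub>M\<^esub> x \<oplus>\<^bsub>M\<^esub> b \<odot>\<^bsub>M\<^esub> x"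
    and "\<And>a x y. \<lbrakk>a \<in> carrier R; x \<in> carrier M; y \<in> carrier M\<rbrakk> \<Longrightarrow>
      a \<odot>\<^bsub>M\<^esub> (x \<oplus>\<^bsub>M\<^esub> y) = a \<odot>\<^bsub>M\<^esub> x \<oplus>\<^bsub>M\<^esub> a \<odot>\<^bsub>M\<^esub> y"
    and "\<And>a b x. \<lbrakk>a \<in> carrier R; b \<in> carrier R; x \<in> carrier M\<rbrakk> \<Longrightarrow>
      (a \<otimes> b) \<odot>\<^bsub>M\<^esub> x = a \<odot>\<^bsub>M\<^esub> (b \<odot>\<^bsub>M\<^esub> x)"
    and "\<And>x. x \<in> carrier M \<Longrightarrow> \<one> \<odot>\<^bsub>M\<^esub> x = x"
  shows "left_module R M"
  using assms by (intro left_module.intro left_module_axioms.intro) auto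

lemma submodule_zero_closed: "submodule K R M \<Longrightarrow> \<zero>\<^bsub>M\<^esub> \<in> K"
  using subgroup.one_closed[OF submodule.axioms(1)] by fastforce

lemma submodule_add_closed: "\<lbrakk>submodule K R M; x \<in> K; y \<in> K\<rbrakk> \<Longrightarrow> x \<oplus>\<^bsub>M\<^esub> y \<in> K"
  using subgroup.m_closed[OF submodule.axioms(1)] by fastforce

lemma submodule_subset: "submodule K R M \<Longrightarrow> K \<subseteq> carrier M"
  using subgroup.subset[OF submodule.axioms(1)] by fastforce

lemma submodule_minus_closed: "\<lbrakk>submodule K R M; x \<in> K\<rbrakk> \<Longrightarrow> \<ominus>\<^bsub>M\<^esub> x \<in> K"
  using subgroup.m_inv_closed[OF submodule.axioms(1)] by (fastforce simp: a_inv_def)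

lemma submodule_diff_closed: "\<lbrakk>submodule K R M; x \<in> K; y \<in> K\<rbrakk> \<Longrightarrow> x \<ominus>\<^bsub>M\<^esub> y \<in> K"
  by (simp add: a_minus_def submodule_add_closed submodule_minus_closed)

text \<open>
  Only the surjection is assumed to behave linearly: the module laws of \<open>N\<close> are inherited from
  \<open>M\<close>. This is how quotients and tensor products are recognised as modules.
\<close>

lemma left_module_surj_image:
  assumes M: "left_module R M" and surj: "f ` carrier M = carrier N"
    and add: "\<And>x y. \<lbrakk>x \<in> carrier M; y \<in> carrier M\<rbrakk> \<Longrightarrow> f (x \<oplus>\<^bsub>M\<^esub> y) = f x \<oplus>\<^bsub>N\<^esub> f y"
    and smult: "\<And>a x. \<lbrakk>a \<in> carrier R; x \<in> carrier M\<rbrakk> \<Longrightarrow> f (a \<odot>\<^bsub>M\<^esub> x) = a \<odot>\<^bsub>N\<^esub> f x"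
    and zero: "f \<zero>\<^bsub>M\<^esub> = \<zero>\<^bsub>N\<^esub>"
  shows "left_module R N" "f \<in> lin_hom R M N"
proof -
  interpret M: left_module R M by fact
  have *: "\<exists>x\<in>carrier M. u = f x" if "u \<in> carrier N" for u
    using that surj by blast
  have cl: "f x \<in> carrier N" if "x \<in> carrier M" for x
    using that surj by blast
  have 1: "u \<oplus>\<^bsub>N\<^esub> v \<in> carrier N" if "u \<in> carrier N" "v \<in> carrier N" for u v
    using *[OF that(1)] *[OF that(2)] cl by (auto simp flip: add)
  have 2: "u \<oplus>\<^bsub>N\<^esub> v \<oplus>\<^bsub>N\<^esub> w = u \<oplus>\<^bsub>N\<^esub> (v \<oplus>\<^bsub>N\<^esub> w)" if "u \<in> carrier N" "v \<in> carrier N" "w \<in> carrier N" for u v w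
    using *[OF that(1)] *[OF that(2)] *[OF that(3)] by (auto simp flip: add simp: M.M.add.m_assoc)
  have 3: "u \<oplus>\<^bsub>N\<^esub> v = v \<oplus>\<^bsub>N\<^esub> u" if "u \<in> carrier N" "v \<in> carrier N" for u v
    using *[OF that(1)] *[OF that(2)] by (auto simp flip: add simp: M.M.add.m_comm)
  have 4: "\<zero>\<^bsub>N\<^esub> \<oplus>\<^bsub>N\<^esub> u = u" if "u \<in> carrier N" for u
    using *[OF that] by (auto simp flip: add zero)
  have 5: "\<exists>v\<in>carrier N. v \<oplus>\<^bsub>N\<^esub> u = \<zero>\<^bsub>N\<^esub>" if "u \<in> carrier N" for u
  proof -
    obtain x where x: "x \<in> carrier M" "u = f x" using *[OF \<open>u \<in> carrier N\<close>] by blast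
    have "f (\<ominus>\<^bsub>M\<^esub> x) \<oplus>\<^bsub>N\<^esub> u = f (\<ominus>\<^bsub>M\<^esub> x \<oplus>\<^bsub>M\<^esub> x)" using x add by simp
    then show ?thesis using x cl by (metis M.M.a_inv_closed M.M.l_neg zero)
  qed
  have ab: "abelian_group N"
    by (rule abelian_groupI) (use 1 2 3 4 5 cl[of "\<zero>\<^bsub>M\<^esub>"] zero in auto)
  show "left_module R N"
  proof (rule left_moduleI[OF M.R.ring_axioms ab])
    fix a u assume "a \<in> carrier R" "u \<in> carrier N"
    then show "a \<odot>\<^bsub>N\<^esub> u \<in> carrier N" using *[of u] cl by (auto simp flip: smult)
  next
    fix a b u assume A: "a \<in> carrier R" "b \<in> carrier R" "u \<in> carrier N"
    then obtain x where x: "x \<in> carrier M" "u = f x" using * by blast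
    show "(a \<oplus>\<^bsub>R\<^esub> b) \<odot>\<^bsub>N\<^esub> u = a \<odot>\<^bsub>N\<^esub> u \<oplus>\<^bsub>N\<^esub> b \<odot>\<^bsub>N\<^esub> u"
      using A x by (simp flip: smult add add: M.smult_l_distr)
    show "(a \<otimes>\<^bsub>R\<^esub> b) \<odot>\<^bsub>N\<^esub> u = a \<odot>\<^bsub>N\<^esub> (b \<odot>\<^bsub>N\<^esub> u)"
      using A x by (simp flip: smult add: M.smult_assoc)
  next
    fix a u v assume A: "a \<in> carrier R" "u \<in> carrier N" "v \<in> carrier N"
    then obtain x y where x: "x \<in> carrier M" "u = f x" "y \<in> carrier M" "v = f y" using * by metis
    show "a \<odot>\<^bsub>N\<^esub> (u \<oplus>\<^bsub>N\<^esub> v) = a \<odot>\<^bsub>N\<^esub> u \<oplus>\<^bsub>N\<^esub> a \<odot>\<^bsub>N\<^esub> v"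
      using A x by (simp flip: smult add add: M.smult_r_distr)
  next
    fix u assume "u \<in> carrier N"
    then show "\<one>\<^bsub>R\<^esub> \<odot>\<^bsub>N\<^esub> u = u" using *[of u] by (auto simp flip: smult)
  qed
  show "f \<in> lin_hom R M N"
    using add smult cl by (simp add: lin_hom_def)
qed

lemma submodule_left_module:
  assumes M: "left_module R M" and K: "submodule K R M"
  shows "left_module R (M\<lparr>carrier := K\<rparr>)"
proof -
  interpret M: left_module R M by fact
  have sub: "K \<subseteq> carrier M" using K by (rule submodule_subset)
  note in_M = subsetD[OF sub]
  have "abelian_group (M\<lparr>carrier := K\<rparr>)"
  proof (rule abelian_groupI)
    fix x assume "x \<in> carrier (M\<lparr>carrier := K\<rparr>)"
    then show "\<exists>y\<in>carrier (M\<lparr>carrier := K\<rparr>). y \<oplus>\<^bsub>M\<lparr>carrier := K\<rparr>\<^esub> x = \<zero>\<^bsub>M\<lparr>carrier := K\<rparr>\<^esub>"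
      using submodule_minus_closed[OF K, of x] in_M M.M.l_neg by auto
  qed (use in_M submodule_add_closed[OF K] submodule_zero_closed[OF K] in
      \<open>auto simp: M.M.a_assoc intro: M.M.a_comm\<close>)
  then show ?thesis
    by (rule left_moduleI[OF M.R.ring_axioms])
      (use in_M submodule.smult_closed[OF K] in
        \<open>auto simp: M.smult_l_distr M.smult_r_distr M.smult_assoc\<close>)
qed

lemma submodule_carrier: "left_module R M \<Longrightarrow> submodule (carrier M) R M"
  by (rule left_module.submoduleI)
    (auto simp: left_module.smult_closed left_module_def abelian_group.axioms
      abelian_monoid.zero_closed abelian_monoid.a_closed)

lemma submodule_zero: "left_module R M \<Longrightarrow> submodule {\<zero>\<^bsub>M\<^esub>} R M"
proof -
  assume "left_module R M"
  then interpret left_module R M .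
  show ?thesis by (rule submoduleI) auto
qed

subsection \<open>Linear maps\<close>

lemma lin_homI:
  assumes "\<And>x. x \<in> carrier M \<Longrightarrow> h x \<in> carrier N"
    and "\<And>x y. \<lbrakk>x \<in> carrier M; y \<in> carrier M\<rbrakk> \<Longrightarrow> h (x \<oplus>\<^bsub>M\<^esub> y) = h x \<oplus>\<^bsub>N\<^esub> h y"
    and "\<And>a x. \<lbrakk>a \<in> carrier R; x \<in> carrier M\<rbrakk> \<Longrightarrow> h (a \<odot>\<^bsub>M\<^esub> x) = a \<odot>\<^bsub>N\<^esub> h x"
  shows "h \<in> lin_hom R M N"
  using assms by (simp add: lin_hom_def)

lemma lin_hom_closed: "\<lbrakk>h \<in> lin_hom R M N; x \<in> carrier M\<rbrakk> \<Longrightarrow> h x \<in> carrier N"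
  by (auto simp: lin_hom_def)

lemma lin_hom_add:
  "\<lbrakk>h \<in> lin_hom R M N; x \<in> carrier M; y \<in> carrier M\<rbrakk> \<Longrightarrow> h (x \<oplus>\<^bsub>M\<^esub> y) = h x \<oplus>\<^bsub>N\<^esub> h y"
  by (auto simp: lin_hom_def)

lemma lin_hom_smult:
  "\<lbrakk>h \<in> lin_hom R M N; a \<in> carrier R; x \<in> carrier M\<rbrakk> \<Longrightarrow> h (a \<odot>\<^bsub>M\<^esub> x) = a \<odot>\<^bsub>N\<^esub> h x"
  by (auto simp: lin_hom_def)

lemma lin_hom_zero:
  assumes "left_module R M" "left_module R N" and h: "h \<in> lin_hom R M N"
  shows "h \<zero>\<^bsub>M\<^esub> = \<zero>\<^bsub>N\<^esub>"
proof -
  interpret M: left_module R M by fact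
  interpret N: left_module R N by fact
  have "h \<zero>\<^bsub>M\<^esub> \<in> carrier N" using h by (simp add: lin_hom_closed)
  then show ?thesis
    using lin_hom_smult[OF h, of "\<zero>\<^bsub>R\<^esub>" "\<zero>\<^bsub>M\<^esub>"] by simp
qed

lemma lin_hom_minus:
  assumes "left_module R M" "left_module R N" and h: "h \<in> lin_hom R M N" and "x \<in> carrier M"
  shows "h (\<ominus>\<^bsub>M\<^esub> x) = \<ominus>\<^bsub>N\<^esub> h x"
proof -
  interpret M: left_module R M by fact
  interpret N: left_module R N by fact
  have "h x \<in> carrier N" using h \<open>x \<in> carrier M\<close> by (simp add: lin_hom_closed)
  then show ?thesis
    using lin_hom_smult[OF h, of "\<ominus>\<^bsub>R\<^esub> \<one>\<^bsub>R\<^esub>" x] \<open>x \<in> carrier M\<close> M.smult_l_minus N.smult_l_minus by simp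
qed

lemma lin_hom_diff:
  assumes "left_module R M" "left_module R N" and h: "h \<in> lin_hom R M N"
    and "x \<in> carrier M" "y \<in> carrier M"
  shows "h (x \<ominus>\<^bsub>M\<^esub> y) = h x \<ominus>\<^bsub>N\<^esub> h y"
proof -
  interpret M: left_module R M by fact
  show ?thesis
    using assms by (simp add: a_minus_def lin_hom_add[OF h] lin_hom_minus[OF assms(1-3)])
qed

lemma lin_hom_comp:
  assumes "f \<in> lin_hom R M N" "g \<in> lin_hom R N L"
  shows "(\<lambda>x. g (f x)) \<in> lin_hom R M L"
  using assms by (simp add: lin_hom_def Pi_def)

lemma lin_hom_cong:
  assumes "f \<in> lin_hom R M N" "left_module R M" "\<And>x. x \<in> carrier M \<Longrightarrow> f x = g x"
  shows "g \<in> lin_hom R M N"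
proof -
  interpret left_module R M by fact
  show ?thesis using assms(1) by (simp add: lin_hom_def Pi_def flip: assms(3))
qed

lemma lin_hom_restrict_dom: "\<lbrakk>h \<in> lin_hom R M N; K \<subseteq> carrier M\<rbrakk> \<Longrightarrow> h \<in> lin_hom R (M\<lparr>carrier := K\<rparr>) N"
  by (simp add: lin_hom_def Pi_def subset_iff)

lemma lin_hom_restrict_cod:
  "\<lbrakk>h \<in> lin_hom R M N; \<And>x. x \<in> carrier M \<Longrightarrow> h x \<in> K\<rbrakk> \<Longrightarrow> h \<in> lin_hom R M (N\<lparr>carrier := K\<rparr>)"
  by (auto simp: lin_hom_def)

lemma lin_hom_extend_cod:
  "\<lbrakk>h \<in> lin_hom R M (N\<lparr>carrier := K\<rparr>); K \<subseteq> carrier N\<rbrakk> \<Longrightarrow> h \<in> lin_hom R M N"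
  by (auto simp: lin_hom_def)

lemma lin_hom_inclusion: "K \<subseteq> carrier M \<Longrightarrow> (\<lambda>x. x) \<in> lin_hom R (M\<lparr>carrier := K\<rparr>) M"
  by (auto simp: lin_hom_def)

lemma lin_hom_subtract:
  assumes M: "left_module R M" and N: "left_module R N"
    and f: "f \<in> lin_hom R M N" and g: "g \<in> lin_hom R M N"
  shows "(\<lambda>x. f x \<ominus>\<^bsub>N\<^esub> g x) \<in> lin_hom R M N"
proof -
  interpret M: left_module R M by fact
  interpret N: left_module R N by fact
  note cl = lin_hom_closed[OF f] lin_hom_closed[OF g]
  show ?thesis
  proof (rule lin_homI)
    fix x y assume xy: "x \<in> carrier M" "y \<in> carrier M"
    show "f (x \<oplus>\<^bsub>M\<^esub> y) \<ominus>\<^bsub>N\<^esub> g (x \<oplus>\<^bsub>M\<^esub> y) = f x \<ominus>\<^bsub>N\<^esub> g x \<oplus>\<^bsub>N\<^esub> (f y \<ominus>\<^bsub>N\<^esub> g y)"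
      using xy cl
      by (simp add: lin_hom_add[OF f] lin_hom_add[OF g] N.M.minus_add a_minus_def N.M.a_ac)
  qed (use cl in \<open>auto simp: lin_hom_smult[OF f] lin_hom_smult[OF g] N.smult_r_diff\<close>)
qed

lemma lin_hom_image_submodule:
  assumes M: "left_module R M" and N: "left_module R N" and h: "h \<in> lin_hom R M N"
    and K: "submodule K R M"
  shows "submodule (h ` K) R N"
proof -
  interpret M: left_module R M by fact
  interpret N: left_module R N by fact
  note sub = submodule_subset[OF K]
  show ?thesis
  proof (rule N.submoduleI)
    show "\<zero>\<^bsub>N\<^esub> \<in> h ` K" using lin_hom_zero[OF M N h] submodule_zero_closed[OF K] by force
    show "h ` K \<subseteq> carrier N" using sub lin_hom_closed[OF h] by auto
    fix u v assume "u \<in> h ` K" "v \<in> h ` K"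
    then show "u \<oplus>\<^bsub>N\<^esub> v \<in> h ` K"
      using lin_hom_add[OF h] sub submodule_add_closed[OF K] by (smt (verit) imageE imageI subsetD)
  next
    fix a u assume "a \<in> carrier R" "u \<in> h ` K"
    then show "a \<odot>\<^bsub>N\<^esub> u \<in> h ` K"
      using lin_hom_smult[OF h] sub submodule.smult_closed[OF K] by (smt (verit) imageE imageI subsetD)
  qed
qed

lemma lin_kernel_submodule:
  assumes M: "left_module R M" and N: "left_module R N" and h: "h \<in> lin_hom R M N"
  shows "submodule (lin_kernel M N h) R M"
proof -
  interpret M: left_module R M by fact
  interpret N: left_module R N by fact
  show ?thesis
    by (rule M.submoduleI)
      (auto simp: lin_kernel_def lin_hom_zero[OF M N h] lin_hom_add[OF h] lin_hom_smult[OF h])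
qed

lemma lin_hom_eq_iff_diff_kernel:
  assumes M: "left_module R M" and N: "left_module R N" and h: "h \<in> lin_hom R M N"
    and xy: "x \<in> carrier M" "y \<in> carrier M"
  shows "h x = h y \<longleftrightarrow> h (x \<ominus>\<^bsub>M\<^esub> y) = \<zero>\<^bsub>N\<^esub>"
proof -
  interpret N: left_module R N by fact
  show ?thesis
    using lin_hom_diff[OF M N h xy] lin_hom_closed[OF h xy(1)] lin_hom_closed[OF h xy(2)]
    by simp
qed

text \<open>
  Maps out of a tensor product are only understood on the image of a surjection; linearity is tested
  there.
\<close>

lemma lin_hom_of_surj:
  assumes t: "t \<in> lin_hom R M T" and surj: "t ` carrier M = carrier T"
    and ft: "(\<lambda>x. f (t x)) \<in> lin_hom R M N" and M: "left_module R M"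
  shows "f \<in> lin_hom R T N"
proof -
  interpret M: left_module R M by (rule M)
  have *: "\<exists>x\<in>carrier M. u = t x" if "u \<in> carrier T" for u using that surj by blast
  show ?thesis
  proof (rule lin_homI)
    fix u assume "u \<in> carrier T"
    then show "f u \<in> carrier N" using * lin_hom_closed[OF ft] by blast
  next
    fix u v assume "u \<in> carrier T" "v \<in> carrier T"
    then obtain x y where xy: "x \<in> carrier M" "u = t x" "y \<in> carrier M" "v = t y" using * by blast
    show "f (u \<oplus>\<^bsub>T\<^esub> v) = f u \<oplus>\<^bsub>N\<^esub> f v"
      using lin_hom_add[OF ft xy(1,3)] lin_hom_add[OF t xy(1,3)] xy by simp
  next
    fix a u assume a: "a \<in> carrier R" and "u \<in> carrier T"
    then obtain x where x: "x \<in> carrier M" "u = t x" using * by blast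
    show "f (a \<odot>\<^bsub>T\<^esub> u) = a \<odot>\<^bsub>N\<^esub> f u"
      using lin_hom_smult[OF ft a x(1)] lin_hom_smult[OF t a x(1)] x by simp
  qed
qed

lemma lin_hom_factor:
  assumes M: "left_module R M" and Q: "left_module R Q" and N: "left_module R N"
    and p: "p \<in> lin_hom R M Q" and surj: "p ` carrier M = carrier Q"
    and g: "g \<in> lin_hom R M N"
    and van: "\<And>x. \<lbrakk>x \<in> carrier M; p x = \<zero>\<^bsub>Q\<^esub>\<rbrakk> \<Longrightarrow> g x = \<zero>\<^bsub>N\<^esub>"
  obtains h where "h \<in> lin_hom R Q N" "\<forall>x\<in>carrier M. h (p x) = g x"
proof
  interpret M: left_module R M by fact
  let ?s = "inv_into (carrier M) p"
  have s: "?s u \<in> carrier M" "p (?s u) = u" if "u \<in> carrier Q" for u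
    using that surj inv_into_into[of u p "carrier M"] f_inv_into_f[of u p "carrier M"] by auto
  have *: "g (?s (p x)) = g x" if x: "x \<in> carrier M" for x
  proof -
    have px: "p x \<in> carrier Q" using lin_hom_closed[OF p x] .
    have "p (?s (p x) \<ominus>\<^bsub>M\<^esub> x) = \<zero>\<^bsub>Q\<^esub>"
      using lin_hom_eq_iff_diff_kernel[OF M Q p] s[OF px] x by blast
    then have "g (?s (p x) \<ominus>\<^bsub>M\<^esub> x) = \<zero>\<^bsub>N\<^esub>"
      using van s[OF px] x by simp
    then show ?thesis using lin_hom_eq_iff_diff_kernel[OF M N g] s[OF px] x by blast
  qed
  then show "\<forall>x\<in>carrier M. g (?s (p x)) = g x" by blast
  show "(\<lambda>u. g (?s u)) \<in> lin_hom R Q N"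
  proof (rule lin_homI)
    fix u v assume uv: "u \<in> carrier Q" "v \<in> carrier Q"
    have "g (?s (u \<oplus>\<^bsub>Q\<^esub> v)) = g (?s (p (?s u \<oplus>\<^bsub>M\<^esub> ?s v)))"
      using lin_hom_add[OF p] s uv by simp
    also have "\<dots> = g (?s u) \<oplus>\<^bsub>N\<^esub> g (?s v)"
      using * lin_hom_add[OF g] s uv by simp
    finally show "g (?s (u \<oplus>\<^bsub>Q\<^esub> v)) = g (?s u) \<oplus>\<^bsub>N\<^esub> g (?s v)" .
  next
    fix a u assume u: "a \<in> carrier R" "u \<in> carrier Q"
    have "g (?s (a \<odot>\<^bsub>Q\<^esub> u)) = g (?s (p (a \<odot>\<^bsub>M\<^esub> ?s u)))"
      using lin_hom_smult[OF p] s u by simp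
    also have "\<dots> = a \<odot>\<^bsub>N\<^esub> g (?s u)"
      using * lin_hom_smult[OF g] s u by simp
    finally show "g (?s (a \<odot>\<^bsub>Q\<^esub> u)) = a \<odot>\<^bsub>N\<^esub> g (?s u)" .
  qed (use s lin_hom_closed[OF g] in auto)
qed

lemma lin_hom_inverse:
  assumes M: "left_module R M" and N: "left_module R N"
    and f: "f \<in> lin_hom R M N" and inj: "inj_on f (carrier M)" and surj: "f ` carrier M = carrier N"
  obtains g where "g \<in> lin_hom R N M" "\<forall>x\<in>carrier M. g (f x) = x" "\<forall>y\<in>carrier N. f (g y) = y"
proof -
  interpret M: left_module R M by fact
  have id: "(\<lambda>x. x) \<in> lin_hom R M M" by (rule lin_homI) auto
  have "x = \<zero>\<^bsub>M\<^esub>" if "x \<in> carrier M" "f x = \<zero>\<^bsub>N\<^esub>" for x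
    using inj_onD[OF inj, of x "\<zero>\<^bsub>M\<^esub>"] that lin_hom_zero[OF M N f] by simp
  from lin_hom_factor[OF M N M f surj id this]
  obtain g where g: "g \<in> lin_hom R N M" "\<forall>x\<in>carrier M. g (f x) = x"
    by blast
  moreover have "\<forall>y\<in>carrier N. f (g y) = y"
  proof
    fix y assume "y \<in> carrier N"
    then obtain x where "x \<in> carrier M" "y = f x" using surj by blast
    then show "f (g y) = y" using g(2) by simp
  qed
  ultimately show ?thesis by (rule that)
qed

subsection \<open>Quotients inside a given type\<close>

text \<open>
  A linear structure can be pushed forward along any map \<open>f\<close> whose fibres are the cosets of a
  submodule. Letting \<open>f\<close> pick coset representatives gives quotients without leaving the type of the
  module; letting \<open>f\<close> be injective transports a module to another type.
\<close>

lemma push_forward_module: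
  fixes M :: "('a, 'x) module" and f :: "'x \<Rightarrow> 'y"
  assumes M: "left_module R M" and K: "submodule K R M"
    and fib: "\<And>x y. \<lbrakk>x \<in> carrier M; y \<in> carrier M\<rbrakk> \<Longrightarrow> f x = f y \<longleftrightarrow> x \<ominus>\<^bsub>M\<^esub> y \<in> K"
  obtains Q :: "('a, 'y) module" where "left_module R Q" "f \<in> lin_hom R M Q"
    "f ` carrier M = carrier Q" "\<And>x. x \<in> carrier M \<Longrightarrow> f x = \<zero>\<^bsub>Q\<^esub> \<longleftrightarrow> x \<in> K"
proof -
  interpret M: left_module R M by fact
  let ?s = "inv_into (carrier M) f"
  have s: "?s (f x) \<in> carrier M" "f (?s (f x)) = f x" if "x \<in> carrier M" for x
    using that inv_into_into[of "f x" f "carrier M"] f_inv_into_f[of "f x" f "carrier M"] by auto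
  define Q :: "('a, 'y) module" where "Q = \<lparr>carrier = f ` carrier M, monoid.mult = undefined,
    monoid.one = undefined, ring.zero = f \<zero>\<^bsub>M\<^esub>, ring.add = (\<lambda>u v. f (?s u \<oplus>\<^bsub>M\<^esub> ?s v)),
    smult = (\<lambda>a u. f (a \<odot>\<^bsub>M\<^esub> ?s u))\<rparr>"
  have add: "f (x \<oplus>\<^bsub>M\<^esub> y) = f x \<oplus>\<^bsub>Q\<^esub> f y" if xy: "x \<in> carrier M" "y \<in> carrier M" for x y
  proof -
    have "(x \<ominus>\<^bsub>M\<^esub> ?s (f x)) \<oplus>\<^bsub>M\<^esub> (y \<ominus>\<^bsub>M\<^esub> ?s (f y)) \<in> K"
      using xy s fib by (intro submodule_add_closed[OF K]) metis+
    also have "(x \<ominus>\<^bsub>M\<^esub> ?s (f x)) \<oplus>\<^bsub>M\<^esub> (y \<ominus>\<^bsub>M\<^esub> ?s (f y)) = (x \<oplus>\<^bsub>M\<^esub> y) \<ominus>\<^bsub>M\<^esub> (?s (f x) \<oplus>\<^bsub>M\<^esub> ?s (f y))"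
      using xy s by (simp add: a_minus_def M.M.minus_add M.M.a_ac)
    finally show ?thesis using fib xy s by (simp add: Q_def)
  qed
  have smult: "f (a \<odot>\<^bsub>M\<^esub> x) = a \<odot>\<^bsub>Q\<^esub> f x" if ax: "a \<in> carrier R" "x \<in> carrier M" for a x
  proof -
    have "a \<odot>\<^bsub>M\<^esub> (x \<ominus>\<^bsub>M\<^esub> ?s (f x)) \<in> K"
      using ax s fib by (intro submodule.smult_closed[OF K]) metis+
    then have "a \<odot>\<^bsub>M\<^esub> x \<ominus>\<^bsub>M\<^esub> a \<odot>\<^bsub>M\<^esub> ?s (f x) \<in> K"
      using ax s by (simp add: M.smult_r_diff)
    then show ?thesis using fib ax s by (simp add: Q_def)
  qed
  have "f x = \<zero>\<^bsub>Q\<^esub> \<longleftrightarrow> x \<in> K" if "x \<in> carrier M" for x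
    using fib[of x "\<zero>\<^bsub>M\<^esub>"] that by (simp add: Q_def)
  moreover have "f ` carrier M = carrier Q" by (simp add: Q_def)
  moreover have "f \<zero>\<^bsub>M\<^esub> = \<zero>\<^bsub>Q\<^esub>" by (simp add: Q_def)
  ultimately show ?thesis
    using that left_module_surj_image[OF M _ add smult] by blast
qed

lemma quotient_exists:
  fixes M :: "('a, 'm) module"
  assumes M: "left_module R M" and K: "submodule K R M"
  obtains Q :: "('a, 'm) module" and p where "left_module R Q" "p \<in> lin_hom R M Q"
    "p ` carrier M = carrier Q" "\<forall>x\<in>carrier M. p x = \<zero>\<^bsub>Q\<^esub> \<longleftrightarrow> x \<in> K"
proof -
  interpret M: left_module R M by fact
  \<comment> \<open>a choice of coset representatives\<close>
  let ?C = "\<lambda>x. {y \<in> carrier M. x \<ominus>\<^bsub>M\<^esub> y \<in> K}"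
  let ?f = "\<lambda>x. SOME y. y \<in> ?C x"
  have f: "?f x \<in> carrier M \<and> x \<ominus>\<^bsub>M\<^esub> ?f x \<in> K" if "x \<in> carrier M" for x
    using someI[of "\<lambda>y. y \<in> ?C x" x] that submodule_zero_closed[OF K] M.M.diff_self[OF that] by simp
  have fib: "?f x = ?f y \<longleftrightarrow> x \<ominus>\<^bsub>M\<^esub> y \<in> K" if xy: "x \<in> carrier M" "y \<in> carrier M" for x y
  proof
    assume d: "x \<ominus>\<^bsub>M\<^esub> y \<in> K"
    have "x \<ominus>\<^bsub>M\<^esub> z \<in> K \<longleftrightarrow> y \<ominus>\<^bsub>M\<^esub> z \<in> K" if z: "z \<in> carrier M" for z
    proof
      assume *: "x \<ominus>\<^bsub>M\<^esub> z \<in> K"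
      have "(x \<ominus>\<^bsub>M\<^esub> z) \<ominus>\<^bsub>M\<^esub> (x \<ominus>\<^bsub>M\<^esub> y) = y \<ominus>\<^bsub>M\<^esub> z"
        using xy z by (simp add: M.M.diff_diff_left)
      then show "y \<ominus>\<^bsub>M\<^esub> z \<in> K" using submodule_diff_closed[OF K * d] by simp
    next
      assume *: "y \<ominus>\<^bsub>M\<^esub> z \<in> K"
      show "x \<ominus>\<^bsub>M\<^esub> z \<in> K"
        using submodule_add_closed[OF K d *] M.M.diff_add_diff[of x y z] xy z by simp
    qed
    then have "?C x = ?C y" by blast
    then show "?f x = ?f y" by simp
  next
    assume *: "?f x = ?f y"
    have "x \<ominus>\<^bsub>M\<^esub> ?f x \<in> K" "y \<ominus>\<^bsub>M\<^esub> ?f x \<in> K" "?f x \<in> carrier M"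
      using f[OF xy(1)] f[OF xy(2)] * by simp_all
    then have "(x \<ominus>\<^bsub>M\<^esub> ?f x) \<oplus>\<^bsub>M\<^esub> (?f x \<ominus>\<^bsub>M\<^esub> y) \<in> K"
      using submodule_minus_closed[OF K, of "y \<ominus>\<^bsub>M\<^esub> ?f x"] xy
      by (intro submodule_add_closed[OF K]) (simp_all add: a_minus_def M.M.minus_add M.M.a_comm)
    then show "x \<ominus>\<^bsub>M\<^esub> y \<in> K"
      using M.M.diff_add_diff[of x "?f x" y] xy \<open>?f x \<in> carrier M\<close> by simp
  qed
  define f where "f = ?f"
  have "f x = f y \<longleftrightarrow> x \<ominus>\<^bsub>M\<^esub> y \<in> K" if "x \<in> carrier M" "y \<in> carrier M" for x y
    using fib[OF that] by (simp add: f_def)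
  note fib = this
  show ?thesis
  proof (rule push_forward_module[OF M K fib])
    fix Q :: "('a, 'm) module"
    assume "left_module R Q" "f \<in> lin_hom R M Q" "f ` carrier M = carrier Q"
      "\<And>x. x \<in> carrier M \<Longrightarrow> (f x = \<zero>\<^bsub>Q\<^esub>) = (x \<in> K)"
    then show thesis by (intro that) auto
  qed
qed

lemma transport_module:
  fixes M :: "('a, 'x) module" and f :: "'x \<Rightarrow> 'y"
  assumes M: "left_module R M" and inj: "inj_on f (carrier M)"
  obtains N :: "('a, 'y) module" where "left_module R N" "f \<in> lin_hom R M N"
    "f ` carrier M = carrier N"
proof -
  interpret M: left_module R M by fact
  have "f x = f y \<longleftrightarrow> x \<ominus>\<^bsub>M\<^esub> y \<in> {\<zero>\<^bsub>M\<^esub>}" if "x \<in> carrier M" "y \<in> carrier M" for x y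
    using inj_on_eq_iff[OF inj that] M.M.diff_eq_zero_iff[OF that] by simp
  note fib = this
  show ?thesis
  proof (rule push_forward_module[OF M submodule_zero[OF M] fib])
    fix Q :: "('a, 'y) module"
    assume "left_module R Q" "f \<in> lin_hom R M Q" "f ` carrier M = carrier Q"
    then show thesis by (rule that)
  qed
qed

section \<open>Cardinalities inside the universe\<close>

text \<open>
  The single injection of \<open>nat \<Rightarrow> 'a \<Rightarrow> 'm\<close> into \<open>'m\<close> codes elements of \<open>'a\<close> by characteristic functions,
  pairs by sequences, and functions on \<open>'a\<close> by constant sequences.
\<close>

lemma module_universe_embeddings:
  assumes "module_universe TYPE('a) TYPE('m)"
  shows "infinite (UNIV :: 'm set)"
    and "\<exists>f :: 'a \<Rightarrow> 'm. inj f"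
    and "\<exists>f :: 'm \<times> 'm \<Rightarrow> 'm. inj f"
    and "\<exists>f :: ('a \<Rightarrow> 'm) \<Rightarrow> 'm. inj f"
proof -
  obtain u v :: 'm and \<phi> :: "(nat \<Rightarrow> 'a \<Rightarrow> 'm) \<Rightarrow> 'm" where uv: "u \<noteq> v" and \<phi>: "inj \<phi>"
    using assms unfolding module_universe_def by blast
  have eq: "F n b = G n b" if "\<phi> F = \<phi> G" for F G n b
    using injD[OF \<phi>, OF that] by simp
  have "inj (\<lambda>n. \<phi> (\<lambda>k _. if k = n then u else v))"
  proof (rule injI)
    fix n n' :: nat
    assume "\<phi> (\<lambda>k _. if k = n then u else v) = \<phi> (\<lambda>k _. if k = n' then u else v)"
    from eq[OF this, of n] uv show "n = n'" by (auto split: if_splits)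
  qed
  then show "infinite (UNIV :: 'm set)"
    using infinite_iff_countable_subset by blast
  have "inj (\<lambda>a. \<phi> (\<lambda>_ b. if b = a then u else v))"
  proof (rule injI)
    fix a a' :: 'a
    assume "\<phi> (\<lambda>_ b. if b = a then u else v) = \<phi> (\<lambda>_ b. if b = a' then u else v)"
    from eq[OF this, of a] uv show "a = a'" by (auto split: if_splits)
  qed
  then show "\<exists>f :: 'a \<Rightarrow> 'm. inj f" by blast
  have "inj (\<lambda>p. \<phi> (\<lambda>n _. if n = 0 then fst p else snd p))"
  proof (rule injI)
    fix p q :: "'m \<times> 'm"
    assume *: "\<phi> (\<lambda>n _. if n = 0 then fst p else snd p) = \<phi> (\<lambda>n _. if n = 0 then fst q else snd q)"
    from eq[OF *, of 0] eq[OF *, of 1] show "p = q" by (simp add: prod_eq_iff)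
  qed
  then show "\<exists>f :: 'm \<times> 'm \<Rightarrow> 'm. inj f" by blast
  have "inj (\<lambda>h. \<phi> (\<lambda>_. h))"
  proof (rule injI, rule ext)
    fix g h :: "'a \<Rightarrow> 'm" and b
    assume *: "\<phi> (\<lambda>_. g) = \<phi> (\<lambda>_. h)"
    from eq[OF *] show "g b = h b" .
  qed
  then show "\<exists>f :: ('a \<Rightarrow> 'm) \<Rightarrow> 'm. inj f" by blast
qed

text \<open>
  This bounds the size of free modules and of divisible hulls: a finitely supported function is
  determined by the finite part of its graph where it differs from \<open>z\<close>, and an infinite set has as
  many finite subsets as elements.
\<close>

lemma finite_support_functions_embed:
  fixes z :: 'b
  assumes U: "module_universe TYPE('a) TYPE('m)" and b: "\<exists>f :: 'b \<Rightarrow> 'm. inj f"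
  shows "\<exists>g :: ('m \<Rightarrow> 'b) \<Rightarrow> 'm. inj_on g {c. finite {x. c x \<noteq> z}}"
proof -
  note univ = module_universe_embeddings[OF U]
  have inf: "infinite (UNIV :: ('m \<times> 'b) set)"
    using univ(1) by (simp add: finite_prod)
  obtain f :: "'b \<Rightarrow> 'm" and g :: "'m \<times> 'm \<Rightarrow> 'm" where fg: "inj f" "inj g"
    using b univ(3) by blast
  have "inj (\<lambda>p. g (fst p, f (snd p)))"
    using inj_eq[OF fg(1)] inj_eq[OF fg(2)] by (intro injI) (simp add: prod_eq_iff)
  then have *: "(UNIV :: ('m \<times> 'b) set) \<lesssim> (UNIV :: 'm set)"
    unfolding lepoll_def by (intro exI[of _ "\<lambda>p. g (fst p, f (snd p))"]) simp
  have "{c :: 'm \<Rightarrow> 'b. finite {x. c x \<noteq> z}} \<lesssim> Fpow (UNIV \<times> UNIV :: ('m \<times> 'b) set)"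
    using lepoll_restricted_funspace[of "UNIV :: 'm set" "UNIV :: 'b set" "\<lambda>_. z"] by simp
  also have "\<dots> \<approx> (UNIV :: ('m \<times> 'b) set)"
    using eqpoll_Fpow[OF inf] by simp
  also note *
  finally show ?thesis unfolding lepoll_def by blast
qed

section \<open>Divisible abelian groups are injective\<close>

definition divisible_group :: "('d, 'r) monoid_scheme \<Rightarrow> bool"
  where "divisible_group D \<longleftrightarrow> comm_group D \<and>
    (\<forall>d\<in>carrier D. \<forall>n::nat. n > 0 \<longrightarrow> (\<exists>e\<in>carrier D. e [^]\<^bsub>D\<^esub> n = d))"

text \<open>
  A partial homomorphism is treated as its graph \<open>S\<close>, a subgroup of the product. If \<open>k\<close> is the least
  positive exponent for which \<open>x\<^sup>k\<close> lies in the domain, the exponents with this property are the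
  multiples of \<open>k\<close>, so the image of \<open>x\<close> may be any \<open>k\<close>-th root of the value at \<open>x\<^sup>k\<close>. If there is no
  such \<open>k\<close>, any image is compatible.
\<close>

lemma divisible_root_compatible:
  assumes G: "comm_group G" and D: "divisible_group D"
    and S: "subgroup S (G \<times>\<times> D)" and x: "x \<in> carrier G"
  obtains d where "d \<in> carrier D"
    "\<And>n::int. x [^]\<^bsub>G\<^esub> n \<in> fst ` S \<Longrightarrow> (x, d) [^]\<^bsub>G \<times>\<times> D\<^esub> n \<in> S"
proof -
  interpret G: comm_group G by fact
  interpret D: comm_group D using D by (simp add: divisible_group_def)
  interpret P: group "G \<times>\<times> D" by (rule DirProd_group) (simp_all add: G.is_group D.is_group)
  have pow: "(y, d) [^]\<^bsub>G \<times>\<times> D\<^esub> n = (y [^]\<^bsub>G\<^esub> n, d [^]\<^bsub>D\<^esub> n)"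
    if "y \<in> carrier G" "d \<in> carrier D" for y d and n :: int
  proof -
    have "group_hom (G \<times>\<times> D) G fst" "group_hom (G \<times>\<times> D) D snd"
      by (auto simp: group_hom_def group_hom_axioms_def hom_def mult_DirProd' P.is_group G.is_group D.is_group)
    from group_hom.hom_int_pow[OF this(1), of "(y, d)" n] group_hom.hom_int_pow[OF this(2), of "(y, d)" n]
    show ?thesis using that by (metis SigmaI carrier_DirProd fst_conv prod.collapse snd_conv)
  qed
  let ?N = "{n::nat. n > 0 \<and> x [^]\<^bsub>G\<^esub> int n \<in> fst ` S}"
  have sub: "subgroup (fst ` S) G"
  proof -
    have "group_hom (G \<times>\<times> D) G fst"
      by (auto simp: group_hom_def group_hom_axioms_def hom_def mult_DirProd' P.is_group G.is_group)
    from group_hom.subgroup_img_is_subgroup[OF this S] show ?thesis .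
  qed
  have neg: "x [^]\<^bsub>G\<^esub> (- n) \<in> fst ` S" if "x [^]\<^bsub>G\<^esub> n \<in> fst ` S" for n :: int
    using subgroup.m_inv_closed[OF sub that] x by (simp add: G.int_pow_neg)
  show ?thesis
  proof (cases "?N = {}")
    case True
    show ?thesis
    proof
      show "\<one>\<^bsub>D\<^esub> \<in> carrier D" by simp
      fix n :: int assume n: "x [^]\<^bsub>G\<^esub> n \<in> fst ` S"
      have no: "\<not> (m > 0 \<and> x [^]\<^bsub>G\<^esub> m \<in> fst ` S)" for m :: int
      proof
        assume "m > 0 \<and> x [^]\<^bsub>G\<^esub> m \<in> fst ` S"
        then have "nat m \<in> ?N" by simp
        with True show False by blast
      qed
      have "n = 0" using no[of n] no[of "- n"] n neg[OF n] by linarith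
      then show "(x, \<one>\<^bsub>D\<^esub>) [^]\<^bsub>G \<times>\<times> D\<^esub> n \<in> S" using subgroup.one_closed[OF S] by simp
    qed
  next
    case False
    define k where "k = (LEAST n. n \<in> ?N)"
    obtain k0 where "k0 \<in> ?N" using False by blast
    then have "k \<in> ?N" unfolding k_def by (rule LeastI)
    then have k: "k > 0" "x [^]\<^bsub>G\<^esub> int k \<in> fst ` S" by auto
    have least: "k \<le> n" if "n \<in> ?N" for n unfolding k_def using that by (rule Least_le)
    from k(2) obtain d0 where d0: "(x [^]\<^bsub>G\<^esub> int k, d0) \<in> S" by force
    then have "d0 \<in> carrier D" using subgroup.subset[OF S] by auto
    then obtain d where d: "d \<in> carrier D" "d [^]\<^bsub>D\<^esub> k = d0"
      using D k(1) unfolding divisible_group_def by blast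
    have zk: "(x, d) [^]\<^bsub>G \<times>\<times> D\<^esub> int k \<in> S"
      using d0 d pow[OF x d(1), of "int k"] by (simp add: int_pow_int)
    show ?thesis
    proof
      show "d \<in> carrier D" by fact
      fix n :: int assume n: "x [^]\<^bsub>G\<^esub> n \<in> fst ` S"
      let ?r = "n mod int k"
      have "x [^]\<^bsub>G\<^esub> ?r = x [^]\<^bsub>G\<^esub> (n + int k * (- (n div int k)))"
        using minus_mult_div_eq_mod[of n "int k"] by simp
      also have "\<dots> = x [^]\<^bsub>G\<^esub> n \<otimes>\<^bsub>G\<^esub> (x [^]\<^bsub>G\<^esub> int k) [^]\<^bsub>G\<^esub> (- (n div int k))"
        using x by (simp only: G.int_pow_pow G.int_pow_mult)
      also have "\<dots> \<in> fst ` S"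
        by (intro subgroup.m_closed[OF sub] n G.subgroup_int_pow_closed[OF sub] k(2))
      finally have r: "x [^]\<^bsub>G\<^esub> ?r \<in> fst ` S" .
      have "\<not> 0 < ?r"
      proof
        assume "0 < ?r"
        then have "nat ?r \<in> ?N" using r by simp
        from least[OF this] have "int k \<le> ?r" using k(1) by linarith
        then show False using pos_mod_bound[of "int k" n] k(1) by linarith
      qed
      then have "?r = 0" using k(1) pos_mod_sign[of "int k" n] by linarith
      then have nk: "int k * (n div int k) = n" using mult_div_mod_eq[of "int k" n] by linarith
      have "(x, d) [^]\<^bsub>G \<times>\<times> D\<^esub> n = ((x, d) [^]\<^bsub>G \<times>\<times> D\<^esub> int k) [^]\<^bsub>G \<times>\<times> D\<^esub> (n div int k)"
        using x d(1) by (subst P.int_pow_pow) (simp_all add: nk)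
      also have "\<dots> \<in> S" by (rule P.subgroup_int_pow_closed[OF S zk])
      finally show "(x, d) [^]\<^bsub>G \<times>\<times> D\<^esub> n \<in> S" .
    qed
  qed
qed

text \<open>
  A maximal partial extension exists by Zorn's lemma, and it is total because any further element can be
  adjoined, with the compatible image of the previous lemma.
\<close>

lemma divisible_group_extends_hom:
  assumes G: "comm_group G" and D: "divisible_group D" and H: "subgroup H G"
    and \<gamma>: "\<gamma> \<in> hom (G\<lparr>carrier := H\<rparr>) D"
  obtains \<gamma>' where "\<gamma>' \<in> hom G D" "\<And>x. x \<in> H \<Longrightarrow> \<gamma>' x = \<gamma> x"
proof -
  interpret G: comm_group G by fact
  interpret D: comm_group D using D by (simp add: divisible_group_def)
  interpret P: comm_group "G \<times>\<times> D"
    by (rule group.group_comm_groupI)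
      (auto simp: DirProd_group G.is_group D.is_group mult_DirProd' G.m_comm D.m_comm)
  interpret H: group "G\<lparr>carrier := H\<rparr>" by (rule G.subgroup_imp_group[OF H])
  interpret \<gamma>: group_hom "G\<lparr>carrier := H\<rparr>" D \<gamma>
    by (simp add: group_hom_def group_hom_axioms_def \<gamma> H.is_group D.is_group)
  let ?\<Gamma> = "(\<lambda>x. (x, \<gamma> x)) ` H"
  let ?\<S> = "{S. subgroup S (G \<times>\<times> D) \<and> ?\<Gamma> \<subseteq> S \<and> (\<forall>d. (\<one>\<^bsub>G\<^esub>, d) \<in> S \<longrightarrow> d = \<one>\<^bsub>D\<^esub>)}"
  have HG: "x \<in> carrier G" if "x \<in> H" for x using that subgroup.mem_carrier[OF H] by blast
  have \<gamma>_closed: "\<gamma> x \<in> carrier D" if "x \<in> H" for x using \<gamma>.hom_closed[of x] that by simp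
  have \<gamma>_mult: "\<gamma> (x \<otimes>\<^bsub>G\<^esub> y) = \<gamma> x \<otimes>\<^bsub>D\<^esub> \<gamma> y" if "x \<in> H" "y \<in> H" for x y
    using \<gamma>.hom_mult[of x y] that by simp
  have \<gamma>_inv: "\<gamma> (inv\<^bsub>G\<^esub> x) = inv\<^bsub>D\<^esub> \<gamma> x" if "x \<in> H" for x
    using \<gamma>.hom_inv[of x] that G.m_inv_consistent[OF H that] by simp
  have \<gamma>_one: "\<gamma> \<one>\<^bsub>G\<^esub> = \<one>\<^bsub>D\<^esub>" using \<gamma>.hom_one by simp
  have "subgroup ?\<Gamma> (G \<times>\<times> D)"
  proof (rule P.subgroupI)
    show "?\<Gamma> \<subseteq> carrier (G \<times>\<times> D)" using HG \<gamma>_closed by auto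
    show "?\<Gamma> \<noteq> {}" using subgroup.one_closed[OF H] by blast
    fix p assume "p \<in> ?\<Gamma>"
    then obtain x where x: "x \<in> H" "p = (x, \<gamma> x)" by blast
    then have "inv\<^bsub>G \<times>\<times> D\<^esub> p = (inv\<^bsub>G\<^esub> x, \<gamma> (inv\<^bsub>G\<^esub> x))"
      using HG \<gamma>_closed \<gamma>_inv by (simp add: inv_DirProd G.is_group D.is_group)
    then show "inv\<^bsub>G \<times>\<times> D\<^esub> p \<in> ?\<Gamma>" using subgroup.m_inv_closed[OF H x(1)] by blast
    fix q assume "q \<in> ?\<Gamma>"
    then obtain y where y: "y \<in> H" "q = (y, \<gamma> y)" by blast
    then have "p \<otimes>\<^bsub>G \<times>\<times> D\<^esub> q = (x \<otimes>\<^bsub>G\<^esub> y, \<gamma> (x \<otimes>\<^bsub>G\<^esub> y))"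
      using x \<gamma>_mult by simp
    then show "p \<otimes>\<^bsub>G \<times>\<times> D\<^esub> q \<in> ?\<Gamma>" using subgroup.m_closed[OF H x(1) y(1)] by blast
  qed
  then have ne: "?\<Gamma> \<in> ?\<S>" using \<gamma>_one by auto
  have chain: "\<Union>\<C> \<in> ?\<S>" if "\<C> \<noteq> {}" "subset.chain ?\<S> \<C>" for \<C>
  proof -
    have C: "S \<in> ?\<S>" if "S \<in> \<C>" for S using \<open>subset.chain ?\<S> \<C>\<close> that by (auto simp: subset_chain_def)
    have lin: "S \<subseteq> T \<or> T \<subseteq> S" if "S \<in> \<C>" "T \<in> \<C>" for S T
      using \<open>subset.chain ?\<S> \<C>\<close> that by (auto simp: subset_chain_def)
    have "subgroup (\<Union>\<C>) (G \<times>\<times> D)"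
    proof (rule P.subgroupI)
      show "\<Union>\<C> \<subseteq> carrier (G \<times>\<times> D)"
        by (rule Union_least) (use C subgroup.subset[of _ "G \<times>\<times> D"] in simp)
      obtain S0 where "S0 \<in> \<C>" using \<open>\<C> \<noteq> {}\<close> by blast
      moreover from this have "subgroup S0 (G \<times>\<times> D)" using C by simp
      ultimately show "\<Union>\<C> \<noteq> {}" using subgroup.one_closed[of S0 "G \<times>\<times> D"] by blast
      fix p assume "p \<in> \<Union>\<C>"
      then obtain S where S: "S \<in> \<C>" "p \<in> S" by blast
      then have "subgroup S (G \<times>\<times> D)" using C by simp
      from subgroup.m_inv_closed[OF this S(2)] S(1) show "inv\<^bsub>G \<times>\<times> D\<^esub> p \<in> \<Union>\<C>" by (rule UnionI[rotated])
      fix q assume "q \<in> \<Union>\<C>"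
      then obtain T where T: "T \<in> \<C>" "q \<in> T" by blast
      have sg: "subgroup S (G \<times>\<times> D)" "subgroup T (G \<times>\<times> D)" using C S(1) T(1) by auto
      from lin[OF S(1) T(1)] show "p \<otimes>\<^bsub>G \<times>\<times> D\<^esub> q \<in> \<Union>\<C>"
      proof
        assume "S \<subseteq> T"
        then show ?thesis using subgroup.m_closed[OF sg(2), of p q] S T by blast
      next
        assume "T \<subseteq> S"
        then show ?thesis using subgroup.m_closed[OF sg(1), of p q] S T by blast
      qed
    qed
    moreover have "?\<Gamma> \<subseteq> \<Union>\<C>"
    proof -
      obtain S0 where "S0 \<in> \<C>" using \<open>\<C> \<noteq> {}\<close> by blast
      with C show ?thesis by blast
    qed
    moreover have "\<forall>d. (\<one>\<^bsub>G\<^esub>, d) \<in> \<Union>\<C> \<longrightarrow> d = \<one>\<^bsub>D\<^esub>"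
      using C by blast
    ultimately show ?thesis by simp
  qed
  obtain S where S: "S \<in> ?\<S>" and max: "\<And>T. \<lbrakk>T \<in> ?\<S>; S \<subseteq> T\<rbrakk> \<Longrightarrow> T = S"
  proof -
    have "?\<S> \<noteq> {}" using ne by blast
    from subset_Zorn_nonempty[OF this chain]
    obtain S where S: "S \<in> ?\<S>" and m: "\<forall>Y. Y \<in> ?\<S> \<longrightarrow> S \<subseteq> Y \<longrightarrow> Y = S" unfolding Ball_def by (rule bexE)
    show thesis
    proof (rule that[OF S])
      fix T assume T: "T \<in> ?\<S>" "S \<subseteq> T"
      show "T = S" using m T by (simp only: simp_thms)
    qed
  qed
  have sg: "subgroup S (G \<times>\<times> D)" and \<Gamma>S: "?\<Gamma> \<subseteq> S"
    and S1: "\<And>d. (\<one>\<^bsub>G\<^esub>, d) \<in> S \<Longrightarrow> d = \<one>\<^bsub>D\<^esub>" using S by simp_all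
  have S_carr: "p \<in> carrier (G \<times>\<times> D)" if "p \<in> S" for p using that subgroup.mem_carrier[OF sg] by blast
  have dom: "\<exists>d. (x, d) \<in> S" if x: "x \<in> carrier G" for x
  proof -
    obtain d where d: "d \<in> carrier D"
      and comp: "\<And>n::int. x [^]\<^bsub>G\<^esub> n \<in> fst ` S \<Longrightarrow> (x, d) [^]\<^bsub>G \<times>\<times> D\<^esub> n \<in> S"
      using divisible_root_compatible[OF G D sg x] by blast
    let ?z = "(x, d)"
    have z: "?z \<in> carrier (G \<times>\<times> D)" using x d by simp
    let ?T = "S <#>\<^bsub>G \<times>\<times> D\<^esub> generate (G \<times>\<times> D) {?z}"
    have sgT: "subgroup ?T (G \<times>\<times> D)"
      by (rule P.mult_subgroups[OF sg]) (rule P.generate_is_subgroup, use z in simp)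
    have fst_pow: "fst (?z [^]\<^bsub>G \<times>\<times> D\<^esub> n) = x [^]\<^bsub>G\<^esub> n" for n :: int
    proof -
      have "group_hom (G \<times>\<times> D) G fst"
        by (auto simp: group_hom_def group_hom_axioms_def hom_def mult_DirProd' P.is_group G.is_group)
      from group_hom.hom_int_pow[OF this z, of n] show ?thesis by simp
    qed
    have ST: "S \<subseteq> ?T"
    proof
      fix p assume p: "p \<in> S"
      have "p \<otimes>\<^bsub>G \<times>\<times> D\<^esub> \<one>\<^bsub>G \<times>\<times> D\<^esub> \<in> ?T"
        unfolding set_mult_def using p generate.one by blast
      then show "p \<in> ?T" using S_carr[OF p] by (metis P.r_one)
    qed
    have "e = \<one>\<^bsub>D\<^esub>" if e_in: "(\<one>\<^bsub>G\<^esub>, e) \<in> ?T" for e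
    proof -
      obtain s n where s: "s \<in> S" and e: "(\<one>\<^bsub>G\<^esub>, e) = s \<otimes>\<^bsub>G \<times>\<times> D\<^esub> ?z [^]\<^bsub>G \<times>\<times> D\<^esub> (n::int)"
        using e_in unfolding set_mult_def P.generate_pow[OF z] by blast
      have "\<one>\<^bsub>G\<^esub> = fst s \<otimes>\<^bsub>G\<^esub> x [^]\<^bsub>G\<^esub> n"
        using arg_cong[OF e, of fst] fst_pow[of n] by (simp add: mult_DirProd')
      then have "inv\<^bsub>G\<^esub> (x [^]\<^bsub>G\<^esub> n) = fst s"
        using S_carr[OF s] x by (intro G.inv_equality) auto
      then have "x [^]\<^bsub>G\<^esub> (- n) \<in> fst ` S" using s x by (simp add: G.int_pow_neg)
      from subgroup.m_inv_closed[OF sg comp[OF this]]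
      have "?z [^]\<^bsub>G \<times>\<times> D\<^esub> n \<in> S" using P.int_pow_neg[OF z, of "- n"] by simp
      from subgroup.m_closed[OF sg s this] e S1 show ?thesis by simp
    qed
    then have "?T \<in> ?\<S>" using sgT ST \<Gamma>S by auto
    from max[OF this ST] have "?T = S" .
    moreover have "\<one>\<^bsub>G \<times>\<times> D\<^esub> \<otimes>\<^bsub>G \<times>\<times> D\<^esub> ?z \<in> ?T"
      unfolding set_mult_def using subgroup.one_closed[OF sg] generate.incl[of ?z] by blast
    ultimately have "?z \<in> S" using P.l_one[OF z] by (simp del: one_DirProd mult_DirProd)
    then show ?thesis by blast
  qed
  have functional: "d = e" if "(x, d) \<in> S" "(x, e) \<in> S" for x d e
  proof -
    have c: "x \<in> carrier G" "d \<in> carrier D" "e \<in> carrier D" using S_carr that by auto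
    have "(x, d) \<otimes>\<^bsub>G \<times>\<times> D\<^esub> inv\<^bsub>G \<times>\<times> D\<^esub> (x, e) \<in> S"
      by (intro subgroup.m_closed[OF sg] subgroup.m_inv_closed[OF sg] that)
    then have "d \<otimes>\<^bsub>D\<^esub> inv\<^bsub>D\<^esub> e = \<one>\<^bsub>D\<^esub>"
      using c S1 by (simp add: inv_DirProd G.is_group D.is_group)
    then show ?thesis using c by (metis D.inv_closed D.inv_equality D.inv_inv)
  qed
  define \<gamma>' where "\<gamma>' x = (THE d. (x, d) \<in> S)" for x
  have \<gamma>'I: "\<gamma>' x = d" if "(x, d) \<in> S" for x d
    unfolding \<gamma>'_def using that functional by blast
  have \<gamma>'S: "(x, \<gamma>' x) \<in> S" if "x \<in> carrier G" for x
    using dom[OF that] \<gamma>'I by auto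
  show ?thesis
  proof
    show "\<gamma>' \<in> hom G D"
    proof (rule homI)
      fix x y assume xy: "x \<in> carrier G" "y \<in> carrier G"
      show "\<gamma>' x \<in> carrier D" using S_carr[OF \<gamma>'S[OF xy(1)]] by simp
      show "\<gamma>' (x \<otimes>\<^bsub>G\<^esub> y) = \<gamma>' x \<otimes>\<^bsub>D\<^esub> \<gamma>' y"
        using subgroup.m_closed[OF sg \<gamma>'S[OF xy(1)] \<gamma>'S[OF xy(2)]] by (intro \<gamma>'I) simp
    qed
    show "\<gamma>' x = \<gamma> x" if "x \<in> H" for x
      using \<Gamma>S that by (intro \<gamma>'I) blast
  qed
qed

text \<open>
  Write \<open>A\<close> as a quotient of the free abelian group on its own elements by the group \<open>K\<close> of relations. The
  rational span of the generators modulo \<open>K\<close> is divisible and contains \<open>A\<close>, because an element of the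
  free group that lies in \<open>K\<close> after passing to rational coefficients was in \<open>K\<close> before. The last two
  conclusions record that the carrier consists of disjoint nonempty sets, which is needed to
  count it.
\<close>

lemma divisible_hull:
  fixes A :: "('x, 'r) monoid_scheme"
  assumes A: "comm_group A"
  obtains D :: "('x \<Rightarrow>\<^sub>0 rat) set monoid" and e where "divisible_group D" "e \<in> hom A D"
    "inj_on e (carrier A)" "\<And>Z. Z \<in> carrier D \<Longrightarrow> Z \<noteq> {}"
    "\<And>Y Z. \<lbrakk>Y \<in> carrier D; Z \<in> carrier D; Y \<inter> Z \<noteq> {}\<rbrakk> \<Longrightarrow> Y = Z"
proof -
  interpret A: comm_group A by fact
  let ?F = "free_Abelian_group (carrier A)"
  obtain h where h: "h \<in> hom ?F A" and h_of: "\<And>x. x \<in> carrier A \<Longrightarrow> h (frag_of x) = x"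
    using A.free_Abelian_group_universal[of "\<lambda>x. x" "carrier A"] by blast
  interpret h: group_hom ?F A h
    by (simp add: group_hom_def group_hom_axioms_def h A.is_group)
  define V where "V = \<lparr>carrier = (UNIV :: ('x \<Rightarrow>\<^sub>0 rat) set), monoid.mult = (+), one = (0 :: 'x \<Rightarrow>\<^sub>0 rat)\<rparr>"
  have [simp]: "carrier V = UNIV" "\<And>u v. u \<otimes>\<^bsub>V\<^esub> v = u + v" "\<one>\<^bsub>V\<^esub> = 0" by (simp_all add: V_def)
  interpret V: comm_group V
  proof (rule comm_groupI)
    fix v assume "v \<in> carrier V"
    show "\<exists>w\<in>carrier V. w \<otimes>\<^bsub>V\<^esub> v = \<one>\<^bsub>V\<^esub>" by (rule bexI[of _ "- v"]) simp_all
  qed (simp_all add: add_ac)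
  have V_inv: "inv\<^bsub>V\<^esub> v = - v" for v by (rule V.inv_equality) auto
  define K where "K = {v :: 'x \<Rightarrow>\<^sub>0 rat. \<exists>c. Poly_Mapping.keys c \<subseteq> carrier A \<and> h c = \<one>\<^bsub>A\<^esub> \<and>
    (\<forall>k. Poly_Mapping.lookup v k = of_int (Poly_Mapping.lookup c k))}"
  have h_diff: "h (a - b) = h a \<otimes>\<^bsub>A\<^esub> inv\<^bsub>A\<^esub> h b"
    if "Poly_Mapping.keys a \<subseteq> carrier A" "Poly_Mapping.keys b \<subseteq> carrier A" for a b
    using h.hom_mult[of a "- b"] h.hom_inv[of b] that by simp
  have h_closed: "h a \<in> carrier A" if "Poly_Mapping.keys a \<subseteq> carrier A" for a
    using h.hom_closed[of a] that by simp
  have K_diff: "u - v \<in> K" if "u \<in> K" "v \<in> K" for u v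
  proof -
    obtain c where c: "Poly_Mapping.keys c \<subseteq> carrier A" "h c = \<one>\<^bsub>A\<^esub>"
      "\<forall>k. Poly_Mapping.lookup u k = of_int (Poly_Mapping.lookup c k)"
      using \<open>u \<in> K\<close> unfolding K_def by blast
    obtain d where d: "Poly_Mapping.keys d \<subseteq> carrier A" "h d = \<one>\<^bsub>A\<^esub>"
      "\<forall>k. Poly_Mapping.lookup v k = of_int (Poly_Mapping.lookup d k)"
      using \<open>v \<in> K\<close> unfolding K_def by blast
    have "Poly_Mapping.keys (c - d) \<subseteq> carrier A" using c d keys_diff[of c d] by blast
    moreover have "h (c - d) = \<one>\<^bsub>A\<^esub>" using h_diff c d by simp
    moreover have "\<forall>k. Poly_Mapping.lookup (u - v) k = of_int (Poly_Mapping.lookup (c - d) k)"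
      using c d by (simp add: lookup_minus)
    ultimately show ?thesis unfolding K_def by blast
  qed
  have K0: "0 \<in> K" unfolding K_def using h.hom_one by (auto intro: exI[of _ 0])
  have K_neg: "- v \<in> K" if "v \<in> K" for v using K_diff[OF K0 that] by simp
  have K_add: "u + v \<in> K" if "u \<in> K" "v \<in> K" for u v
    using K_diff[OF that(1) K_neg[OF that(2)]] by simp
  have K: "subgroup K V"
    by (rule V.subgroupI) (use K0 K_neg K_add in \<open>auto simp: V_inv\<close>)
  let ?D = "V Mod K" and ?q = "\<lambda>v. K #>\<^bsub>V\<^esub> v"
  interpret D: comm_group ?D by (rule V.abelian_FactGroup[OF K])
  have q_hom: "?q \<in> hom V ?D"
    by (rule normal.r_coset_hom_Mod) (rule V.subgroup_imp_normal[OF K])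
  interpret q: group_hom V ?D ?q
    by (simp add: group_hom_def group_hom_axioms_def q_hom V.is_group D.is_group)
  have q_surj: "\<exists>v. Z = ?q v" if "Z \<in> carrier ?D" for Z
    using that unfolding FactGroup_def RCOSETS_def by auto
  have mem_q: "u \<in> ?q v \<longleftrightarrow> u - v \<in> K" for u v
    unfolding r_coset_def by (auto simp: algebra_simps) (metis diff_add_cancel)
  have q_eq: "?q u = ?q v" if "u - v \<in> K" for u v
    using V.repr_independence[of u K v] that K mem_q by simp
  define e where "e x = ?q (Poly_Mapping.single x 1)" for x
  have pows: "Poly_Mapping.lookup (w [^]\<^bsub>V\<^esub> n) k = of_nat n * Poly_Mapping.lookup w k" for w n k
    by (induction n) (simp_all add: lookup_add algebra_simps)
  show ?thesis
  proof
    have "\<exists>E\<in>carrier ?D. E [^]\<^bsub>?D\<^esub> n = Z" if Z: "Z \<in> carrier ?D" and n: "n > 0" for Z and n :: nat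
    proof -
      obtain v where v: "Z = ?q v" using q_surj[OF Z] by blast
      define w where "w = Poly_Mapping.map (\<lambda>c. c / of_nat n) v"
      have "Poly_Mapping.lookup w k = Poly_Mapping.lookup v k / of_nat n" for k
        by (simp add: w_def Poly_Mapping.map.rep_eq when_def)
      then have "w [^]\<^bsub>V\<^esub> n = v"
        using n by (intro poly_mapping_eqI) (simp add: pows)
      then have "?q w [^]\<^bsub>?D\<^esub> n = Z" using q.hom_nat_pow[of w n] v by simp
      then show ?thesis using q.hom_closed[of w] by auto
    qed
    then show "divisible_group ?D"
      using D.comm_group_axioms unfolding divisible_group_def by blast
    show "e \<in> hom A ?D"
    proof (rule homI)
      fix x y assume xy: "x \<in> carrier A" "y \<in> carrier A"
      show "e x \<in> carrier ?D" unfolding e_def using q.hom_closed by simp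
      let ?c = "frag_of (x \<otimes>\<^bsub>A\<^esub> y) - (frag_of x - (- frag_of y))"
      have k2: "Poly_Mapping.keys (frag_of x - (- frag_of y)) \<subseteq> carrier A"
        using keys_diff[of "frag_of x" "- frag_of y"] xy by auto
      then have kc: "Poly_Mapping.keys ?c \<subseteq> carrier A"
        using keys_diff[of "frag_of (x \<otimes>\<^bsub>A\<^esub> y)" "frag_of x - (- frag_of y)"] xy by auto
      have "h (- frag_of y) = inv\<^bsub>A\<^esub> y"
        using h.hom_inv[of "frag_of y"] h_of xy by simp
      then have "h (frag_of x - (- frag_of y)) = x \<otimes>\<^bsub>A\<^esub> y"
        using h_diff[of "frag_of x" "- frag_of y"] h_of xy by simp
      then have "h ?c = \<one>\<^bsub>A\<^esub>"
        using h_diff[OF _ k2, of "frag_of (x \<otimes>\<^bsub>A\<^esub> y)"] h_of xy by simp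
      then have "Poly_Mapping.single (x \<otimes>\<^bsub>A\<^esub> y) 1 - (Poly_Mapping.single x 1 + Poly_Mapping.single y 1) \<in> K"
        unfolding K_def using kc
        by (intro CollectI exI[of _ ?c]) (auto simp: lookup_minus lookup_add lookup_single when_def)
      from q_eq[OF this] show "e (x \<otimes>\<^bsub>A\<^esub> y) = e x \<otimes>\<^bsub>?D\<^esub> e y"
        unfolding e_def using q.hom_mult[of "Poly_Mapping.single x 1" "Poly_Mapping.single y 1"] by simp
    qed
    show "inj_on e (carrier A)"
    proof (rule inj_onI)
      fix x y assume xy: "x \<in> carrier A" "y \<in> carrier A" "e x = e y"
      then have "Poly_Mapping.single x 1 - Poly_Mapping.single y 1 \<in> K"
        using mem_q[of "Poly_Mapping.single x 1" "Poly_Mapping.single x 1"] mem_q[of "Poly_Mapping.single x 1" "Poly_Mapping.single y 1"] K0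
        by (simp add: e_def)
      then obtain c where c: "h c = \<one>\<^bsub>A\<^esub>"
        and lk: "\<And>k. Poly_Mapping.lookup (Poly_Mapping.single x 1 - Poly_Mapping.single y (1::rat)) k = of_int (Poly_Mapping.lookup c k)"
        unfolding K_def by blast
      have "c = frag_of x - frag_of y"
      proof (rule poly_mapping_eqI)
        fix k
        have "rat_of_int (Poly_Mapping.lookup (frag_of x - frag_of y) k) =
          Poly_Mapping.lookup (Poly_Mapping.single x 1 - Poly_Mapping.single y 1) k"
          by (simp add: lookup_minus lookup_single when_def)
        with lk[of k] have "rat_of_int (Poly_Mapping.lookup c k) =
          rat_of_int (Poly_Mapping.lookup (frag_of x - frag_of y) k)" by (rule trans[OF sym sym])
        then show "Poly_Mapping.lookup c k = Poly_Mapping.lookup (frag_of x - frag_of y) k"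
          by (rule of_int_eq_iff[THEN iffD1])
      qed
      then have "x \<otimes>\<^bsub>A\<^esub> inv\<^bsub>A\<^esub> y = \<one>\<^bsub>A\<^esub>"
        using c h_diff[of "frag_of x" "frag_of y"] h_of xy by simp
      then have "inv\<^bsub>A\<^esub> (inv\<^bsub>A\<^esub> y) = x" using xy by (intro A.inv_equality) auto
      then show "x = y" using xy by simp
    qed
    show "Z \<noteq> {}" if "Z \<in> carrier ?D" for Z
    proof -
      obtain v where "Z = ?q v" using q_surj[OF \<open>Z \<in> carrier ?D\<close>] by blast
      moreover have "v \<in> ?q v" using mem_q[of v v] K0 by simp
      ultimately show ?thesis by blast
    qed
    show "Y = Z" if YZ: "Y \<in> carrier ?D" "Z \<in> carrier ?D" "Y \<inter> Z \<noteq> {}" for Y Z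
    proof -
      obtain u v w where uv: "Y = ?q u" "Z = ?q v" and w: "w \<in> ?q u" "w \<in> ?q v"
        using q_surj[OF YZ(1)] q_surj[OF YZ(2)] YZ(3) by blast
      have "?q w = ?q u" "?q w = ?q v" using w by (intro q_eq; simp only: mem_q)+
      then show ?thesis using uv by simp
    qed
  qed
qed

section \<open>Enough injective modules\<close>

text \<open>
  The group \<open>Hom\<^sub>\<int>(R, D)\<close>; \<open>R\<close> acts through right multiplication on the argument, which makes it a
  left module. Homomorphisms are cut off outside \<open>R\<close>, so that they are equal if they agree on \<open>R\<close>.
\<close>

definition coinduced_module :: "('a, 'r) ring_scheme \<Rightarrow> 'd monoid \<Rightarrow> ('a, 'a \<Rightarrow> 'd) module"
  where "coinduced_module R D = \<lparr>carrier = hom (add_monoid R) D \<inter> extensional (carrier R),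
    monoid.mult = undefined, monoid.one = undefined, ring.zero = (\<lambda>r\<in>carrier R. \<one>\<^bsub>D\<^esub>),
    ring.add = (\<lambda>h k. \<lambda>r\<in>carrier R. h r \<otimes>\<^bsub>D\<^esub> k r), smult = (\<lambda>a h. \<lambda>r\<in>carrier R. h (r \<otimes>\<^bsub>R\<^esub> a))\<rparr>"

lemma coinduced_moduleI:
  assumes "\<And>r. r \<in> carrier R \<Longrightarrow> f r \<in> carrier D"
    and "\<And>r s. \<lbrakk>r \<in> carrier R; s \<in> carrier R\<rbrakk> \<Longrightarrow> f (r \<oplus>\<^bsub>R\<^esub> s) = f r \<otimes>\<^bsub>D\<^esub> f s"
    and "ring R"
  shows "(\<lambda>r\<in>carrier R. f r) \<in> carrier (coinduced_module R D)"
proof -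
  interpret ring R by fact
  show ?thesis using assms(1,2) by (auto simp: coinduced_module_def hom_def)
qed

lemma coinduced_left_module:
  assumes "ring R" and D: "comm_group D"
  shows "left_module R (coinduced_module R D)"
proof -
  interpret R: ring R by fact
  interpret D: comm_group D by fact
  let ?C = "coinduced_module R D"
  have cl: "h r \<in> carrier D" if "h \<in> carrier ?C" "r \<in> carrier R" for h r
    using that by (auto simp: coinduced_module_def hom_def)
  have add: "h (r \<oplus>\<^bsub>R\<^esub> s) = h r \<otimes>\<^bsub>D\<^esub> h s" if "h \<in> carrier ?C" "r \<in> carrier R" "s \<in> carrier R" for h r s
    using that by (auto simp: coinduced_module_def hom_def)
  have ext: "h = k" if "h \<in> carrier ?C" "k \<in> carrier ?C" "\<And>r. r \<in> carrier R \<Longrightarrow> h r = k r" for h k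
    using that by (intro extensionalityI[of h "carrier R" k]) (auto simp: coinduced_module_def)
  have ap: "(h \<oplus>\<^bsub>?C\<^esub> k) r = h r \<otimes>\<^bsub>D\<^esub> k r" "(a \<odot>\<^bsub>?C\<^esub> h) r = h (r \<otimes>\<^bsub>R\<^esub> a)" "\<zero>\<^bsub>?C\<^esub> r = \<one>\<^bsub>D\<^esub>"
    if "r \<in> carrier R" for h k r a
    using that by (auto simp: coinduced_module_def)
  have addc: "h \<oplus>\<^bsub>?C\<^esub> k \<in> carrier ?C" if hk: "h \<in> carrier ?C" "k \<in> carrier ?C" for h k
  proof -
    have "(\<lambda>r\<in>carrier R. h r \<otimes>\<^bsub>D\<^esub> k r) \<in> carrier ?C"
      by (rule coinduced_moduleI) (use cl[OF hk(1)] cl[OF hk(2)] R.ring_axioms in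
        \<open>simp_all add: add[OF hk(1)] add[OF hk(2)] D.m_ac\<close>)
    then show ?thesis by (simp add: coinduced_module_def)
  qed
  have zc: "\<zero>\<^bsub>?C\<^esub> \<in> carrier ?C"
    using coinduced_moduleI[of R "\<lambda>r. \<one>\<^bsub>D\<^esub>" D] R.ring_axioms by (simp add: coinduced_module_def)
  have sc: "a \<odot>\<^bsub>?C\<^esub> h \<in> carrier ?C" if ah: "a \<in> carrier R" "h \<in> carrier ?C" for a h
  proof -
    have "(\<lambda>r\<in>carrier R. h (r \<otimes>\<^bsub>R\<^esub> a)) \<in> carrier ?C"
      by (rule coinduced_moduleI) (use ah(1) cl[OF ah(2)] R.ring_axioms in
        \<open>simp_all add: R.l_distr add[OF ah(2)]\<close>)
    then show ?thesis by (simp add: coinduced_module_def)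
  qed
  have neg: "\<exists>k\<in>carrier ?C. k \<oplus>\<^bsub>?C\<^esub> h = \<zero>\<^bsub>?C\<^esub>" if h: "h \<in> carrier ?C" for h
  proof
    show k: "(\<lambda>r\<in>carrier R. inv\<^bsub>D\<^esub> h r) \<in> carrier ?C"
      by (rule coinduced_moduleI) (use cl[OF h] R.ring_axioms in \<open>simp_all add: add[OF h] D.inv_mult\<close>)
    show "(\<lambda>r\<in>carrier R. inv\<^bsub>D\<^esub> h r) \<oplus>\<^bsub>?C\<^esub> h = \<zero>\<^bsub>?C\<^esub>"
      by (rule ext[OF addc[OF k h] zc]) (use h cl in \<open>simp add: ap\<close>)
  qed
  have ab: "abelian_group ?C"
  proof (rule abelian_groupI)
    fix h k l assume H: "h \<in> carrier ?C" "k \<in> carrier ?C" "l \<in> carrier ?C"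
    show "h \<oplus>\<^bsub>?C\<^esub> k \<oplus>\<^bsub>?C\<^esub> l = h \<oplus>\<^bsub>?C\<^esub> (k \<oplus>\<^bsub>?C\<^esub> l)"
      by (rule ext) (use H in \<open>simp_all add: addc ap cl D.m_assoc\<close>)
  next
    fix h k assume H: "h \<in> carrier ?C" "k \<in> carrier ?C"
    show "h \<oplus>\<^bsub>?C\<^esub> k = k \<oplus>\<^bsub>?C\<^esub> h"
      by (rule ext) (use H in \<open>simp_all add: addc ap cl D.m_comm\<close>)
    show "\<zero>\<^bsub>?C\<^esub> \<oplus>\<^bsub>?C\<^esub> h = h"
      by (rule ext) (use H in \<open>simp_all add: addc zc ap cl\<close>)
  qed (use addc zc neg in simp_all)
  show ?thesis
  proof (rule left_moduleI[OF \<open>ring R\<close> ab])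
    fix a b h k assume H: "a \<in> carrier R" "b \<in> carrier R" "h \<in> carrier ?C"
    show "(a \<oplus>\<^bsub>R\<^esub> b) \<odot>\<^bsub>?C\<^esub> h = a \<odot>\<^bsub>?C\<^esub> h \<oplus>\<^bsub>?C\<^esub> b \<odot>\<^bsub>?C\<^esub> h"
      by (rule ext) (use H(1,2) in \<open>simp_all add: addc sc ap add[OF H(3)] R.r_distr H(3)\<close>)
    show "(a \<otimes>\<^bsub>R\<^esub> b) \<odot>\<^bsub>?C\<^esub> h = a \<odot>\<^bsub>?C\<^esub> (b \<odot>\<^bsub>?C\<^esub> h)"
      by (rule ext) (use H in \<open>simp_all add: sc ap R.m_assoc\<close>)
  next
    fix a h k assume H: "a \<in> carrier R" "h \<in> carrier ?C" "k \<in> carrier ?C"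
    show "a \<odot>\<^bsub>?C\<^esub> (h \<oplus>\<^bsub>?C\<^esub> k) = a \<odot>\<^bsub>?C\<^esub> h \<oplus>\<^bsub>?C\<^esub> a \<odot>\<^bsub>?C\<^esub> k"
      by (rule ext) (use H in \<open>simp_all add: addc sc ap\<close>)
  next
    fix h assume H: "h \<in> carrier ?C"
    show "\<one>\<^bsub>R\<^esub> \<odot>\<^bsub>?C\<^esub> h = h"
      by (rule ext) (use H in \<open>simp_all add: sc ap\<close>)
  qed (use sc in simp)
qed

text \<open>
  A linear map \<open>g\<close> into the coinduced module is determined by the additive map \<open>m \<mapsto> g m 1\<close>, and
  every additive map arises; so maps extend because they extend as maps into the divisible group.
\<close>

lemma coinduced_module_extends:
  assumes "ring R" and D: "divisible_group D"
    and M: "left_module R M" and N: "left_module R N"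
    and f: "f \<in> lin_hom R M N" and inj: "inj_on f (carrier M)"
    and g: "g \<in> lin_hom R M (coinduced_module R D)"
  obtains h where "h \<in> lin_hom R N (coinduced_module R D)" "\<forall>x\<in>carrier M. h (f x) = g x"
proof -
  interpret R: ring R by fact
  interpret D: comm_group D using D by (simp add: divisible_group_def)
  interpret M: left_module R M by fact
  interpret N: left_module R N by fact
  let ?C = "coinduced_module R D" and ?i = "inv_into (carrier M) f" and ?H = "f ` carrier M"
  interpret C: left_module R ?C by (rule coinduced_left_module) (fact R.ring_axioms D.comm_group_axioms)+
  have i: "?i (f x) = x" if "x \<in> carrier M" for x by (rule inv_into_f_f[OF inj that])
  have cl: "h r \<in> carrier D" if "h \<in> carrier ?C" "r \<in> carrier R" for h r
    using that by (auto simp: coinduced_module_def hom_def)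
  have H: "submodule ?H R N" by (rule lin_hom_image_submodule[OF M N f submodule_carrier[OF M]])
  have "(\<lambda>y. g (?i y) \<one>\<^bsub>R\<^esub>) \<in> hom (add_monoid N\<lparr>carrier := ?H\<rparr>) D"
  proof (rule homI)
    fix u assume "u \<in> carrier (add_monoid N\<lparr>carrier := ?H\<rparr>)"
    then show "g (?i u) \<one>\<^bsub>R\<^esub> \<in> carrier D"
      using i lin_hom_closed[OF g] by (auto intro!: cl)
  next
    fix u v assume "u \<in> carrier (add_monoid N\<lparr>carrier := ?H\<rparr>)" "v \<in> carrier (add_monoid N\<lparr>carrier := ?H\<rparr>)"
    then obtain x y where xy: "x \<in> carrier M" "u = f x" "y \<in> carrier M" "v = f y" by auto
    have "g (?i (f (x \<oplus>\<^bsub>M\<^esub> y))) \<one>\<^bsub>R\<^esub> = (g x \<oplus>\<^bsub>?C\<^esub> g y) \<one>\<^bsub>R\<^esub>"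
      using xy i lin_hom_add[OF g] by simp
    then show "g (?i (u \<otimes>\<^bsub>add_monoid N\<lparr>carrier := ?H\<rparr>\<^esub> v)) \<one>\<^bsub>R\<^esub> = g (?i u) \<one>\<^bsub>R\<^esub> \<otimes>\<^bsub>D\<^esub> g (?i v) \<one>\<^bsub>R\<^esub>"
      using xy i lin_hom_add[OF f] by (simp add: coinduced_module_def)
  qed
  then obtain \<gamma> where \<gamma>: "\<gamma> \<in> hom (add_monoid N) D"
    and \<gamma>_eq: "\<And>y. y \<in> ?H \<Longrightarrow> \<gamma> y = g (?i y) \<one>\<^bsub>R\<^esub>"
    using divisible_group_extends_hom[OF N.M.a_comm_group D submodule.axioms(1)[OF H]] by blast
  have \<gamma>c: "\<gamma> y \<in> carrier D" if "y \<in> carrier N" for y using \<gamma> that by (auto simp: hom_def)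
  have \<gamma>a: "\<gamma> (x \<oplus>\<^bsub>N\<^esub> y) = \<gamma> x \<otimes>\<^bsub>D\<^esub> \<gamma> y" if "x \<in> carrier N" "y \<in> carrier N" for x y
    using \<gamma> that by (auto simp: hom_def)
  define h where "h n = (\<lambda>r\<in>carrier R. \<gamma> (r \<odot>\<^bsub>N\<^esub> n))" for n
  have hc: "h n \<in> carrier ?C" if "n \<in> carrier N" for n
    unfolding h_def using that \<gamma>c \<gamma>a R.ring_axioms
    by (intro coinduced_moduleI) (simp_all add: N.smult_l_distr)
  show ?thesis
  proof
    show "h \<in> lin_hom R N ?C"
    proof (rule lin_homI)
      fix a x y assume xy: "x \<in> carrier N" "y \<in> carrier N"
      show "h (x \<oplus>\<^bsub>N\<^esub> y) = h x \<oplus>\<^bsub>?C\<^esub> h y"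
        using xy by (auto simp: h_def coinduced_module_def N.smult_r_distr \<gamma>a intro!: restrict_ext)
    next
      fix a x assume "a \<in> carrier R" "x \<in> carrier N"
      then show "h (a \<odot>\<^bsub>N\<^esub> x) = a \<odot>\<^bsub>?C\<^esub> h x"
        by (auto simp: h_def coinduced_module_def N.smult_assoc intro!: restrict_ext)
    qed (use hc in simp)
    show "\<forall>x\<in>carrier M. h (f x) = g x"
    proof (rule ballI, rule extensionalityI)
      fix x assume x: "x \<in> carrier M"
      show "h (f x) \<in> extensional (carrier R)" by (simp add: h_def)
      show "g x \<in> extensional (carrier R)"
        using lin_hom_closed[OF g x] by (simp add: coinduced_module_def)
      fix r assume r: "r \<in> carrier R"
      have "h (f x) r = \<gamma> (f (r \<odot>\<^bsub>M\<^esub> x))" using r x by (simp add: h_def lin_hom_smult[OF f])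
      also have "\<dots> = g (r \<odot>\<^bsub>M\<^esub> x) \<one>\<^bsub>R\<^esub>" using r x i by (simp add: \<gamma>_eq)
      also have "\<dots> = (r \<odot>\<^bsub>?C\<^esub> g x) \<one>\<^bsub>R\<^esub>" using r x by (simp add: lin_hom_smult[OF g])
      also have "\<dots> = g x r" using r by (simp add: coinduced_module_def)
      finally show "h (f x) r = g x r" .
    qed
  qed
qed

lemma injective_module_left_module: "injective_module R E \<Longrightarrow> left_module R E"
  by (simp add: injective_module_def)

lemma injective_module_extends:
  fixes M N E :: "('a, 'm) module"
  assumes "injective_module R E" "left_module R M" "left_module R N"
    "f \<in> lin_hom R M N" "inj_on f (carrier M)" "g \<in> lin_hom R M E"
  obtains h where "h \<in> lin_hom R N E" "\<forall>x\<in>carrier M. h (f x) = g x"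
proof -
  have "\<exists>h\<in>lin_hom R N E. \<forall>x\<in>carrier M. h (f x) = g x"
    using assms(1)[unfolded injective_module_def, THEN conjunct2, rule_format, of M N f g] assms(2-) by simp
  then show ?thesis by (elim bexE) (rule that)
qed

text \<open>
  The module \<open>M\<close> embeds into \<open>Hom\<^sub>\<int>(R, D)\<close> for a divisible hull \<open>D\<close> of its additive group, by sending \<open>m\<close> to
  \<open>r \<mapsto> rm\<close>. The universe has room for \<open>D\<close>, hence for functions from \<open>R\<close> to \<open>D\<close>, and the module is
  transported there.
\<close>

lemma enough_injectives:
  fixes M :: "('a, 'm) module"
  assumes U: "module_universe TYPE('a) TYPE('m)" and M: "left_module R M"
  obtains E :: "('a, 'm) module" and \<iota> where "injective_module R E" "\<iota> \<in> lin_hom R M E"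
    "inj_on \<iota> (carrier M)"
proof -
  interpret M: left_module R M by fact
  note univ = module_universe_embeddings[OF U]
  obtain D :: "('m \<Rightarrow>\<^sub>0 rat) set monoid" and e where D: "divisible_group D"
    and e: "e \<in> hom (add_monoid M) D" "inj_on e (carrier M)"
    and D_ne: "\<And>Z. Z \<in> carrier D \<Longrightarrow> Z \<noteq> {}"
    and D_disj: "\<And>Y Z. \<lbrakk>Y \<in> carrier D; Z \<in> carrier D; Y \<inter> Z \<noteq> {}\<rbrakk> \<Longrightarrow> Y = Z"
    using divisible_hull[OF M.M.a_comm_group] by auto
  interpret D: comm_group D using D by (simp add: divisible_group_def)
  let ?C = "coinduced_module R D"
  have C: "left_module R ?C" by (rule coinduced_left_module[OF M.R.ring_axioms D.comm_group_axioms])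
  have "infinite (UNIV :: 'm set)" by (rule univ(1))
  then obtain nat_m :: "nat \<Rightarrow> 'm" where "inj nat_m" using infinite_countable_subset by blast
  then have "inj (\<lambda>q :: rat. nat_m (to_nat q))"
    by (intro injI) (simp add: inj_eq)
  then have "\<exists>f :: rat \<Rightarrow> 'm. inj f" by (intro exI[of _ "\<lambda>q. nat_m (to_nat q)"])
  from finite_support_functions_embed[OF U this, of 0]
  obtain g :: "('m \<Rightarrow> rat) \<Rightarrow> 'm" where g: "inj_on g {c. finite {x. c x \<noteq> 0}}"
    by (elim exE) simp
  define j where "j Z = g (Poly_Mapping.lookup (SOME v. v \<in> Z))" for Z
  have j: "inj_on j (carrier D)"
  proof (rule inj_onI)
    fix Y Z assume YZ: "Y \<in> carrier D" "Z \<in> carrier D" "j Y = j Z"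
    define y z where "y = (SOME v. v \<in> Y)" and "z = (SOME v. v \<in> Z)"
    have "g (Poly_Mapping.lookup y) = g (Poly_Mapping.lookup z)"
      using YZ(3) by (simp only: j_def y_def z_def)
    from inj_onD[OF g, OF this] have "Poly_Mapping.lookup y = Poly_Mapping.lookup z"
      by (simp only: mem_Collect_eq finite_lookup simp_thms)
    then have "y = z" by (simp only: lookup_inject)
    moreover have "y \<in> Y" "z \<in> Z"
      unfolding y_def z_def using D_ne[OF YZ(1)] D_ne[OF YZ(2)] by (simp_all add: some_in_eq)
    ultimately have "Y \<inter> Z \<noteq> {}" by blast
    then show "Y = Z" by (rule D_disj[OF YZ(1,2)])
  qed
  obtain \<psi> :: "('a \<Rightarrow> 'm) \<Rightarrow> 'm" where \<psi>: "inj \<psi>" using univ(4) by blast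
  define k where "k h = \<psi> (\<lambda>r. j (h r))" for h
  have k: "inj_on k (carrier ?C)"
  proof (rule inj_onI)
    fix h h' assume H: "h \<in> carrier ?C" "h' \<in> carrier ?C" "k h = k h'"
    from injD[OF \<psi>, OF H(3)[unfolded k_def]] have *: "j (h r) = j (h' r)" for r by (rule fun_cong)
    show "h = h'"
    proof (rule extensionalityI)
      show "h \<in> extensional (carrier R)" "h' \<in> extensional (carrier R)"
        using H(1,2) by (simp_all add: coinduced_module_def)
      fix r assume "r \<in> carrier R"
      then have "h r \<in> carrier D" "h' r \<in> carrier D"
        using H(1,2) by (auto simp: coinduced_module_def hom_def)
      with * show "h r = h' r" by (rule inj_onD[OF j])
    qed
  qed
  obtain E :: "('a, 'm) module" where E: "left_module R E" and kE: "k \<in> lin_hom R ?C E"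
    and k_surj: "k ` carrier ?C = carrier E"
    by (rule transport_module[OF C k])
  obtain k' where k': "k' \<in> lin_hom R E ?C" "\<forall>h\<in>carrier ?C. k' (k h) = h"
    "\<forall>y\<in>carrier E. k (k' y) = y"
    by (rule lin_hom_inverse[OF C E kE k k_surj]) (rule that)
  have inj_E: "injective_module R E"
    unfolding injective_module_def
  proof (intro conjI E allI impI, elim conjE)
    fix N P :: "('a, 'm) module" and f g
    assume N: "left_module R N" and P: "left_module R P" and f: "f \<in> lin_hom R N P" "inj_on f (carrier N)"
      and g: "g \<in> lin_hom R N E"
    obtain h where h: "h \<in> lin_hom R P ?C" "\<forall>x\<in>carrier N. h (f x) = k' (g x)"
      by (rule coinduced_module_extends[OF M.R.ring_axioms D N P f lin_hom_comp[OF g k'(1)]]) (rule that)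
    show "\<exists>h\<in>lin_hom R P E. \<forall>x\<in>carrier N. h (f x) = g x"
      by (rule bexI[OF _ lin_hom_comp[OF h(1) kE]]) (simp add: h(2) k'(3) lin_hom_closed[OF g])
  qed
  define \<iota> where "\<iota> m = (\<lambda>r\<in>carrier R. e (r \<odot>\<^bsub>M\<^esub> m))" for m
  have ec: "e x \<in> carrier D" if "x \<in> carrier M" for x using e(1) that by (auto simp: hom_def)
  have ea: "e (x \<oplus>\<^bsub>M\<^esub> y) = e x \<otimes>\<^bsub>D\<^esub> e y" if "x \<in> carrier M" "y \<in> carrier M" for x y
    using e(1) that by (auto simp: hom_def)
  have \<iota>: "\<iota> \<in> lin_hom R M ?C"
  proof (rule lin_homI)
    fix x assume "x \<in> carrier M"
    then show "\<iota> x \<in> carrier ?C" unfolding \<iota>_def using ec ea M.R.ring_axioms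
      by (intro coinduced_moduleI) (simp_all add: M.smult_l_distr)
  next
    fix x y assume "x \<in> carrier M" "y \<in> carrier M"
    then show "\<iota> (x \<oplus>\<^bsub>M\<^esub> y) = \<iota> x \<oplus>\<^bsub>?C\<^esub> \<iota> y"
      by (auto simp: \<iota>_def coinduced_module_def M.smult_r_distr ea intro!: restrict_ext)
  next
    fix a x assume "a \<in> carrier R" "x \<in> carrier M"
    then show "\<iota> (a \<odot>\<^bsub>M\<^esub> x) = a \<odot>\<^bsub>?C\<^esub> \<iota> x"
      by (auto simp: \<iota>_def coinduced_module_def M.smult_assoc intro!: restrict_ext)
  qed
  then have "(\<lambda>x. k (\<iota> x)) \<in> lin_hom R M E" using kE by (rule lin_hom_comp)
  with inj_E show ?thesis
  proof (rule that)
    show "inj_on (\<lambda>x. k (\<iota> x)) (carrier M)"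
    proof (rule inj_onI)
      fix x y assume xy: "x \<in> carrier M" "y \<in> carrier M" "k (\<iota> x) = k (\<iota> y)"
      then have "\<iota> x = \<iota> y" using inj_onD[OF k, of "\<iota> x" "\<iota> y"] lin_hom_closed[OF \<iota>] by simp
      from fun_cong[OF this, of "\<one>\<^bsub>R\<^esub>"] have "e x = e y" using xy by (simp add: \<iota>_def)
      then show "x = y" using inj_onD[OF e(2)] xy(1,2) by simp
    qed
  qed
qed

section \<open>Enough projective modules\<close>

definition free_module :: "('a, 'r) ring_scheme \<Rightarrow> 'x set \<Rightarrow> ('a, 'x \<Rightarrow> 'a) module"
  where "free_module R S = \<lparr>carrier = {c. range c \<subseteq> carrier R \<and> finite {x. c x \<noteq> \<zero>\<^bsub>R\<^esub>} \<and> {x. c x \<noteq> \<zero>\<^bsub>R\<^esub>} \<subseteq> S},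
    monoid.mult = undefined, monoid.one = undefined, ring.zero = (\<lambda>_. \<zero>\<^bsub>R\<^esub>),
    ring.add = (\<lambda>c d x. c x \<oplus>\<^bsub>R\<^esub> d x), smult = (\<lambda>a c x. a \<otimes>\<^bsub>R\<^esub> c x)\<rparr>"

definition free_basis :: "('a, 'r) ring_scheme \<Rightarrow> 'x \<Rightarrow> 'x \<Rightarrow> 'a"
  where "free_basis R x = (\<lambda>y. if y = x then \<one>\<^bsub>R\<^esub> else \<zero>\<^bsub>R\<^esub>)"

definition free_lift :: "('a, 'r) ring_scheme \<Rightarrow> ('a, 'n) module \<Rightarrow> ('x \<Rightarrow> 'n) \<Rightarrow> ('x \<Rightarrow> 'a) \<Rightarrow> 'n"
  where "free_lift R N g c = (\<Oplus>\<^bsub>N\<^esub>x\<in>{x. c x \<noteq> \<zero>\<^bsub>R\<^esub>}. c x \<odot>\<^bsub>N\<^esub> g x)"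

lemma free_moduleD:
  assumes "c \<in> carrier (free_module R S)"
  shows "c x \<in> carrier R" "finite {x. c x \<noteq> \<zero>\<^bsub>R\<^esub>}" "{x. c x \<noteq> \<zero>\<^bsub>R\<^esub>} \<subseteq> S"
  using assms by (auto simp: free_module_def)

lemma free_left_module:
  assumes "ring R" shows "left_module R (free_module R S)"
proof -
  interpret R: ring R by fact
  let ?F = "free_module R S"
  note D = free_moduleD
  have add: "(\<lambda>x. c x \<oplus>\<^bsub>R\<^esub> d x) \<in> carrier ?F" if cd: "c \<in> carrier ?F" "d \<in> carrier ?F" for c d
  proof -
    have sub: "{x. c x \<oplus>\<^bsub>R\<^esub> d x \<noteq> \<zero>\<^bsub>R\<^esub>} \<subseteq> {x. c x \<noteq> \<zero>\<^bsub>R\<^esub>} \<union> {x. d x \<noteq> \<zero>\<^bsub>R\<^esub>}"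
      by auto
    have "finite {x. c x \<oplus>\<^bsub>R\<^esub> d x \<noteq> \<zero>\<^bsub>R\<^esub>}"
      by (rule finite_subset[OF sub]) (use D(2)[OF cd(1)] D(2)[OF cd(2)] in simp)
    moreover have "{x. c x \<oplus>\<^bsub>R\<^esub> d x \<noteq> \<zero>\<^bsub>R\<^esub>} \<subseteq> S"
      using sub D(3)[OF cd(1)] D(3)[OF cd(2)] by (simp only: subset_trans[OF sub] Un_least)
    ultimately show ?thesis
      using D(1)[OF cd(1)] D(1)[OF cd(2)] by (simp add: free_module_def image_subset_iff)
  qed
  have smult: "(\<lambda>x. a \<otimes>\<^bsub>R\<^esub> c x) \<in> carrier ?F" if a: "a \<in> carrier R" and c: "c \<in> carrier ?F" for a c
  proof -
    have sub: "{x. a \<otimes>\<^bsub>R\<^esub> c x \<noteq> \<zero>\<^bsub>R\<^esub>} \<subseteq> {x. c x \<noteq> \<zero>\<^bsub>R\<^esub>}" using a by auto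
    show ?thesis
      using finite_subset[OF sub D(2)[OF c]] subset_trans[OF sub D(3)[OF c]] D(1)[OF c] a
      by (simp add: free_module_def image_subset_iff)
  qed
  have zero: "(\<lambda>_. \<zero>\<^bsub>R\<^esub>) \<in> carrier ?F" by (simp add: free_module_def)
  have ops: "c \<oplus>\<^bsub>?F\<^esub> d = (\<lambda>x. c x \<oplus>\<^bsub>R\<^esub> d x)" "a \<odot>\<^bsub>?F\<^esub> c = (\<lambda>x. a \<otimes>\<^bsub>R\<^esub> c x)"
    "\<zero>\<^bsub>?F\<^esub> = (\<lambda>_. \<zero>\<^bsub>R\<^esub>)" for a c d by (simp_all add: free_module_def)
  have ab: "abelian_group ?F"
  proof (rule abelian_groupI)
    fix c assume c: "c \<in> carrier ?F"
    show "\<exists>d\<in>carrier ?F. d \<oplus>\<^bsub>?F\<^esub> c = \<zero>\<^bsub>?F\<^esub>"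
      by (rule bexI[OF _ smult[of "\<ominus>\<^bsub>R\<^esub> \<one>\<^bsub>R\<^esub>" c]])
        (use D(1)[OF c] c in \<open>simp_all add: ops R.l_minus R.l_neg\<close>)
  qed (auto simp: ops add zero fun_eq_iff intro: R.a_assoc R.a_comm R.l_zero dest: D(1))
  show ?thesis
    by (rule left_moduleI[OF assms ab])
      (auto simp: ops smult fun_eq_iff intro: R.l_distr R.r_distr R.m_assoc R.l_one dest: D(1))
qed

lemma free_basis_in_free_module: "ring R \<Longrightarrow> x \<in> S \<Longrightarrow> free_basis R x \<in> carrier (free_module R S)"
proof -
  assume "ring R" "x \<in> S"
  then interpret ring R by simp
  have "{y. free_basis R x y \<noteq> \<zero>\<^bsub>R\<^esub>} \<subseteq> {x}" by (auto simp: free_basis_def)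
  then have "finite {y. free_basis R x y \<noteq> \<zero>\<^bsub>R\<^esub>}" "{y. free_basis R x y \<noteq> \<zero>\<^bsub>R\<^esub>} \<subseteq> S"
    using \<open>x \<in> S\<close> finite_subset by auto
  then show ?thesis by (auto simp: free_module_def free_basis_def)
qed

text \<open>
  The sum over the support may be taken over any larger finite set, so that the supports of several
  coefficient functions can be treated together.
\<close>

lemma free_lift_superset:
  assumes N: "left_module R N" and c: "c \<in> carrier (free_module R S)"
    and A: "finite A" "{x. c x \<noteq> \<zero>\<^bsub>R\<^esub>} \<subseteq> A" "A \<subseteq> S" and g: "g \<in> S \<rightarrow> carrier N"
  shows "free_lift R N g c = (\<Oplus>\<^bsub>N\<^esub>x\<in>A. c x \<odot>\<^bsub>N\<^esub> g x)"
proof -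
  interpret N: left_module R N by fact
  have g: "g x \<in> carrier N" if "x \<in> A" for x using g A that by auto
  show ?thesis unfolding free_lift_def
    by (rule N.M.add.finprod_mono_neutral_cong_left[simplified])
      (use A g free_moduleD(1)[OF c] in auto)
qed

lemma free_lift_lin_hom:
  assumes N: "left_module R N" and g: "g \<in> S \<rightarrow> carrier N"
  shows "free_lift R N g \<in> lin_hom R (free_module R S) N"
proof -
  interpret N: left_module R N by fact
  let ?F = "free_module R S"
  interpret F: left_module R ?F by (rule free_left_module[OF N.R.ring_axioms])
  note D = free_moduleD
  have gS: "g x \<in> carrier N" if "x \<in> S" for x using g that by auto
  show ?thesis
  proof (rule lin_homI)
    fix c assume c: "c \<in> carrier ?F"
    have *: "c x \<odot>\<^bsub>N\<^esub> g x \<in> carrier N" if "x \<in> {x. c x \<noteq> \<zero>\<^bsub>R\<^esub>}" for x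
      using D(1)[OF c, of x] subsetD[OF D(3)[OF c] that] gS by simp
    show "free_lift R N g c \<in> carrier N"
      unfolding free_lift_def by (rule N.M.finsum_closed) (use * in auto)
    fix d assume d: "d \<in> carrier ?F"
    let ?A = "{x. c x \<noteq> \<zero>\<^bsub>R\<^esub>} \<union> {x. d x \<noteq> \<zero>\<^bsub>R\<^esub>}"
    have A: "finite ?A" "?A \<subseteq> S" using D(2,3)[OF c] D(2,3)[OF d] by auto
    have gA: "g x \<in> carrier N" if "x \<in> ?A" for x using gS subsetD[OF A(2) that] .
    have cd: "c \<oplus>\<^bsub>?F\<^esub> d \<in> carrier ?F" using c d by simp
    have ap: "(c \<oplus>\<^bsub>?F\<^esub> d) x = c x \<oplus>\<^bsub>R\<^esub> d x" for x by (simp add: free_module_def)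
    have sub: "{x. (c \<oplus>\<^bsub>?F\<^esub> d) x \<noteq> \<zero>\<^bsub>R\<^esub>} \<subseteq> ?A" by (auto simp: ap)
    have "free_lift R N g (c \<oplus>\<^bsub>?F\<^esub> d) = (\<Oplus>\<^bsub>N\<^esub>x\<in>?A. (c \<oplus>\<^bsub>?F\<^esub> d) x \<odot>\<^bsub>N\<^esub> g x)"
      by (rule free_lift_superset[OF N cd A(1) sub A(2) g])
    also have "\<dots> = (\<Oplus>\<^bsub>N\<^esub>x\<in>?A. c x \<odot>\<^bsub>N\<^esub> g x \<oplus>\<^bsub>N\<^esub> d x \<odot>\<^bsub>N\<^esub> g x)"
      by (rule N.M.finsum_cong') (use gA D(1)[OF c] D(1)[OF d] in \<open>auto simp: ap N.smult_l_distr\<close>)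
    also have "\<dots> = (\<Oplus>\<^bsub>N\<^esub>x\<in>?A. c x \<odot>\<^bsub>N\<^esub> g x) \<oplus>\<^bsub>N\<^esub> (\<Oplus>\<^bsub>N\<^esub>x\<in>?A. d x \<odot>\<^bsub>N\<^esub> g x)"
      by (rule N.M.finsum_addf) (use gA D(1)[OF c] D(1)[OF d] in auto)
    also have "\<dots> = free_lift R N g c \<oplus>\<^bsub>N\<^esub> free_lift R N g d"
      using free_lift_superset[OF N c A(1) Un_upper1 A(2) g] free_lift_superset[OF N d A(1) Un_upper2 A(2) g]
      by simp
    finally show "free_lift R N g (c \<oplus>\<^bsub>?F\<^esub> d) = free_lift R N g c \<oplus>\<^bsub>N\<^esub> free_lift R N g d" .
  next
    fix a c assume a: "a \<in> carrier R" and c: "c \<in> carrier ?F"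
    let ?A = "{x. c x \<noteq> \<zero>\<^bsub>R\<^esub>}"
    have gA: "g x \<in> carrier N" if "x \<in> ?A" for x using gS subsetD[OF D(3)[OF c] that] .
    have ap: "(a \<odot>\<^bsub>?F\<^esub> c) x = a \<otimes>\<^bsub>R\<^esub> c x" for x by (simp add: free_module_def)
    have sub: "{x. (a \<odot>\<^bsub>?F\<^esub> c) x \<noteq> \<zero>\<^bsub>R\<^esub>} \<subseteq> ?A" using a by (auto simp: ap)
    have "free_lift R N g (a \<odot>\<^bsub>?F\<^esub> c) = (\<Oplus>\<^bsub>N\<^esub>x\<in>?A. (a \<odot>\<^bsub>?F\<^esub> c) x \<odot>\<^bsub>N\<^esub> g x)"
      by (rule free_lift_superset[OF N _ D(2)[OF c] sub D(3)[OF c] g]) (use a c in simp)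
    also have "\<dots> = (\<Oplus>\<^bsub>N\<^esub>x\<in>?A. a \<odot>\<^bsub>N\<^esub> (c x \<odot>\<^bsub>N\<^esub> g x))"
      by (rule N.M.finsum_cong') (use gA D(1)[OF c] a in \<open>auto simp: ap N.smult_assoc\<close>)
    also have "\<dots> = a \<odot>\<^bsub>N\<^esub> free_lift R N g c"
      unfolding free_lift_def
      by (rule N.finsum_smult_r[symmetric, OF D(2)[OF c] a]) (use gA D(1)[OF c] in auto)
    finally show "free_lift R N g (a \<odot>\<^bsub>?F\<^esub> c) = a \<odot>\<^bsub>N\<^esub> free_lift R N g c" .
  qed
qed

lemma free_lift_basis:
  assumes N: "left_module R N" and g: "g \<in> S \<rightarrow> carrier N" and x: "x \<in> S"
  shows "free_lift R N g (free_basis R x) = g x"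
proof -
  interpret N: left_module R N by fact
  have gx: "g x \<in> carrier N" using g x by auto
  have "free_lift R N g (free_basis R x) = (\<Oplus>\<^bsub>N\<^esub>y\<in>{x}. free_basis R x y \<odot>\<^bsub>N\<^esub> g y)"
    by (rule free_lift_superset[OF N free_basis_in_free_module[OF N.R.ring_axioms x] _ _ _ g])
      (use x in \<open>auto simp: free_basis_def\<close>)
  also have "\<dots> = g x" using gx by (simp add: free_basis_def)
  finally show ?thesis .
qed

lemma free_module_hom_eqI:
  assumes N: "left_module R N" and f: "f \<in> lin_hom R (free_module R S) N" and g: "g \<in> lin_hom R (free_module R S) N"
    and eq: "\<And>x. x \<in> S \<Longrightarrow> f (free_basis R x) = g (free_basis R x)"
    and c: "c \<in> carrier (free_module R S)"
  shows "f c = g c"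
proof -
  interpret N: left_module R N by fact
  let ?F = "free_module R S"
  have F: "left_module R ?F" by (rule free_left_module[OF N.R.ring_axioms])
  interpret F: left_module R ?F by (rule F)
  have "\<forall>c\<in>carrier ?F. {x. c x \<noteq> \<zero>\<^bsub>R\<^esub>} \<subseteq> A \<longrightarrow> f c = g c" if "finite A" "A \<subseteq> S" for A
    using that
  proof (induction A rule: finite_induct)
    case empty
    have "c = \<zero>\<^bsub>?F\<^esub>" if "{x. c x \<noteq> \<zero>\<^bsub>R\<^esub>} \<subseteq> {}" for c
      using that by (auto simp: free_module_def)
    then show ?case using lin_hom_zero[OF F N f] lin_hom_zero[OF F N g] by metis
  next
    case (insert x A)
    show ?case
    proof (intro ballI impI)
      fix c assume c: "c \<in> carrier ?F" and sub: "{y. c y \<noteq> \<zero>\<^bsub>R\<^esub>} \<subseteq> insert x A"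
      let ?d = "c(x := \<zero>\<^bsub>R\<^esub>)" and ?b = "free_basis R x"
      have x: "x \<in> S" using insert.prems by simp
      have b: "?b \<in> carrier ?F" by (rule free_basis_in_free_module[OF N.R.ring_axioms x])
      have cx: "c x \<in> carrier R" by (rule free_moduleD(1)[OF c])
      have "finite {y. ?d y \<noteq> \<zero>\<^bsub>R\<^esub>}" "{y. ?d y \<noteq> \<zero>\<^bsub>R\<^esub>} \<subseteq> S"
        using free_moduleD(3)[OF c] by (auto intro!: finite_subset[OF _ free_moduleD(2)[OF c]])
      then have d: "?d \<in> carrier ?F"
        using free_moduleD(1)[OF c] by (simp add: free_module_def image_subset_iff)
      have "{y. ?d y \<noteq> \<zero>\<^bsub>R\<^esub>} \<subseteq> A" using sub by auto
      then have fd: "f ?d = g ?d" using insert.IH insert.prems d by simp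
      have c_eq: "c = (c x \<odot>\<^bsub>?F\<^esub> ?b) \<oplus>\<^bsub>?F\<^esub> ?d"
        using free_moduleD(1)[OF c] by (simp add: free_module_def free_basis_def fun_eq_iff)
      have "f ((c x \<odot>\<^bsub>?F\<^esub> ?b) \<oplus>\<^bsub>?F\<^esub> ?d) = g ((c x \<odot>\<^bsub>?F\<^esub> ?b) \<oplus>\<^bsub>?F\<^esub> ?d)"
        using cx b d fd eq[OF x] by (simp add: lin_hom_add[OF f] lin_hom_add[OF g] lin_hom_smult[OF f] lin_hom_smult[OF g])
      then show "f c = g c" using c_eq by simp
    qed
  qed
  from this[OF free_moduleD(2,3)[OF c]] c show ?thesis by simp
qed

text \<open>
  The free module on the carrier of \<open>M\<close> itself; its elements are finitely supported functions, which the
  universe can accommodate.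
\<close>

lemma enough_projectives:
  fixes M :: "('a, 'm) module"
  assumes U: "module_universe TYPE('a) TYPE('m)" and M: "left_module R M"
  obtains P :: "('a, 'm) module" and p where "projective_module R P" "p \<in> lin_hom R P M"
    "p ` carrier P = carrier M"
proof -
  interpret M: left_module R M by fact
  let ?S = "carrier M" and ?F = "free_module R (carrier M)"
  have F: "left_module R ?F" by (rule free_left_module[OF M.R.ring_axioms])
  obtain i :: "('m \<Rightarrow> 'a) \<Rightarrow> 'm" where i: "inj_on i {c. finite {x. c x \<noteq> \<zero>\<^bsub>R\<^esub>}}"
    using finite_support_functions_embed[OF U module_universe_embeddings(2)[OF U], of "\<zero>\<^bsub>R\<^esub>"] by (elim exE) simp
  have i: "inj_on i (carrier ?F)"
    by (rule inj_on_subset[OF i]) (auto simp: free_module_def)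
  obtain P :: "('a, 'm) module" where P: "left_module R P" and iP: "i \<in> lin_hom R ?F P"
    and i_surj: "i ` carrier ?F = carrier P"
    by (rule transport_module[OF F i])
  obtain j where j: "j \<in> lin_hom R P ?F" "\<forall>c\<in>carrier ?F. j (i c) = c" "\<forall>y\<in>carrier P. i (j y) = y"
    by (rule lin_hom_inverse[OF F P iP i i_surj]) (rule that)
  have jc: "j y \<in> carrier ?F" if "y \<in> carrier P" for y by (rule lin_hom_closed[OF j(1) that])
  have "projective_module R P"
    unfolding projective_module_def
  proof (intro conjI P allI impI, elim conjE)
    fix A B :: "('a, 'm) module" and f g
    assume A: "left_module R A" and B: "left_module R B" and f: "f \<in> lin_hom R A B"
      and f_surj: "f ` carrier A = carrier B" and g: "g \<in> lin_hom R P B"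
    define l where "l x = inv_into (carrier A) f (g (i (free_basis R x)))" for x
    have gi: "(\<lambda>c. g (i c)) \<in> lin_hom R ?F B" by (rule lin_hom_comp[OF iP g])
    have gb: "g (i (free_basis R x)) \<in> f ` carrier A" if "x \<in> ?S" for x
      using lin_hom_closed[OF gi free_basis_in_free_module[OF M.R.ring_axioms that]] f_surj by simp
    have l: "l \<in> ?S \<rightarrow> carrier A" using inv_into_into[OF gb] by (simp add: l_def)
    have fl: "f (l x) = g (i (free_basis R x))" if "x \<in> ?S" for x
      unfolding l_def by (rule f_inv_into_f[OF gb[OF that]])
    note L = free_lift_lin_hom[OF A l]
    have "f (free_lift R A l c) = g (i c)" if "c \<in> carrier ?F" for c
      by (rule free_module_hom_eqI[OF B lin_hom_comp[OF L f] gi _ that])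
        (simp add: free_lift_basis[OF A l] fl)
    then show "\<exists>h\<in>lin_hom R P A. \<forall>x\<in>carrier P. f (h x) = g x"
      by (intro bexI[OF _ lin_hom_comp[OF j(1) L]]) (simp add: jc j(3))
  qed
  moreover have id: "(\<lambda>x. x) \<in> ?S \<rightarrow> carrier M" by simp
  have L: "free_lift R M (\<lambda>x. x) \<in> lin_hom R ?F M" by (rule free_lift_lin_hom[OF M id])
  have pL: "(\<lambda>y. free_lift R M (\<lambda>x. x) (j y)) \<in> lin_hom R P M" by (rule lin_hom_comp[OF j(1) L])
  moreover have "(\<lambda>y. free_lift R M (\<lambda>x. x) (j y)) ` carrier P = carrier M"
  proof
    show "(\<lambda>y. free_lift R M (\<lambda>x. x) (j y)) ` carrier P \<subseteq> carrier M"
      using lin_hom_closed[OF pL] by auto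
    show "carrier M \<subseteq> (\<lambda>y. free_lift R M (\<lambda>x. x) (j y)) ` carrier P"
    proof
      fix x assume x: "x \<in> carrier M"
      note b = free_basis_in_free_module[OF M.R.ring_axioms x]
      show "x \<in> (\<lambda>y. free_lift R M (\<lambda>x. x) (j y)) ` carrier P"
      proof (rule image_eqI)
        show "i (free_basis R x) \<in> carrier P" by (rule lin_hom_closed[OF iP b])
        show "x = free_lift R M (\<lambda>x. x) (j (i (free_basis R x)))"
          using free_lift_basis[OF M id x] j(2) b by simp
      qed
    qed
  qed
  ultimately show ?thesis by (rule that)
qed

lemma projective_module_left_module: "projective_module R P \<Longrightarrow> left_module R P"
  by (simp add: projective_module_def)

lemma projective_module_lifts:
  fixes P M N :: "('a, 'm) module"
  assumes "projective_module R P" "left_module R M" "left_module R N"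
    "f \<in> lin_hom R M N" "f ` carrier M = carrier N" "g \<in> lin_hom R P N"
  obtains h where "h \<in> lin_hom R P M" "\<forall>x\<in>carrier P. f (h x) = g x"
proof -
  have "\<exists>h\<in>lin_hom R P M. \<forall>x\<in>carrier P. f (h x) = g x"
    using assms(1)[unfolded projective_module_def, THEN conjunct2, rule_format, of M N f g] assms(2-) by simp
  then show ?thesis by (elim bexE) (rule that)
qed

lemma zero_module_projective:
  fixes P :: "('a, 'm) module"
  assumes P: "left_module R P" and "zero_module P" shows "projective_module R P"
  unfolding projective_module_def
proof (intro conjI P allI impI, elim conjE)
  fix M N :: "('a, 'm) module" and f g
  assume M: "left_module R M" and N: "left_module R N" and f: "f \<in> lin_hom R M N"
    and g: "g \<in> lin_hom R P N"
  interpret M: left_module R M by fact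
  interpret P: left_module R P by fact
  have P0: "carrier P = {\<zero>\<^bsub>P\<^esub>}" using assms(2) by (simp add: zero_module_def)
  have "(\<lambda>_. \<zero>\<^bsub>M\<^esub>) \<in> lin_hom R P M" by (rule lin_homI) auto
  then show "\<exists>h\<in>lin_hom R P M. \<forall>x\<in>carrier P. f (h x) = g x"
    by (rule bexI[rotated]) (use lin_hom_zero[OF M N f] lin_hom_zero[OF P N g] P0 in simp)
qed

lemma zero_module_injective:
  fixes E :: "('a, 'm) module"
  assumes E: "left_module R E" and "zero_module E" shows "injective_module R E"
  unfolding injective_module_def
proof (intro conjI E allI impI, elim conjE)
  fix M N :: "('a, 'm) module" and f g
  assume M: "left_module R M" and N: "left_module R N" and g: "g \<in> lin_hom R M E"
  interpret E: left_module R E by fact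
  have E0: "carrier E = {\<zero>\<^bsub>E\<^esub>}" using assms(2) by (simp add: zero_module_def)
  have "(\<lambda>_. \<zero>\<^bsub>E\<^esub>) \<in> lin_hom R N E" by (rule lin_homI) auto
  then show "\<exists>h\<in>lin_hom R N E. \<forall>x\<in>carrier M. h (f x) = g x"
    by (rule bexI[rotated]) (use lin_hom_closed[OF g] E0 in auto)
qed

section \<open>Cohomology and resolutions elementwise\<close>

lemma is_complexD:
  assumes "is_complex R C"
  shows "left_module R (obj C n)" "diff C n \<in> lin_hom R (obj C n) (obj C (n + 1))"
    "diff C (n - 1) \<in> lin_hom R (obj C (n - 1)) (obj C n)"
    "x \<in> carrier (obj C n) \<Longrightarrow> diff C (n + 1) (diff C n x) = \<zero>\<^bsub>obj C (n + 2)\<^esub>"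
    "y \<in> carrier (obj C (n - 1)) \<Longrightarrow> diff C n (diff C (n - 1) y) = \<zero>\<^bsub>obj C (n + 1)\<^esub>"
proof -
  have *: "left_module R (obj C n) \<and> diff C n \<in> lin_hom R (obj C n) (obj C (n + 1)) \<and>
    (\<forall>x\<in>carrier (obj C n). diff C (n + 1) (diff C n x) = \<zero>\<^bsub>obj C (n + 2)\<^esub>)" for n
    using assms unfolding is_complex_def by (rule spec)
  from *[of n] show "left_module R (obj C n)" "diff C n \<in> lin_hom R (obj C n) (obj C (n + 1))"
    "x \<in> carrier (obj C n) \<Longrightarrow> diff C (n + 1) (diff C n x) = \<zero>\<^bsub>obj C (n + 2)\<^esub>" by simp_all
  have e: "n - 1 + 1 = n" "n - 1 + 2 = n + 1" by simp_all
  from *[of "n - 1"] show "diff C (n - 1) \<in> lin_hom R (obj C (n - 1)) (obj C n)"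
    "y \<in> carrier (obj C (n - 1)) \<Longrightarrow> diff C n (diff C (n - 1) y) = \<zero>\<^bsub>obj C (n + 1)\<^esub>"
    unfolding e by simp_all
qed

lemma cocycles_iff: "x \<in> cocycles C n \<longleftrightarrow> x \<in> carrier (obj C n) \<and> diff C n x = \<zero>\<^bsub>obj C (n + 1)\<^esub>"
  by (simp add: cocycles_def lin_kernel_def)

lemma coboundaries_iff: "x \<in> coboundaries C n \<longleftrightarrow> (\<exists>y\<in>carrier (obj C (n - 1)). x = diff C (n - 1) y)"
  by (auto simp: coboundaries_def)

lemma cocycles_submodule: "is_complex R C \<Longrightarrow> submodule (cocycles C n) R (obj C n)"
  unfolding cocycles_def by (intro lin_kernel_submodule is_complexD)

lemma coboundaries_submodule:
  assumes C: "is_complex R C" shows "submodule (coboundaries C n) R (obj C n)"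
  unfolding coboundaries_def
  by (rule lin_hom_image_submodule[OF _ _ _ submodule_carrier]) (rule is_complexD[OF C])+

lemma coboundaries_subset_cocycles: "is_complex R C \<Longrightarrow> coboundaries C n \<subseteq> cocycles C n"
  by (auto simp: cocycles_iff coboundaries_iff is_complexD(5) intro: lin_hom_closed[OF is_complexD(3)])

text \<open>
  Cohomology is defined by cosets. The following lemmas turn vanishing of cohomology and quasi-isomorphy
  into statements about cocycles and coboundaries, the only form in which they are used.
\<close>

lemma coset_eq_iff:
  assumes M: "left_module R M" and K: "submodule K R M" and xy: "x \<in> carrier M" "y \<in> carrier M"
  shows "K +>\<^bsub>M\<^esub> x = K +>\<^bsub>M\<^esub> y \<longleftrightarrow> x \<ominus>\<^bsub>M\<^esub> y \<in> K"
proof -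
  interpret M: left_module R M by fact
  interpret K: abelian_subgroup K M
    using submodule.axioms(1)[OF K] M.M.abelian_group_axioms
    by (intro abelian_subgroupI3 additive_subgroupI)
  show ?thesis
    using K.a_rcos_module[OF xy(2,1)] K.a_repr_independence'[OF _ xy(2), of x] K.a_rcos_self[OF xy(1)]
    by (auto simp: a_minus_def)
qed

lemma carrier_cohomology:
  "carrier (cohomology C n) = (\<lambda>z. coboundaries C n +>\<^bsub>obj C n\<^esub> z) ` cocycles C n"
  unfolding cohomology_def quotient_module_def A_RCOSETS_def' a_r_coset_def' by auto

lemma zero_module_cohomology_iff:
  assumes C: "is_complex R C"
  shows "zero_module (cohomology C n) \<longleftrightarrow> cocycles C n \<subseteq> coboundaries C n"
proof -
  let ?B = "coboundaries C n" and ?M = "obj C n"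
  note M = is_complexD(1)[OF C, of n] and Z = cocycles_submodule[OF C, of n]
    and B = coboundaries_submodule[OF C, of n]
  interpret M: left_module R ?M by (rule M)
  have Zc: "z \<in> carrier ?M" if "z \<in> cocycles C n" for z using that submodule_subset[OF Z] by blast
  have B0: "?B +>\<^bsub>?M\<^esub> \<zero>\<^bsub>?M\<^esub> = ?B" using submodule_subset[OF B] by simp
  have *: "?B +>\<^bsub>?M\<^esub> z = ?B \<longleftrightarrow> z \<in> ?B" if "z \<in> cocycles C n" for z
    using coset_eq_iff[OF M B Zc[OF that], of "\<zero>\<^bsub>?M\<^esub>"] Zc[OF that] B0 by simp
  have "\<zero>\<^bsub>cohomology C n\<^esub> = ?B" by (simp add: cohomology_def quotient_module_def)
  then have "zero_module (cohomology C n) \<longleftrightarrow> (\<lambda>z. ?B +>\<^bsub>?M\<^esub> z) ` cocycles C n = {?B}"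
    by (simp add: zero_module_def carrier_cohomology)
  also have "\<dots> \<longleftrightarrow> (\<forall>z\<in>cocycles C n. ?B +>\<^bsub>?M\<^esub> z = ?B)"
    using submodule_zero_closed[OF Z] by auto
  also have "\<dots> \<longleftrightarrow> cocycles C n \<subseteq> ?B" using * by blast
  finally show ?thesis .
qed

lemma chain_mapD:
  assumes "chain_map R C D f"
  shows "is_complex R C" "is_complex R D" "f n \<in> lin_hom R (obj C n) (obj D n)"
    "x \<in> carrier (obj C n) \<Longrightarrow> f (n + 1) (diff C n x) = diff D n (f n x)"
    "y \<in> carrier (obj C (n - 1)) \<Longrightarrow> f n (diff C (n - 1) y) = diff D (n - 1) (f (n - 1) y)"
proof -
  have *: "f n \<in> lin_hom R (obj C n) (obj D n) \<and>
      (\<forall>x\<in>carrier (obj C n). f (n + 1) (diff C n x) = diff D n (f n x))" for n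
    using assms unfolding chain_map_def by blast
  show "is_complex R C" "is_complex R D" using assms by (simp_all add: chain_map_def)
  from *[of n] show "f n \<in> lin_hom R (obj C n) (obj D n)"
    "x \<in> carrier (obj C n) \<Longrightarrow> f (n + 1) (diff C n x) = diff D n (f n x)" by simp_all
  have e: "n - 1 + 1 = n" by simp
  from *[of "n - 1"] show "y \<in> carrier (obj C (n - 1)) \<Longrightarrow> f n (diff C (n - 1) y) = diff D (n - 1) (f (n - 1) y)"
    unfolding e by simp
qed

lemma chain_map_cocycle:
  assumes f: "chain_map R C D f" and z: "z \<in> cocycles C n"
  shows "f n z \<in> cocycles D n"
proof -
  note C = chain_mapD(1)[OF f] and D = chain_mapD(2)[OF f]
  have z: "z \<in> carrier (obj C n)" "diff C n z = \<zero>\<^bsub>obj C (n + 1)\<^esub>" using z by (simp_all add: cocycles_iff)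
  have "diff D n (f n z) = f (n + 1) \<zero>\<^bsub>obj C (n + 1)\<^esub>"
    using chain_mapD(4)[OF f z(1)] z(2) by simp
  also have "\<dots> = \<zero>\<^bsub>obj D (n + 1)\<^esub>"
    by (rule lin_hom_zero[OF is_complexD(1)[OF C] is_complexD(1)[OF D] chain_mapD(3)[OF f]])
  finally show ?thesis using lin_hom_closed[OF chain_mapD(3)[OF f] z(1)] by (simp add: cocycles_iff)
qed

lemma chain_map_coboundary:
  assumes f: "chain_map R C D f" and z: "z \<in> coboundaries C n"
  shows "f n z \<in> coboundaries D n"
  using z chain_mapD(5)[OF f] lin_hom_closed[OF chain_mapD(3)[OF f]] by (auto simp: coboundaries_iff)

lemma cohomology_map_coset:
  assumes f: "chain_map R C D f" and z: "z \<in> cocycles C n"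
  shows "cohomology_map D f n (coboundaries C n +>\<^bsub>obj C n\<^esub> z) = coboundaries D n +>\<^bsub>obj D n\<^esub> f n z"
proof -
  let ?B = "coboundaries C n" and ?M = "obj C n" and ?B' = "coboundaries D n" and ?N = "obj D n"
  note C = chain_mapD(1)[OF f] and D = chain_mapD(2)[OF f] and fn = chain_mapD(3)[OF f, of n]
  note M = is_complexD(1)[OF C, of n] and N = is_complexD(1)[OF D, of n]
  note B = coboundaries_submodule[OF C, of n] and B' = coboundaries_submodule[OF D, of n]
  interpret M: left_module R ?M by (rule M)
  interpret N: left_module R ?N by (rule N)
  have zc: "z \<in> carrier ?M" using z by (simp add: cocycles_iff)
  have "?B' +>\<^bsub>?N\<^esub> f n x = ?B' +>\<^bsub>?N\<^esub> f n z" if xB: "x \<in> ?B +>\<^bsub>?M\<^esub> z" for x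
  proof -
    obtain b where b: "b \<in> ?B" "x = b \<oplus>\<^bsub>?M\<^esub> z" using xB by (auto simp: a_r_coset_def')
    have bc: "b \<in> carrier ?M" using b(1) submodule_subset[OF B] by blast
    have fb: "f n b \<in> ?B'" by (rule chain_map_coboundary[OF f b(1)])
    have cl: "f n b \<in> carrier ?N" "f n z \<in> carrier ?N" "x \<in> carrier ?M" "f n x \<in> carrier ?N"
      using lin_hom_closed[OF fn] bc zc b(2) by simp_all
    have "f n x \<ominus>\<^bsub>?N\<^esub> f n z = f n b"
      using cl by (simp add: b(2) lin_hom_add[OF fn bc zc] a_minus_def N.M.a_assoc N.M.r_neg)
    then show ?thesis using coset_eq_iff[OF N B' cl(4,2)] fb by simp
  qed
  moreover have "z \<in> ?B +>\<^bsub>?M\<^esub> z"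
    using submodule_zero_closed[OF B] zc by (auto simp: a_r_coset_def' intro!: bexI[of _ "\<zero>\<^bsub>?M\<^esub>"])
  ultimately show ?thesis unfolding cohomology_map_def by blast
qed

lemma quasi_iso_iff:
  "quasi_iso R C D f \<longleftrightarrow> chain_map R C D f \<and>
    (\<forall>n. (\<forall>x\<in>cocycles C n. f n x \<in> coboundaries D n \<longrightarrow> x \<in> coboundaries C n) \<and>
      (\<forall>y\<in>cocycles D n. \<exists>x\<in>cocycles C n. y \<ominus>\<^bsub>obj D n\<^esub> f n x \<in> coboundaries D n))"
proof (cases "chain_map R C D f")
  case f: True
  have "bij_betw (cohomology_map D f n) (carrier (cohomology C n)) (carrier (cohomology D n)) \<longleftrightarrow>
    (\<forall>x\<in>cocycles C n. f n x \<in> coboundaries D n \<longrightarrow> x \<in> coboundaries C n) \<and>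
    (\<forall>y\<in>cocycles D n. \<exists>x\<in>cocycles C n. y \<ominus>\<^bsub>obj D n\<^esub> f n x \<in> coboundaries D n)" for n
  proof -
    let ?B = "coboundaries C n" and ?M = "obj C n" and ?B' = "coboundaries D n" and ?N = "obj D n"
    let ?Z = "cocycles C n" and ?Z' = "cocycles D n"
    note C = chain_mapD(1)[OF f] and D = chain_mapD(2)[OF f] and fn = chain_mapD(3)[OF f, of n]
    note M = is_complexD(1)[OF C, of n] and N = is_complexD(1)[OF D, of n]
    note B = coboundaries_submodule[OF C, of n] and B' = coboundaries_submodule[OF D, of n]
    interpret M: left_module R ?M by (rule M)
    interpret N: left_module R ?N by (rule N)
    have Zc: "z \<in> carrier ?M" "f n z \<in> carrier ?N" if "z \<in> ?Z" for z
      using that lin_hom_closed[OF fn] by (simp_all add: cocycles_iff)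
    have Zc': "z \<in> carrier ?N" if "z \<in> ?Z'" for z using that by (simp add: cocycles_iff)
    have eqM: "?B +>\<^bsub>?M\<^esub> x = ?B +>\<^bsub>?M\<^esub> y \<longleftrightarrow> x \<ominus>\<^bsub>?M\<^esub> y \<in> ?B" if "x \<in> ?Z" "y \<in> ?Z" for x y
      using coset_eq_iff[OF M B Zc(1)[OF that(1)] Zc(1)[OF that(2)]] .
    have eqN: "?B' +>\<^bsub>?N\<^esub> f n x = ?B' +>\<^bsub>?N\<^esub> f n y \<longleftrightarrow> f n (x \<ominus>\<^bsub>?M\<^esub> y) \<in> ?B'" if "x \<in> ?Z" "y \<in> ?Z" for x y
      using coset_eq_iff[OF N B' Zc(2)[OF that(1)] Zc(2)[OF that(2)]]
      by (simp add: lin_hom_diff[OF M N fn Zc(1)[OF that(1)] Zc(1)[OF that(2)]])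
    have inj: "inj_on (cohomology_map D f n) (carrier (cohomology C n)) \<longleftrightarrow>
      (\<forall>x\<in>?Z. f n x \<in> ?B' \<longrightarrow> x \<in> ?B)" (is "?I \<longleftrightarrow> ?K")
    proof -
      have "?I \<longleftrightarrow> (\<forall>x\<in>?Z. \<forall>y\<in>?Z. f n (x \<ominus>\<^bsub>?M\<^esub> y) \<in> ?B' \<longrightarrow> x \<ominus>\<^bsub>?M\<^esub> y \<in> ?B)"
        unfolding inj_on_def carrier_cohomology ball_simps
        by (simp add: cohomology_map_coset[OF f] eqM eqN)
      also have "\<dots> \<longleftrightarrow> ?K"
      proof
        assume L: "\<forall>x\<in>?Z. \<forall>y\<in>?Z. f n (x \<ominus>\<^bsub>?M\<^esub> y) \<in> ?B' \<longrightarrow> x \<ominus>\<^bsub>?M\<^esub> y \<in> ?B"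
        show ?K
        proof (intro ballI impI)
          fix x assume x: "x \<in> ?Z" "f n x \<in> ?B'"
          have "x \<ominus>\<^bsub>?M\<^esub> \<zero>\<^bsub>?M\<^esub> = x" using Zc(1)[OF x(1)] by simp
          with L[rule_format, OF x(1) submodule_zero_closed[OF cocycles_submodule[OF C]]] x(2)
          show "x \<in> ?B" by simp
        qed
      next
        assume ?K
        then show "\<forall>x\<in>?Z. \<forall>y\<in>?Z. f n (x \<ominus>\<^bsub>?M\<^esub> y) \<in> ?B' \<longrightarrow> x \<ominus>\<^bsub>?M\<^esub> y \<in> ?B"
          using submodule_diff_closed[OF cocycles_submodule[OF C]] by blast
      qed
      finally show ?thesis .
    qed
    have sub: "cohomology_map D f n ` carrier (cohomology C n) \<subseteq> carrier (cohomology D n)"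
      using cohomology_map_coset[OF f] chain_map_cocycle[OF f] by (auto simp: carrier_cohomology)
    have "cohomology_map D f n ` carrier (cohomology C n) = carrier (cohomology D n) \<longleftrightarrow>
      carrier (cohomology D n) \<subseteq> cohomology_map D f n ` carrier (cohomology C n)"
      using sub by blast
    also have "\<dots> \<longleftrightarrow> (\<forall>y\<in>?Z'. \<exists>x\<in>?Z. ?B' +>\<^bsub>?N\<^esub> y = ?B' +>\<^bsub>?N\<^esub> f n x)"
      unfolding carrier_cohomology image_image image_subset_iff
      by (simp add: cohomology_map_coset[OF f] image_iff cong: bex_cong)
    also have "\<dots> \<longleftrightarrow> (\<forall>y\<in>?Z'. \<exists>x\<in>?Z. y \<ominus>\<^bsub>?N\<^esub> f n x \<in> ?B')"
      using coset_eq_iff[OF N B'] Zc Zc' by (intro ball_cong bex_cong) simp_all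
    finally show ?thesis using inj by (simp add: bij_betw_def)
  qed
  then show ?thesis using f by (simp add: quasi_iso_def)
qed (simp add: quasi_iso_def)

subsection \<open>Complexes concentrated in degree zero\<close>

lemma stalk_complex_simps [simp]:
  "obj (stalk_complex M) 0 = M" "n \<noteq> 0 \<Longrightarrow> obj (stalk_complex M) n = M\<lparr>carrier := {\<zero>\<^bsub>M\<^esub>}\<rparr>"
  "diff (stalk_complex M) n x = \<zero>\<^bsub>M\<^esub>" "\<zero>\<^bsub>obj (stalk_complex M) n\<^esub> = \<zero>\<^bsub>M\<^esub>"
  by (simp_all add: stalk_complex_def)

lemma stalk_obj_left_module: "left_module R M \<Longrightarrow> left_module R (obj (stalk_complex M) n)"
  by (cases "n = 0") (simp_all add: submodule_left_module submodule_zero)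

lemma zero_lin_hom:
  assumes "left_module R M" "left_module R N"
  shows "(\<lambda>_. \<zero>\<^bsub>N\<^esub>) \<in> lin_hom R M N"
proof -
  interpret M: left_module R M by fact
  interpret N: left_module R N by fact
  show ?thesis by (rule lin_homI) auto
qed

lemma stalk_is_complex:
  assumes M: "left_module R M" shows "is_complex R (stalk_complex M)"
proof -
  have "diff (stalk_complex M) n = (\<lambda>_. \<zero>\<^bsub>obj (stalk_complex M) (n + 1)\<^esub>)" for n
    by (simp add: fun_eq_iff)
  then have "diff (stalk_complex M) n \<in> lin_hom R (obj (stalk_complex M) n) (obj (stalk_complex M) (n + 1))" for n
    using zero_lin_hom[OF stalk_obj_left_module[OF M, of n] stalk_obj_left_module[OF M, of "n + 1"]] by simp
  then show ?thesis unfolding is_complex_def using stalk_obj_left_module[OF M] by simp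
qed

lemma stalk_cocycles: "cocycles (stalk_complex M) n = carrier (obj (stalk_complex M) n)"
  by (auto simp: cocycles_iff)

lemma stalk_coboundaries:
  assumes M: "left_module R M" shows "coboundaries (stalk_complex M) n = {\<zero>\<^bsub>M\<^esub>}"
proof -
  interpret left_module R "obj (stalk_complex M) (n - 1)" by (rule stalk_obj_left_module[OF M])
  show ?thesis using M.zero_closed by (auto simp: coboundaries_def)
qed

subsection \<open>Injective resolutions\<close>

lemma injective_resolutionD:
  assumes M: "left_module R M" and I: "injective_resolution R M I \<eta>"
  shows "is_complex R I" "injective_module R (obj I n)" "\<eta> 0 \<in> lin_hom R M (obj I 0)"
    "inj_on (\<eta> 0) (carrier M)" "\<eta> 0 ` carrier M = cocycles I 0"
    "n > 0 \<Longrightarrow> cocycles I n = coboundaries I n"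
proof -
  let ?S = "stalk_complex M"
  have q: "quasi_iso R ?S I \<eta>" and inj: "\<And>n. injective_module R (obj I n)"
    and neg: "\<And>n. n < 0 \<Longrightarrow> zero_module (obj I n)"
    using I by (simp_all add: injective_resolution_def)
  have c: "chain_map R ?S I \<eta>"
    and q1: "\<And>n x. \<lbrakk>x \<in> cocycles ?S n; \<eta> n x \<in> coboundaries I n\<rbrakk> \<Longrightarrow> x \<in> coboundaries ?S n"
    and q2: "\<And>n. \<forall>y\<in>cocycles I n. \<exists>x\<in>cocycles ?S n. y \<ominus>\<^bsub>obj I n\<^esub> \<eta> n x \<in> coboundaries I n"
    using q by (simp_all add: quasi_iso_iff)
  show I_cpx: "is_complex R I" by (rule chain_mapD(2)[OF c])
  note I_mod = is_complexD(1)[OF I_cpx]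
  show "injective_module R (obj I n)" by (rule inj)
  show \<eta>: "\<eta> 0 \<in> lin_hom R M (obj I 0)" using chain_mapD(3)[OF c, of 0] by simp
  interpret M: left_module R M by (rule M)
  interpret I0: left_module R "obj I 0" by (rule I_mod)
  have B0: "coboundaries I 0 = {\<zero>\<^bsub>obj I 0\<^esub>}"
  proof -
    have "carrier (obj I (- 1)) = {\<zero>\<^bsub>obj I (- 1)\<^esub>}" using neg[of "- 1"] by (simp add: zero_module_def)
    moreover have "diff I (0 - 1) \<zero>\<^bsub>obj I (0 - 1)\<^esub> = \<zero>\<^bsub>obj I 0\<^esub>"
      by (rule lin_hom_zero[OF I_mod I_mod is_complexD(3)[OF I_cpx]])
    ultimately show ?thesis by (simp add: coboundaries_def)
  qed
  show "inj_on (\<eta> 0) (carrier M)"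
  proof (rule inj_onI)
    fix x y assume xy: "x \<in> carrier M" "y \<in> carrier M" "\<eta> 0 x = \<eta> 0 y"
    then have "\<eta> 0 (x \<ominus>\<^bsub>M\<^esub> y) \<in> coboundaries I 0"
      using lin_hom_eq_iff_diff_kernel[OF M I_mod \<eta>] B0 by simp
    then have "x \<ominus>\<^bsub>M\<^esub> y \<in> {\<zero>\<^bsub>M\<^esub>}"
      using q1[of "x \<ominus>\<^bsub>M\<^esub> y" 0] xy stalk_coboundaries[OF M] by (simp add: stalk_cocycles)
    then show "x = y" using xy by simp
  qed
  show "\<eta> 0 ` carrier M = cocycles I 0"
  proof
    show "\<eta> 0 ` carrier M \<subseteq> cocycles I 0"
      using chain_map_cocycle[OF c, of _ 0] by (auto simp: stalk_cocycles)
    show "cocycles I 0 \<subseteq> \<eta> 0 ` carrier M"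
    proof
      fix y assume y: "y \<in> cocycles I 0"
      then obtain x where x: "x \<in> carrier M" "y \<ominus>\<^bsub>obj I 0\<^esub> \<eta> 0 x = \<zero>\<^bsub>obj I 0\<^esub>"
        using q2[of 0] by (auto simp: stalk_cocycles B0)
      moreover have "y \<in> carrier (obj I 0)" using y by (simp add: cocycles_iff)
      ultimately have "y = \<eta> 0 x" using lin_hom_closed[OF \<eta>] by simp
      then show "y \<in> \<eta> 0 ` carrier M" using x by blast
    qed
  qed
  show "cocycles I n = coboundaries I n" if n: "n > 0"
  proof
    show "coboundaries I n \<subseteq> cocycles I n" by (rule coboundaries_subset_cocycles[OF I_cpx])
    show "cocycles I n \<subseteq> coboundaries I n"
    proof
      fix y assume y: "y \<in> cocycles I n"
      interpret In: left_module R "obj I n" by (rule I_mod)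
      have "\<eta> n \<zero>\<^bsub>M\<^esub> = \<zero>\<^bsub>obj I n\<^esub>"
        using lin_hom_zero[OF stalk_obj_left_module[OF M] I_mod chain_mapD(3)[OF c], of n] by simp
      moreover have "y \<in> carrier (obj I n)" using y by (simp add: cocycles_iff)
      moreover have "\<exists>x\<in>{\<zero>\<^bsub>M\<^esub>}. y \<ominus>\<^bsub>obj I n\<^esub> \<eta> n x \<in> coboundaries I n"
        using bspec[OF q2[of n] y] n by (simp add: stalk_cocycles)
      ultimately show "y \<in> coboundaries I n" by simp
    qed
  qed
qed

text \<open>
  One step of an injective resolution: an embedding into an injective module together with its cokernel,
  which is the module to be embedded next.
\<close>

lemma coresolution_step:
  fixes M :: "('a, 'm) module"
  assumes U: "module_universe TYPE('a) TYPE('m)" and M: "left_module R M"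
  shows "\<exists>(E :: ('a, 'm) module) \<iota> (Q :: ('a, 'm) module) \<pi>. injective_module R E \<and> left_module R Q \<and>
    \<iota> \<in> lin_hom R M E \<and> inj_on \<iota> (carrier M) \<and> \<pi> \<in> lin_hom R E Q \<and> \<pi> ` carrier E = carrier Q \<and>
    (\<forall>x\<in>carrier E. \<pi> x = \<zero>\<^bsub>Q\<^esub> \<longleftrightarrow> x \<in> \<iota> ` carrier M)"
proof -
  obtain E :: "('a, 'm) module" and \<iota> where E: "injective_module R E" and \<iota>: "\<iota> \<in> lin_hom R M E"
    and inj: "inj_on \<iota> (carrier M)" by (rule enough_injectives[OF U M]) (rule that)
  note E' = injective_module_left_module[OF E]
  obtain Q :: "('a, 'm) module" and \<pi> where "left_module R Q" "\<pi> \<in> lin_hom R E Q" "\<pi> ` carrier E = carrier Q"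
    "\<forall>x\<in>carrier E. \<pi> x = \<zero>\<^bsub>Q\<^esub> \<longleftrightarrow> x \<in> \<iota> ` carrier M"
    by (rule quotient_exists[OF E' lin_hom_image_submodule[OF M E' \<iota> submodule_carrier[OF M]]]) (rule that)
  with E \<iota> inj show ?thesis by (intro exI conjI)
qed

lemma injective_resolution_exists:
  fixes M :: "('a, 'm) module"
  assumes U: "module_universe TYPE('a) TYPE('m)" and M: "left_module R M"
  shows "\<exists>I \<eta>. injective_resolution R M I \<eta>"
proof -
  define step where "step N t \<longleftrightarrow> (case t of (E :: ('a, 'm) module, \<iota>, Q :: ('a, 'm) module, \<pi>) \<Rightarrow>
    injective_module R E \<and> left_module R Q \<and>
    \<iota> \<in> lin_hom R N E \<and> inj_on \<iota> (carrier N) \<and> \<pi> \<in> lin_hom R E Q \<and> \<pi> ` carrier E = carrier Q \<and>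
    (\<forall>x\<in>carrier E. \<pi> x = \<zero>\<^bsub>Q\<^esub> \<longleftrightarrow> x \<in> \<iota> ` carrier N))" for N :: "('a, 'm) module" and t
  have "\<forall>N :: ('a, 'm) module. \<exists>t. left_module R N \<longrightarrow> step N t"
  proof
    fix N :: "('a, 'm) module"
    show "\<exists>t. left_module R N \<longrightarrow> step N t"
    proof (cases "left_module R N")
      case True
      from coresolution_step[OF U this] show ?thesis by (auto simp: step_def)
    qed simp
  qed
  from choice[OF this] obtain F where F: "\<forall>N. left_module R N \<longrightarrow> step N (F N)" ..
  define E where "E N = fst (F N)" for N
  define \<iota> where "\<iota> N = fst (snd (F N))" for N
  define Q where "Q N = fst (snd (snd (F N)))" for N
  define \<pi> where "\<pi> N = snd (snd (snd (F N)))" for N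
  have st: "injective_module R (E N)" "left_module R (Q N)" "\<iota> N \<in> lin_hom R N (E N)" "inj_on (\<iota> N) (carrier N)"
    "\<pi> N \<in> lin_hom R (E N) (Q N)" "\<pi> N ` carrier (E N) = carrier (Q N)"
    "\<forall>x\<in>carrier (E N). \<pi> N x = \<zero>\<^bsub>Q N\<^esub> \<longleftrightarrow> x \<in> \<iota> N ` carrier N" if "left_module R N" for N
    using F that by (simp_all add: step_def E_def \<iota>_def Q_def \<pi>_def case_prod_unfold)
  define N where "N k = (Q ^^ k) M" for k :: nat
  have N0: "N 0 = M" and NS: "N (Suc k) = Q (N k)" for k by (simp_all add: N_def)
  have N: "left_module R (N k)" for k by (induction k) (simp_all add: N0 NS M st(2))
  note st = st[OF N]
  have E: "left_module R (E (N k))" for k by (rule injective_module_left_module[OF st(1)])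
  define I where "I = \<lparr>obj = (\<lambda>n::int. if n < 0 then M\<lparr>carrier := {\<zero>\<^bsub>M\<^esub>}\<rparr> else E (N (nat n))),
    diff = (\<lambda>n x. if n < 0 then if n = - 1 then \<zero>\<^bsub>E M\<^esub> else \<zero>\<^bsub>M\<^esub>
      else \<iota> (N (Suc (nat n))) (\<pi> (N (nat n)) x))\<rparr>"
  define \<eta> where "\<eta> n = (if n = 0 then \<iota> M else (\<lambda>_. \<zero>\<^bsub>obj I n\<^esub>))" for n :: int
  have Ineg: "obj I n = M\<lparr>carrier := {\<zero>\<^bsub>M\<^esub>}\<rparr>" "diff I n = (\<lambda>x. \<zero>\<^bsub>obj I (n + 1)\<^esub>)" if "n < 0" for n
    using that by (auto simp: I_def N0)
  have Ipos: "obj I (int k) = E (N k)" "diff I (int k) = (\<lambda>x. \<iota> (N (Suc k)) (\<pi> (N k) x))" for k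
    by (simp_all add: I_def)
  have Imod: "left_module R (obj I n)" for n
    using submodule_left_module[OF M submodule_zero[OF M]] E by (cases "n < 0") (simp_all add: I_def)
  have d: "(\<lambda>x. \<iota> (N (Suc k)) (\<pi> (N k) x)) \<in> lin_hom R (E (N k)) (E (N (Suc k)))" for k
    using lin_hom_comp[OF st(5)[of k]] st(3)[of "Suc k"] by (simp add: NS)
  have \<pi>_closed: "\<pi> (N k) x \<in> carrier (N (Suc k))" if "x \<in> carrier (E (N k))" for x k
    using lin_hom_closed[OF st(5)[of k] that] by (simp add: NS)
  have \<iota>_zero: "\<iota> (N k) x = \<zero>\<^bsub>E (N k)\<^esub> \<longleftrightarrow> x = \<zero>\<^bsub>N k\<^esub>" if "x \<in> carrier (N k)" for k x
  proof -
    interpret left_module R "N k" by (rule N)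
    show ?thesis
      using inj_on_eq_iff[OF st(4)[of k] that M.zero_closed] lin_hom_zero[OF N E st(3)[of k]] by simp
  qed
  have ker: "\<iota> (N (Suc k)) (\<pi> (N k) x) = \<zero>\<^bsub>E (N (Suc k))\<^esub> \<longleftrightarrow> x \<in> \<iota> (N k) ` carrier (N k)"
    if "x \<in> carrier (E (N k))" for x k
    using \<iota>_zero[OF \<pi>_closed[OF that]] st(7)[of k] that by (simp add: NS)
  have I: "is_complex R I"
    unfolding is_complex_def
  proof (intro allI conjI Imod ballI)
    fix n :: int
    have "n < 0 \<or> (\<exists>k. n = int k)" by (metis nonneg_int_cases not_less)
    then consider "n < 0" | k where "n = int k" by blast
    note c = this
    show "diff I n \<in> lin_hom R (obj I n) (obj I (n + 1))"
    proof (cases rule: c)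
      case 1
      then show ?thesis using zero_lin_hom[OF Imod[of n] Imod[of "n + 1"]] by (simp only: Ineg(2))
    next
      case (2 k)
      have "n + 1 = int (Suc k)" using 2 by simp
      then show ?thesis using d[of k] by (simp only: 2 Ipos)
    qed
    fix x assume x: "x \<in> carrier (obj I n)"
    show "diff I (n + 1) (diff I n x) = \<zero>\<^bsub>obj I (n + 2)\<^esub>"
    proof (cases rule: c)
      case 1
      have e: "n + 1 + 1 = n + 2" by simp
      have "n + 1 < 0 \<or> n + 1 = 0" using 1 by linarith
      then have "n + 1 < 0 \<or> n + 1 = int 0" by simp
      then have dl: "diff I (n + 1) \<in> lin_hom R (obj I (n + 1)) (obj I (n + 2))"
      proof
        assume "n + 1 < 0"
        then show ?thesis
          using zero_lin_hom[OF Imod[of "n + 1"] Imod[of "n + 2"]] Ineg(2)[of "n + 1"] unfolding e by simp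
      next
        assume *: "n + 1 = int 0"
        moreover have "n + 2 = int (Suc 0)" using * by simp
        ultimately show ?thesis using d[of 0] by (simp only: Ipos)
      qed
      show ?thesis using lin_hom_zero[OF Imod Imod dl] Ineg(2)[OF 1] by simp
    next
      case (2 k)
      have e: "n + 1 = int (Suc k)" "n + 2 = int (Suc (Suc k))" using 2 by simp_all
      have x: "x \<in> carrier (E (N k))" using x by (simp add: 2 Ipos)
      have "\<iota> (N (Suc k)) (\<pi> (N k) x) \<in> carrier (E (N (Suc k)))" by (rule lin_hom_closed[OF d x])
      from ker[OF this] have "\<iota> (N (Suc (Suc k))) (\<pi> (N (Suc k)) (\<iota> (N (Suc k)) (\<pi> (N k) x))) = \<zero>\<^bsub>E (N (Suc (Suc k)))\<^esub>"
        using \<pi>_closed[OF x] by blast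
      then show ?thesis unfolding e unfolding 2 Ipos .
    qed
  qed
  have Z: "cocycles I (int k) = \<iota> (N k) ` carrier (N k)" for k
  proof -
    have e: "int k + 1 = int (Suc k)" by simp
    have "\<iota> (N k) ` carrier (N k) \<subseteq> carrier (E (N k))" using lin_hom_closed[OF st(3)] by blast
    then show ?thesis unfolding cocycles_def lin_kernel_def e Ipos using ker by blast
  qed
  have B: "coboundaries I (int (Suc k)) = \<iota> (N (Suc k)) ` carrier (N (Suc k))" for k
  proof -
    have e: "int (Suc k) - 1 = int k" by simp
    have "(\<lambda>x. \<iota> (N (Suc k)) (\<pi> (N k) x)) ` carrier (E (N k)) = \<iota> (N (Suc k)) ` (\<pi> (N k) ` carrier (E (N k)))"
      by (simp add: image_image)
    then show ?thesis unfolding coboundaries_def e Ipos st(6) by (simp add: NS)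
  qed
  let ?S = "stalk_complex M"
  have ch: "chain_map R ?S I \<eta>"
    unfolding chain_map_def
  proof (intro conjI stalk_is_complex[OF M] I allI ballI)
    fix n :: int
    show "\<eta> n \<in> lin_hom R (obj ?S n) (obj I n)"
    proof (cases "n = 0")
      case True
      then show ?thesis using st(3)[of 0] Ipos(1)[of 0] by (simp add: \<eta>_def N0)
    next
      case False
      then show ?thesis using zero_lin_hom[OF stalk_obj_left_module[OF M, of n] Imod[of n]] by (simp add: \<eta>_def)
    qed
    note \<eta>n = this
    fix x assume x: "x \<in> carrier (obj ?S n)"
    have "\<eta> (n + 1) \<zero>\<^bsub>M\<^esub> = \<zero>\<^bsub>obj I (n + 1)\<^esub>"
    proof (cases "n + 1 = 0")
      case True
      then show ?thesis using lin_hom_zero[OF N E st(3)[of 0]] Ipos(1)[of 0] by (simp add: \<eta>_def N0)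
    qed (simp add: \<eta>_def)
    moreover have "diff I n (\<eta> n x) = \<zero>\<^bsub>obj I (n + 1)\<^esub>"
    proof (cases "n = 0")
      case True
      have "x \<in> carrier (N 0)" using x True by (simp add: N0)
      then have "\<eta> n x \<in> cocycles I (int 0)" unfolding Z using True by (simp add: \<eta>_def N0)
      then show ?thesis using True by (simp add: cocycles_iff)
    next
      case False
      then show ?thesis using lin_hom_zero[OF Imod Imod is_complexD(2)[OF I, of n]] by (simp add: \<eta>_def)
    qed
    ultimately show "\<eta> (n + 1) (diff ?S n x) = diff I n (\<eta> n x)" by simp
  qed
  have "quasi_iso R ?S I \<eta>"
    unfolding quasi_iso_iff
  proof (intro conjI ch allI ballI impI)
    fix n x assume x: "x \<in> cocycles ?S n" "\<eta> n x \<in> coboundaries I n"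
    show "x \<in> coboundaries ?S n"
    proof (cases "n = 0")
      case True
      have "obj I (n - 1) = M\<lparr>carrier := {\<zero>\<^bsub>M\<^esub>}\<rparr>" "diff I (n - 1) = (\<lambda>x. \<zero>\<^bsub>obj I n\<^esub>)"
        using Ineg[of "n - 1"] True by simp_all
      then have "\<iota> (N 0) x = \<zero>\<^bsub>E (N 0)\<^esub>" using x(2) True Ipos(1)[of 0] by (simp add: coboundaries_def \<eta>_def N0)
      moreover have "x \<in> carrier (N 0)" using x(1) True by (simp add: stalk_cocycles N0)
      ultimately have "x = \<zero>\<^bsub>M\<^esub>" using \<iota>_zero[of x 0] by (simp add: N0)
      then show ?thesis by (simp add: stalk_coboundaries[OF M])
    next
      case False
      then show ?thesis using x(1) by (simp add: stalk_cocycles stalk_coboundaries[OF M])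
    qed
  next
    fix n y assume y: "y \<in> cocycles I n"
    interpret In: left_module R "obj I n" by (rule Imod)
    note zM = submodule_zero_closed[OF submodule_carrier[OF stalk_obj_left_module[OF M, of n]]]
    have yc: "y \<in> carrier (obj I n)" using y by (simp add: cocycles_iff)
    note zB = submodule_zero_closed[OF coboundaries_submodule[OF I, of n]]
    consider "n < 0" | "n = int 0" | k where "n = int (Suc k)"
      by (metis nonneg_int_cases not_less not0_implies_Suc)
    then show "\<exists>x\<in>cocycles ?S n. y \<ominus>\<^bsub>obj I n\<^esub> \<eta> n x \<in> coboundaries I n"
    proof cases
      case 1
      then have "y = \<zero>\<^bsub>obj I n\<^esub>" using yc by (simp add: Ineg)
      then show ?thesis using 1 zM zB by (intro bexI[of _ "\<zero>\<^bsub>M\<^esub>"]) (simp_all add: \<eta>_def stalk_cocycles)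
    next
      case 2
      then obtain x where x: "x \<in> carrier M" "y = \<eta> n x" using y unfolding 2 Z by (auto simp: N0 \<eta>_def)
      have "y \<ominus>\<^bsub>obj I n\<^esub> \<eta> n x \<in> coboundaries I n"
        unfolding x(2)[symmetric] using In.M.diff_self[OF yc] zB by simp
      then show ?thesis using 2 x(1) by (intro bexI[of _ x]) (simp_all add: stalk_cocycles)
    next
      case (3 k)
      have "y \<in> coboundaries I n" using y unfolding 3 Z B .
      moreover have "\<eta> n \<zero>\<^bsub>M\<^esub> = \<zero>\<^bsub>obj I n\<^esub>" using 3 by (simp add: \<eta>_def)
      ultimately have "y \<ominus>\<^bsub>obj I n\<^esub> \<eta> n \<zero>\<^bsub>M\<^esub> \<in> coboundaries I n"
        using In.M.diff_zero[OF yc] by simp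
      then show ?thesis by (rule bexI) (use zM in \<open>simp add: stalk_cocycles\<close>)
    qed
  qed
  moreover have "injective_module R (obj I n)" for n
  proof (cases "n < 0")
    case True
    then show ?thesis using Imod[of n] by (intro zero_module_injective) (simp_all add: Ineg zero_module_def)
  next
    case False
    then show ?thesis using st(1) by (simp add: I_def)
  qed
  moreover have "zero_module (obj I n)" if "n < 0" for n using that by (simp add: Ineg zero_module_def)
  ultimately show ?thesis unfolding injective_resolution_def by blast
qed

subsection \<open>Projective resolutions\<close>

lemma projective_resolutionD:
  assumes M: "left_module R M" and P: "projective_resolution R M P \<epsilon>"
  shows "is_complex R P" "projective_module R (obj P n)" "n > 0 \<Longrightarrow> zero_module (obj P n)"
    "\<epsilon> n \<in> lin_hom R (obj P n) (obj (stalk_complex M) n)"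
    "\<epsilon> 0 \<in> lin_hom R (obj P 0) M" "\<epsilon> 0 ` carrier (obj P 0) = carrier M"
    "lin_kernel (obj P 0) M (\<epsilon> 0) = coboundaries P 0"
    "n < 0 \<Longrightarrow> cocycles P n = coboundaries P n"
proof -
  let ?S = "stalk_complex M"
  have q: "quasi_iso R P ?S \<epsilon>" and proj: "\<And>n. projective_module R (obj P n)"
    and pos: "\<And>n. n > 0 \<Longrightarrow> zero_module (obj P n)"
    using P by (simp_all add: projective_resolution_def)
  have c: "chain_map R P ?S \<epsilon>"
    and q1: "\<And>n x. \<lbrakk>x \<in> cocycles P n; \<epsilon> n x \<in> coboundaries ?S n\<rbrakk> \<Longrightarrow> x \<in> coboundaries P n"
    and q2: "\<And>n. \<forall>y\<in>cocycles ?S n. \<exists>x\<in>cocycles P n. y \<ominus>\<^bsub>obj ?S n\<^esub> \<epsilon> n x \<in> coboundaries ?S n"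
    using q by (simp_all add: quasi_iso_iff)
  show P_cpx: "is_complex R P" by (rule chain_mapD(1)[OF c])
  note P_mod = is_complexD(1)[OF P_cpx]
  show "projective_module R (obj P n)" "n > 0 \<Longrightarrow> zero_module (obj P n)" by (fact proj pos)+
  show "\<epsilon> n \<in> lin_hom R (obj P n) (obj ?S n)" by (rule chain_mapD(3)[OF c])
  show \<epsilon>: "\<epsilon> 0 \<in> lin_hom R (obj P 0) M" using chain_mapD(3)[OF c, of 0] by simp
  interpret M: left_module R M by (rule M)
  note B = stalk_coboundaries[OF M]
  have Z0: "cocycles P 0 = carrier (obj P 0)"
  proof -
    have "carrier (obj P 1) = {\<zero>\<^bsub>obj P 1\<^esub>}" using pos[of 1] by (simp add: zero_module_def)
    then show ?thesis using lin_hom_closed[OF is_complexD(2)[OF P_cpx, of 0]] by (auto simp: cocycles_iff)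
  qed
  show "\<epsilon> 0 ` carrier (obj P 0) = carrier M"
  proof
    show "\<epsilon> 0 ` carrier (obj P 0) \<subseteq> carrier M" using lin_hom_closed[OF \<epsilon>] by blast
    show "carrier M \<subseteq> \<epsilon> 0 ` carrier (obj P 0)"
    proof
      fix y assume y: "y \<in> carrier M"
      then obtain x where x: "x \<in> carrier (obj P 0)" "y \<ominus>\<^bsub>M\<^esub> \<epsilon> 0 x = \<zero>\<^bsub>M\<^esub>"
        using q2[of 0] by (auto simp: stalk_cocycles B Z0)
      then have "y = \<epsilon> 0 x" using y lin_hom_closed[OF \<epsilon>] by simp
      then show "y \<in> \<epsilon> 0 ` carrier (obj P 0)" using x by blast
    qed
  qed
  show "lin_kernel (obj P 0) M (\<epsilon> 0) = coboundaries P 0"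
  proof
    show "lin_kernel (obj P 0) M (\<epsilon> 0) \<subseteq> coboundaries P 0"
      using q1[of _ 0] by (auto simp: lin_kernel_def Z0 B)
    show "coboundaries P 0 \<subseteq> lin_kernel (obj P 0) M (\<epsilon> 0)"
      using chain_map_coboundary[OF c, of _ 0] coboundaries_subset_cocycles[OF P_cpx, of 0]
      by (auto simp: lin_kernel_def Z0 B)
  qed
  show "cocycles P n = coboundaries P n" if n: "n < 0"
  proof
    show "coboundaries P n \<subseteq> cocycles P n" by (rule coboundaries_subset_cocycles[OF P_cpx])
    show "cocycles P n \<subseteq> coboundaries P n"
    proof
      fix x assume x: "x \<in> cocycles P n"
      then have "\<epsilon> n x \<in> carrier (obj ?S n)"
        using lin_hom_closed[OF chain_mapD(3)[OF c]] by (simp add: cocycles_iff)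
      then show "x \<in> coboundaries P n" using n by (intro q1[OF x]) (simp add: B)
    qed
  qed
qed

lemma resolution_step:
  fixes M :: "('a, 'm) module"
  assumes U: "module_universe TYPE('a) TYPE('m)" and M: "left_module R M"
  shows "\<exists>(P :: ('a, 'm) module) p. projective_module R P \<and> p \<in> lin_hom R P M \<and> p ` carrier P = carrier M"
proof -
  obtain P :: "('a, 'm) module" and p where "projective_module R P" "p \<in> lin_hom R P M" "p ` carrier P = carrier M"
    by (rule enough_projectives[OF U M]) (rule that)
  then show ?thesis by (intro exI conjI)
qed

text \<open>
  The module to be resolved may live on another type, as the quotient ring does; it only has to be small
  enough to be transported into the universe.
\<close>

lemma projective_resolution_exists:
  fixes M :: "('a, 'n) module"
  assumes U: "module_universe TYPE('a) TYPE('m)" and M: "left_module R M"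
    and emb: "inj_on (i :: 'n \<Rightarrow> 'm) (carrier M)"
  shows "\<exists>(P :: ('a, 'm) cochain) \<epsilon>. projective_resolution R M P \<epsilon>"
proof -
  obtain M' :: "('a, 'm) module" where M': "left_module R M'" and i: "i \<in> lin_hom R M M'"
    and i_surj: "i ` carrier M = carrier M'" by (rule transport_module[OF M emb])
  obtain j where j: "j \<in> lin_hom R M' M" "\<forall>x\<in>carrier M. j (i x) = x" "\<forall>y\<in>carrier M'. i (j y) = y"
    by (rule lin_hom_inverse[OF M M' i emb i_surj]) (rule that)
  define step where "step N t \<longleftrightarrow> projective_module R (fst t) \<and> snd t \<in> lin_hom R (fst t) N \<and>
    snd t ` carrier (fst t) = carrier N"
    for N :: "('a, 'm) module" and t :: "('a, 'm) module \<times> ('m \<Rightarrow> 'm)"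
  have "\<forall>N :: ('a, 'm) module. \<exists>t. left_module R N \<longrightarrow> step N t"
  proof
    fix N :: "('a, 'm) module"
    show "\<exists>t. left_module R N \<longrightarrow> step N t"
    proof (cases "left_module R N")
      case True
      from resolution_step[OF U this] show ?thesis by (auto simp: step_def)
    qed simp
  qed
  from choice[OF this] obtain F where F: "\<forall>N. left_module R N \<longrightarrow> step N (F N)" ..
  define P where "P N = fst (F N)" for N
  define p where "p N = snd (F N)" for N
  have st: "projective_module R (P N)" "p N \<in> lin_hom R (P N) N" "p N ` carrier (P N) = carrier N"
    if "left_module R N" for N
    using F that by (simp_all add: step_def P_def p_def)
  define S where "S N = (P N)\<lparr>carrier := lin_kernel (P N) N (p N)\<rparr>" for N
  define N where "N k = (S ^^ k) M'" for k :: nat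
  have N0: "N 0 = M'" and NS: "N (Suc k) = S (N k)" for k by (simp_all add: N_def)
  have ker: "submodule (lin_kernel (P N) N (p N)) R (P N)" if "left_module R N" for N
    by (rule lin_kernel_submodule[OF projective_module_left_module[OF st(1)[OF that]] that st(2)[OF that]])
  have N: "left_module R (N k)" for k
  proof (induction k)
    case (Suc k)
    show ?case unfolding NS S_def
      by (rule submodule_left_module[OF projective_module_left_module[OF st(1)[OF Suc]] ker[OF Suc]])
  qed (simp add: N0 M')
  note st = st[OF N] and ker = ker[OF N]
  have Pm: "left_module R (P (N k))" for k by (rule projective_module_left_module[OF st(1)])
  have N_carrier: "carrier (N (Suc k)) = lin_kernel (P (N k)) (N k) (p (N k))"
    and N_zero: "\<zero>\<^bsub>N (Suc k)\<^esub> = \<zero>\<^bsub>P (N k)\<^esub>" for k by (simp_all add: NS S_def)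
  have d: "p (N (Suc k)) \<in> lin_hom R (P (N (Suc k))) (P (N k))" for k
    using lin_hom_extend_cod[OF _ submodule_subset[OF ker[of k]]] st(2)[of "Suc k"] by (simp add: NS S_def)
  define C where "C = \<lparr>obj = (\<lambda>n::int. if n > 0 then M'\<lparr>carrier := {\<zero>\<^bsub>M'\<^esub>}\<rparr> else P (N (nat (- n)))),
    diff = (\<lambda>n x. if n \<ge> 0 then \<zero>\<^bsub>M'\<^esub> else p (N (nat (- n))) x)\<rparr>"
  define \<epsilon> where "\<epsilon> n x = (if n = 0 then j (p M' x) else \<zero>\<^bsub>M\<^esub>)" for n :: int and x
  have Cpos: "obj C n = M'\<lparr>carrier := {\<zero>\<^bsub>M'\<^esub>}\<rparr>" if "n > 0" for n using that by (simp add: C_def)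
  have dpos: "diff C n = (\<lambda>x. \<zero>\<^bsub>obj C (n + 1)\<^esub>)" if "n \<ge> 0" for n using that by (simp add: C_def fun_eq_iff)
  have Cneg: "obj C (- int k) = P (N k)" for k by (simp add: C_def)
  have dneg: "diff C (- int (Suc k)) = p (N (Suc k))" for k
    by (simp add: C_def fun_eq_iff nat_add_distrib)
  have Cmod: "left_module R (obj C n)" for n
    using submodule_left_module[OF M' submodule_zero[OF M']] Pm by (cases "n > 0") (simp_all add: C_def)
  have cases: "n \<ge> 0 \<or> (\<exists>k. n = - int (Suc k))" for n :: int
    using int_cases[of n] by (metis of_nat_0_le_iff)
  have C: "is_complex R C"
    unfolding is_complex_def
  proof (intro allI conjI Cmod ballI)
    fix n :: int
    consider "n \<ge> 0" | k where "n = - int (Suc k)" using cases[of n] by blast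
    note c = this
    show dn: "diff C n \<in> lin_hom R (obj C n) (obj C (n + 1))"
    proof (cases rule: c)
      case 1
      then show ?thesis using zero_lin_hom[OF Cmod[of n] Cmod[of "n + 1"]] by (simp only: dpos)
    next
      case (2 k)
      have "n + 1 = - int k" using 2 by simp
      then show ?thesis using d[of k] by (simp only: 2 Cneg dneg)
    qed
    fix x assume x: "x \<in> carrier (obj C n)"
    have dx: "diff C n x \<in> carrier (obj C (n + 1))" by (rule lin_hom_closed[OF dn x])
    have e2: "n + 1 + 1 = n + 2" by simp
    show "diff C (n + 1) (diff C n x) = \<zero>\<^bsub>obj C (n + 2)\<^esub>"
    proof (cases "n + 1 \<ge> 0")
      case True
      from dpos[OF this] show ?thesis unfolding e2 by simp
    next
      case False
      then obtain k where k: "n + 1 = - int (Suc k)" using cases[of "n + 1"] by blast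
      have n: "n = - int (Suc (Suc k))" and n2: "n + 2 = - int k" using k by simp_all
      have "x \<in> carrier (P (N (Suc (Suc k))))" using x unfolding n Cneg .
      from lin_hom_closed[OF st(2) this] have "p (N (Suc (Suc k))) x \<in> lin_kernel (P (N (Suc k))) (N (Suc k)) (p (N (Suc k)))"
        by (simp only: N_carrier)
      then show ?thesis unfolding k n2 unfolding n Cneg dneg by (simp add: lin_kernel_def N_zero)
    qed
  qed
  have Bneg: "coboundaries C (- int k) = carrier (N (Suc k))" for k
  proof -
    have e: "- int k - 1 = - int (Suc k)" by simp
    show ?thesis unfolding coboundaries_def e dneg Cneg by (rule st(3))
  qed
  have Zneg: "cocycles C (- int (Suc k)) = carrier (N (Suc (Suc k)))" for k
  proof -
    have e: "- int (Suc k) + 1 = - int k" by simp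
    show ?thesis unfolding cocycles_def e dneg Cneg N_carrier by (simp add: lin_kernel_def N_zero)
  qed
  let ?S = "stalk_complex M"
  have \<epsilon>0: "\<epsilon> 0 \<in> lin_hom R (P (N 0)) M"
  proof -
    have "\<epsilon> 0 = (\<lambda>x. j (p M' x))" by (simp add: \<epsilon>_def fun_eq_iff)
    then show ?thesis using lin_hom_comp[OF st(2)[of 0], of j M] j(1) by (simp add: N0)
  qed
  have \<epsilon>0_ker: "\<epsilon> 0 x = \<zero>\<^bsub>M\<^esub> \<longleftrightarrow> x \<in> carrier (N 1)" if "x \<in> carrier (P (N 0))" for x
  proof -
    have y: "p (N 0) x \<in> carrier M'" using lin_hom_closed[OF st(2) that] by (simp add: N0)
    have "j y = \<zero>\<^bsub>M\<^esub> \<longleftrightarrow> y = \<zero>\<^bsub>M'\<^esub>" if "y \<in> carrier M'" for y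
      using j(3) that lin_hom_zero[OF M M' i] lin_hom_zero[OF M' M j(1)] by metis
    from this[OF y] show ?thesis using N_carrier[of 0] that by (simp add: lin_kernel_def \<epsilon>_def N0)
  qed
  have ch: "chain_map R C ?S \<epsilon>"
    unfolding chain_map_def
  proof (intro conjI stalk_is_complex[OF M] C allI ballI)
    fix n :: int
    show \<epsilon>n: "\<epsilon> n \<in> lin_hom R (obj C n) (obj ?S n)"
    proof (cases "n = 0")
      case True
      then show ?thesis using \<epsilon>0 Cneg[of 0] by simp
    next
      case False
      then have "\<epsilon> n = (\<lambda>_. \<zero>\<^bsub>obj ?S n\<^esub>)" by (simp add: \<epsilon>_def fun_eq_iff)
      then show ?thesis using zero_lin_hom[OF Cmod[of n] stalk_obj_left_module[OF M, of n]] by simp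
    qed
    fix x assume x: "x \<in> carrier (obj C n)"
    show "\<epsilon> (n + 1) (diff C n x) = diff ?S n (\<epsilon> n x)"
    proof (cases "n + 1 = 0")
      case True
      then have n: "n = - int (Suc 0)" by simp
      have "x \<in> carrier (P (N (Suc 0)))" using x unfolding n Cneg .
      then have "p (N (Suc 0)) x \<in> carrier (N (Suc 0))" by (rule lin_hom_closed[OF st(2)])
      moreover from this have "p (N (Suc 0)) x \<in> carrier (P (N 0))" using N_carrier[of 0] by (simp add: lin_kernel_def)
      ultimately have "\<epsilon> 0 (p (N (Suc 0)) x) = \<zero>\<^bsub>M\<^esub>" using \<epsilon>0_ker by simp
      then show ?thesis unfolding True unfolding n dneg by simp
    qed (simp add: \<epsilon>_def)
  qed
  have surj0: "\<exists>x\<in>carrier (P (N 0)). y = \<epsilon> 0 x" if y: "y \<in> carrier M" for y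
  proof -
    have "i y \<in> p (N 0) ` carrier (P (N 0))" using st(3)[of 0] lin_hom_closed[OF i y] by (simp add: N0)
    then obtain x where "x \<in> carrier (P (N 0))" "i y = p M' x" by (auto simp: N0)
    then show ?thesis using j(2) y by (intro bexI[of _ x]) (simp_all add: \<epsilon>_def flip: \<open>i y = p M' x\<close>)
  qed
  have Z0: "cocycles C 0 = carrier (P (N 0))"
    using Cneg[of 0] dpos[of 0] by (auto simp: cocycles_iff)
  have "quasi_iso R C ?S \<epsilon>"
    unfolding quasi_iso_iff
  proof (intro conjI ch allI ballI impI)
    fix n x assume x: "x \<in> cocycles C n" "\<epsilon> n x \<in> coboundaries ?S n"
    have xc: "x \<in> carrier (obj C n)" using x(1) by (simp add: cocycles_iff)
    consider "n > 0" | "n = - int 0" | k where "n = - int (Suc k)" using cases[of n] by fastforce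
    then show "x \<in> coboundaries C n"
    proof cases
      case 1
      then have "x = \<zero>\<^bsub>obj C n\<^esub>" using xc by (simp add: Cpos)
      then show ?thesis using submodule_zero_closed[OF coboundaries_submodule[OF C]] by simp
    next
      case 2
      have "x \<in> carrier (P (N 0))" using xc unfolding 2 Cneg .
      moreover have "\<epsilon> 0 x = \<zero>\<^bsub>M\<^esub>" using x(2) 2 by (simp add: stalk_coboundaries[OF M])
      ultimately have "x \<in> carrier (N (Suc 0))" using \<epsilon>0_ker by simp
      then show ?thesis unfolding 2 Bneg .
    next
      case (3 k)
      show ?thesis using x(1) unfolding 3 Zneg Bneg .
    qed
  next
    fix n y assume y: "y \<in> cocycles ?S n"
    interpret Sn: left_module R "obj ?S n" by (rule stalk_obj_left_module[OF M])
    show "\<exists>x\<in>cocycles C n. y \<ominus>\<^bsub>obj ?S n\<^esub> \<epsilon> n x \<in> coboundaries ?S n"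
    proof (cases "n = 0")
      case True
      have yM: "y \<in> carrier M" using y True by (simp add: stalk_cocycles)
      from surj0[OF this] obtain x where x: "x \<in> carrier (P (N 0))" "y = \<epsilon> 0 x" by blast
      then show ?thesis using True Z0 yM Sn.M.diff_self[of y] stalk_coboundaries[OF M]
        by (intro bexI[of _ x]) simp_all
    next
      case False
      then have y0: "y = \<zero>\<^bsub>obj ?S n\<^esub>" using y by (simp add: stalk_cocycles)
      have "y \<ominus>\<^bsub>obj ?S n\<^esub> \<epsilon> n \<zero>\<^bsub>obj C n\<^esub> = \<zero>\<^bsub>M\<^esub>"
        using Sn.M.diff_self[OF Sn.M.zero_closed] False y0 by (simp add: \<epsilon>_def)
      then show ?thesis using submodule_zero_closed[OF cocycles_submodule[OF C]] stalk_coboundaries[OF M]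
        by (intro bexI[of _ "\<zero>\<^bsub>obj C n\<^esub>"]) simp_all
    qed
  qed
  moreover have "projective_module R (obj C n)" for n
  proof (cases "n > 0")
    case True
    then show ?thesis using Cmod[of n] by (intro zero_module_projective) (simp_all add: Cpos zero_module_def)
  next
    case False
    then show ?thesis using st(1) by (simp add: C_def)
  qed
  moreover have "zero_module (obj C n)" if "n > 0" for n using that by (simp add: Cpos zero_module_def)
  ultimately show ?thesis unfolding projective_resolution_def by blast
qed

section \<open>Tensor products\<close>

locale tensor_pair = P: left_module R P + B: abelian_group B
  for R :: "('a, 'r) ring_scheme" (structure) and B :: "('a, 'b) bimodule" and P :: "('a, 'm) module" +
  assumes rsmult_closed: "\<lbrakk>x \<in> carrier B; a \<in> carrier R\<rbrakk> \<Longrightarrow> rsmult B x a \<in> carrier B"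
begin

abbreviation "F \<equiv> free_Abelian_group (carrier B \<times> carrier P)"
abbreviation "N \<equiv> generate F (tensor_relations R B P)"
abbreviation "T \<equiv> tensor_group R B P"
abbreviation "pure \<equiv> pure_tensor R B P"

lemma T_eq: "T = F Mod N"
  by (simp add: tensor_group_def Let_def)

lemma pure_eq: "pure x p = N #>\<^bsub>F\<^esub> frag_of (x, p)"
  by (simp add: pure_tensor_def Let_def)

lemma F_comm_group: "comm_group F"
  by (rule abelian_free_Abelian_group)

lemma F_diff: "\<lbrakk>c \<in> carrier F; d \<in> carrier F\<rbrakk> \<Longrightarrow> c - d \<in> carrier F"
  using keys_diff[of c d] by (auto simp: carrier_free_Abelian_group_iff)

lemma F_add: "\<lbrakk>c \<in> carrier F; d \<in> carrier F\<rbrakk> \<Longrightarrow> c + d \<in> carrier F"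
  using keys_add[of c d] by (auto simp: carrier_free_Abelian_group_iff)

lemma relations_carrier: "tensor_relations R B P \<subseteq> carrier F"
proof
  fix c assume "c \<in> tensor_relations R B P"
  then consider (l) x y p where "c = frag_of (x \<oplus>\<^bsub>B\<^esub> y, p) - frag_of (x, p) - frag_of (y, p)"
      "x \<in> carrier B" "y \<in> carrier B" "p \<in> carrier P"
    | (r) x p q where "c = frag_of (x, p \<oplus>\<^bsub>P\<^esub> q) - frag_of (x, p) - frag_of (x, q)"
      "x \<in> carrier B" "p \<in> carrier P" "q \<in> carrier P"
    | (b) x a p where "c = frag_of (rsmult B x a, p) - frag_of (x, a \<odot>\<^bsub>P\<^esub> p)"
      "x \<in> carrier B" "a \<in> carrier R" "p \<in> carrier P"
    unfolding tensor_relations_def by blast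
  then show "c \<in> carrier F"
  proof cases
    case l
    then show ?thesis unfolding l(1) by (intro F_diff) (simp_all del: carrier_free_Abelian_group_iff)
  next
    case r
    then show ?thesis unfolding r(1) by (intro F_diff) (simp_all del: carrier_free_Abelian_group_iff)
  next
    case b
    then show ?thesis unfolding b(1)
      by (intro F_diff) (simp_all del: carrier_free_Abelian_group_iff add: rsmult_closed)
  qed
qed

lemma N_subgroup: "subgroup N F"
  by (rule group.generate_is_subgroup[OF _ relations_carrier]) simp

lemma T_comm_group: "comm_group T"
  unfolding T_eq by (rule comm_group.abelian_FactGroup[OF F_comm_group N_subgroup])

lemma coset_hom: "(\<lambda>c. N #>\<^bsub>F\<^esub> c) \<in> hom F T"
  unfolding T_eq by (rule normal.r_coset_hom_Mod) (rule comm_group.subgroup_imp_normal[OF F_comm_group N_subgroup])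

lemma coset_eqI:
  assumes "c \<in> carrier F" "d \<in> carrier F" "c - d \<in> N"
  shows "N #>\<^bsub>F\<^esub> c = N #>\<^bsub>F\<^esub> d"
proof -
  have "c \<in> N #>\<^bsub>F\<^esub> d" using assms(3) by (auto simp: r_coset_def intro!: bexI[of _ "c - d"])
  then show ?thesis
    using group.repr_independence[OF _ _ assms(2) N_subgroup, of c] by simp
qed

lemma coset_add: "\<lbrakk>c \<in> carrier F; d \<in> carrier F\<rbrakk> \<Longrightarrow> N #>\<^bsub>F\<^esub> (c + d) = (N #>\<^bsub>F\<^esub> c) \<otimes>\<^bsub>T\<^esub> (N #>\<^bsub>F\<^esub> d)"
  using hom_mult[OF coset_hom, of c d] by (simp del: carrier_free_Abelian_group_iff)

lemma coset_closed: "c \<in> carrier F \<Longrightarrow> N #>\<^bsub>F\<^esub> c \<in> carrier T"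
  using hom_in_carrier[OF coset_hom] .

lemma coset_surj: "Z \<in> carrier T \<Longrightarrow> \<exists>c\<in>carrier F. Z = N #>\<^bsub>F\<^esub> c"
  unfolding T_eq FactGroup_def RCOSETS_def by auto

lemma pure_closed: "\<lbrakk>x \<in> carrier B; p \<in> carrier P\<rbrakk> \<Longrightarrow> pure x p \<in> carrier T"
  unfolding pure_eq by (rule coset_closed) simp

lemma pure_add_left:
  assumes "x \<in> carrier B" "y \<in> carrier B" "p \<in> carrier P"
  shows "pure (x \<oplus>\<^bsub>B\<^esub> y) p = pure x p \<otimes>\<^bsub>T\<^esub> pure y p"
proof -
  have c: "frag_of (x, p) \<in> carrier F" "frag_of (y, p) \<in> carrier F" "frag_of (x \<oplus>\<^bsub>B\<^esub> y, p) \<in> carrier F"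
    using assms by (simp_all del: carrier_free_Abelian_group_iff)
  have "frag_of (x \<oplus>\<^bsub>B\<^esub> y, p) - frag_of (x, p) - frag_of (y, p) \<in> N"
    by (rule generate.incl) (use assms in \<open>auto simp: tensor_relations_def\<close>)
  then have "frag_of (x \<oplus>\<^bsub>B\<^esub> y, p) - (frag_of (x, p) + frag_of (y, p)) \<in> N" by (simp add: algebra_simps)
  from coset_eqI[OF c(3) F_add[OF c(1,2)] this] show ?thesis
    unfolding pure_eq by (simp only: coset_add[OF c(1,2)])
qed

lemma pure_add_right:
  assumes "x \<in> carrier B" "p \<in> carrier P" "q \<in> carrier P"
  shows "pure x (p \<oplus>\<^bsub>P\<^esub> q) = pure x p \<otimes>\<^bsub>T\<^esub> pure x q"
proof -
  have c: "frag_of (x, p) \<in> carrier F" "frag_of (x, q) \<in> carrier F" "frag_of (x, p \<oplus>\<^bsub>P\<^esub> q) \<in> carrier F"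
    using assms by (simp_all del: carrier_free_Abelian_group_iff)
  have "frag_of (x, p \<oplus>\<^bsub>P\<^esub> q) - frag_of (x, p) - frag_of (x, q) \<in> N"
    by (rule generate.incl) (use assms in \<open>auto simp: tensor_relations_def\<close>)
  then have "frag_of (x, p \<oplus>\<^bsub>P\<^esub> q) - (frag_of (x, p) + frag_of (x, q)) \<in> N" by (simp add: algebra_simps)
  from coset_eqI[OF c(3) F_add[OF c(1,2)] this] show ?thesis
    unfolding pure_eq by (simp only: coset_add[OF c(1,2)])
qed

lemma pure_balanced:
  assumes "x \<in> carrier B" "a \<in> carrier R" "p \<in> carrier P"
  shows "pure (rsmult B x a) p = pure x (a \<odot>\<^bsub>P\<^esub> p)"
proof -
  have c: "frag_of (rsmult B x a, p) \<in> carrier F" "frag_of (x, a \<odot>\<^bsub>P\<^esub> p) \<in> carrier F"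
    using assms rsmult_closed by (simp_all del: carrier_free_Abelian_group_iff)
  have "frag_of (rsmult B x a, p) - frag_of (x, a \<odot>\<^bsub>P\<^esub> p) \<in> N"
    by (rule generate.incl) (use assms in \<open>auto simp: tensor_relations_def\<close>)
  from coset_eqI[OF c this] show ?thesis unfolding pure_eq .
qed

text \<open>
  Pure tensors generate. Closure under division serves as the induction step, because it covers sums and
  inverses at once.
\<close>

lemma tensor_group_induct [consumes 1, case_names one div pure]:
  assumes Z: "Z \<in> carrier T" and one: "Q \<one>\<^bsub>T\<^esub>"
    and div: "\<And>Y Z. \<lbrakk>Y \<in> carrier T; Z \<in> carrier T; Q Y; Q Z\<rbrakk> \<Longrightarrow> Q (Y \<otimes>\<^bsub>T\<^esub> inv\<^bsub>T\<^esub> Z)"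
    and pure: "\<And>x p. \<lbrakk>x \<in> carrier B; p \<in> carrier P\<rbrakk> \<Longrightarrow> Q (pure x p)"
  shows "Q Z"
proof -
  interpret T: comm_group T by (rule T_comm_group)
  interpret q: group_hom F T "\<lambda>c. N #>\<^bsub>F\<^esub> c"
    by (simp add: group_hom_def group_hom_axioms_def coset_hom T.is_group)
  obtain c where c: "c \<in> carrier F" "Z = N #>\<^bsub>F\<^esub> c" using coset_surj[OF Z] by blast
  have "Poly_Mapping.keys c \<subseteq> carrier B \<times> carrier P" using c(1) by simp
  then have "Q (N #>\<^bsub>F\<^esub> c)"
  proof (induction c rule: free_Abelian_group_induct[consumes 1, case_names one div gen])
    case one
    then show ?case using \<open>Q \<one>\<^bsub>T\<^esub>\<close> q.hom_one by simp
  next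
    case (div c d)
    note 2 = this
    have cd: "c \<in> carrier F" "d \<in> carrier F" "- d \<in> carrier F" using 2(1,2) by simp_all
    have "N #>\<^bsub>F\<^esub> (c + - d) = (N #>\<^bsub>F\<^esub> c) \<otimes>\<^bsub>T\<^esub> inv\<^bsub>T\<^esub> (N #>\<^bsub>F\<^esub> d)"
      using coset_add[OF cd(1,3)] q.hom_inv[OF cd(2)] 2(2) by simp
    then show ?case using assms(3)[OF coset_closed[OF cd(1)] coset_closed[OF cd(2)] 2(3,4)] by simp
  next
    case (gen z)
    then show ?case using pure[of "fst z" "snd z"] by (auto simp: pure_eq)
  qed
  then show ?thesis using c(2) by simp
qed

end

text \<open>The value of \<^const>\<open>tensor_lift\<close> on a representative.\<close>

definition tensor_sum ::
  "('c, 'g) ring_scheme \<Rightarrow> ('b \<Rightarrow> 'm \<Rightarrow> 'c) \<Rightarrow> ('b \<times> 'm \<Rightarrow>\<^sub>0 int) \<Rightarrow> 'c"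
  where "tensor_sum G \<beta> c = (\<Oplus>\<^bsub>G\<^esub>z\<in>Poly_Mapping.keys c.
    [Poly_Mapping.lookup c z] \<cdot>\<^bsub>G\<^esub> \<beta> (fst z) (snd z))"

text \<open>
  Balanced biadditive maps. Their induced map on the tensor product is evaluated on representatives; the
  point is that \<open>tensor_sum\<close> is a homomorphism on the free abelian group that kills all relations.
\<close>

locale balanced_map = tensor_pair R B P + G: abelian_group G
  for R :: "('a, 'r) ring_scheme" (structure) and B :: "('a, 'b) bimodule" and P :: "('a, 'm) module"
    and G :: "('c, 'g) ring_scheme" +
  fixes \<beta> :: "'b \<Rightarrow> 'm \<Rightarrow> 'c"
  assumes \<beta>_closed: "\<lbrakk>x \<in> carrier B; p \<in> carrier P\<rbrakk> \<Longrightarrow> \<beta> x p \<in> carrier G"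
    and \<beta>_add_left: "\<lbrakk>x \<in> carrier B; y \<in> carrier B; p \<in> carrier P\<rbrakk> \<Longrightarrow>
      \<beta> (x \<oplus>\<^bsub>B\<^esub> y) p = \<beta> x p \<oplus>\<^bsub>G\<^esub> \<beta> y p"
    and \<beta>_add_right: "\<lbrakk>x \<in> carrier B; p \<in> carrier P; q \<in> carrier P\<rbrakk> \<Longrightarrow>
      \<beta> x (p \<oplus>\<^bsub>P\<^esub> q) = \<beta> x p \<oplus>\<^bsub>G\<^esub> \<beta> x q"
    and \<beta>_balanced: "\<lbrakk>x \<in> carrier B; a \<in> carrier R; p \<in> carrier P\<rbrakk> \<Longrightarrow>
      \<beta> (rsmult B x a) p = \<beta> x (a \<odot>\<^bsub>P\<^esub> p)"
begin

abbreviation "\<Phi> \<equiv> tensor_sum G \<beta>"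
abbreviation "\<beta>' z \<equiv> \<beta> (fst z) (snd z)"

lemma int_pow_closed: "x \<in> carrier G \<Longrightarrow> [(k::int)] \<cdot>\<^bsub>G\<^esub> x \<in> carrier G"
  unfolding add_pow_def using group.int_pow_closed[OF G.a_group] by simp

lemma \<beta>'_closed: "z \<in> carrier B \<times> carrier P \<Longrightarrow> \<beta>' z \<in> carrier G"
  using \<beta>_closed by auto

lemma tensor_sum_superset:
  assumes A: "finite A" "Poly_Mapping.keys c \<subseteq> A" "A \<subseteq> carrier B \<times> carrier P"
  shows "\<Phi> c = (\<Oplus>\<^bsub>G\<^esub>z\<in>A. [Poly_Mapping.lookup c z] \<cdot>\<^bsub>G\<^esub> \<beta>' z)"
proof -
  have cl: "[Poly_Mapping.lookup c z] \<cdot>\<^bsub>G\<^esub> \<beta>' z \<in> carrier G" if "z \<in> A" for z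
    by (rule int_pow_closed, rule \<beta>'_closed) (use A(3) that in blast)
  have z: "[Poly_Mapping.lookup c z] \<cdot>\<^bsub>G\<^esub> \<beta>' z = \<zero>\<^bsub>G\<^esub>" if "z \<in> A - Poly_Mapping.keys c" for z
  proof -
    have "Poly_Mapping.lookup c z = 0" using that by (simp add: in_keys_iff)
    then show ?thesis by (simp add: add_pow_def int_pow_def2 nat_pow_def)
  qed
  show ?thesis unfolding tensor_sum_def
    by (rule G.add.finprod_mono_neutral_cong_left[simplified]) (use A z cl in auto)
qed

lemma tensor_sum_closed:
  assumes "c \<in> carrier F" shows "\<Phi> c \<in> carrier G"
  unfolding tensor_sum_def
  by (rule G.finsum_closed) (use assms in \<open>auto intro!: int_pow_closed \<beta>_closed\<close>)

lemma tensor_sum_add: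
  assumes c: "c \<in> carrier F" and d: "d \<in> carrier F"
  shows "\<Phi> (c + d) = \<Phi> c \<oplus>\<^bsub>G\<^esub> \<Phi> d"
proof -
  let ?A = "Poly_Mapping.keys c \<union> Poly_Mapping.keys d"
  have A: "finite ?A" "?A \<subseteq> carrier B \<times> carrier P" using c d by auto
  have \<beta>A: "\<beta>' z \<in> carrier G" if "z \<in> ?A" for z by (rule \<beta>'_closed) (rule subsetD[OF A(2) that])
  have "\<Phi> (c + d) = (\<Oplus>\<^bsub>G\<^esub>z\<in>?A. [Poly_Mapping.lookup (c + d) z] \<cdot>\<^bsub>G\<^esub> \<beta>' z)"
    by (rule tensor_sum_superset[OF A(1) keys_add A(2)])
  also have "\<dots> = (\<Oplus>\<^bsub>G\<^esub>z\<in>?A. [Poly_Mapping.lookup c z] \<cdot>\<^bsub>G\<^esub> \<beta>' z \<oplus>\<^bsub>G\<^esub> [Poly_Mapping.lookup d z] \<cdot>\<^bsub>G\<^esub> \<beta>' z)"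
  proof (rule G.finsum_cong')
    fix z assume z: "z \<in> ?A"
    from group.int_pow_mult[OF G.a_group, of "\<beta>' z"] \<beta>A[OF z]
    show "[Poly_Mapping.lookup (c + d) z] \<cdot>\<^bsub>G\<^esub> \<beta>' z = [Poly_Mapping.lookup c z] \<cdot>\<^bsub>G\<^esub> \<beta>' z \<oplus>\<^bsub>G\<^esub> [Poly_Mapping.lookup d z] \<cdot>\<^bsub>G\<^esub> \<beta>' z"
      by (simp add: add_pow_def lookup_add)
  qed (use \<beta>A in \<open>auto intro!: int_pow_closed\<close>)
  also have "\<dots> = (\<Oplus>\<^bsub>G\<^esub>z\<in>?A. [Poly_Mapping.lookup c z] \<cdot>\<^bsub>G\<^esub> \<beta>' z) \<oplus>\<^bsub>G\<^esub> (\<Oplus>\<^bsub>G\<^esub>z\<in>?A. [Poly_Mapping.lookup d z] \<cdot>\<^bsub>G\<^esub> \<beta>' z)"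
    by (rule G.finsum_addf) (use \<beta>A in \<open>auto intro!: int_pow_closed\<close>)
  also have "\<dots> = \<Phi> c \<oplus>\<^bsub>G\<^esub> \<Phi> d"
    using tensor_sum_superset[OF A(1) Un_upper1 A(2)] tensor_sum_superset[OF A(1) Un_upper2 A(2)] by simp
  finally show ?thesis .
qed

lemma tensor_sum_frag_of:
  assumes "x \<in> carrier B" "p \<in> carrier P" shows "\<Phi> (frag_of (x, p)) = \<beta> x p"
proof -
  have "\<Phi> (frag_of (x, p)) = (\<Oplus>\<^bsub>G\<^esub>z\<in>{(x, p)}. [Poly_Mapping.lookup (frag_of (x, p)) z] \<cdot>\<^bsub>G\<^esub> \<beta>' z)"
    by (rule tensor_sum_superset) (use assms in auto)
  also have "\<dots> = [(1::int)] \<cdot>\<^bsub>G\<^esub> \<beta> x p"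
    using \<beta>_closed[OF assms] by (simp add: int_pow_closed)
  also have "\<dots> = \<beta> x p"
    using group.int_pow_1[OF G.a_group, of "\<beta> x p"] \<beta>_closed[OF assms] by (simp add: add_pow_def)
  finally show ?thesis .
qed

lemma tensor_sum_group_hom: "group_hom F (add_monoid G) \<Phi>"
  by (auto simp: group_hom_def group_hom_axioms_def G.a_group hom_def tensor_sum_add tensor_sum_closed
      simp del: carrier_free_Abelian_group_iff)

lemma tensor_sum_diff:
  assumes c: "c \<in> carrier F" and d: "d \<in> carrier F"
  shows "\<Phi> (c - d) = \<Phi> c \<ominus>\<^bsub>G\<^esub> \<Phi> d"
proof -
  have "- d \<in> carrier F" using d by simp
  from tensor_sum_add[OF c this] group_hom.hom_inv[OF tensor_sum_group_hom d] d
  show ?thesis by (simp add: a_minus_def a_inv_def)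
qed

lemma tensor_sum_relations:
  assumes "c \<in> N" shows "\<Phi> c = \<zero>\<^bsub>G\<^esub>"
proof -
  interpret \<Phi>: group_hom F "add_monoid G" \<Phi> by (rule tensor_sum_group_hom)
  have "tensor_relations R B P \<subseteq> kernel F (add_monoid G) \<Phi>"
  proof
    fix c assume c: "c \<in> tensor_relations R B P"
    then have cF: "c \<in> carrier F" using relations_carrier by blast
    have fr: "frag_of (x, p) \<in> carrier F" if "x \<in> carrier B" "p \<in> carrier P" for x p
      using that by simp
    from c consider (l) x y p where "c = frag_of (x \<oplus>\<^bsub>B\<^esub> y, p) - frag_of (x, p) - frag_of (y, p)"
        "x \<in> carrier B" "y \<in> carrier B" "p \<in> carrier P"
      | (r) x p q where "c = frag_of (x, p \<oplus>\<^bsub>P\<^esub> q) - frag_of (x, p) - frag_of (x, q)"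
        "x \<in> carrier B" "p \<in> carrier P" "q \<in> carrier P"
      | (b) x a p where "c = frag_of (rsmult B x a, p) - frag_of (x, a \<odot>\<^bsub>P\<^esub> p)"
        "x \<in> carrier B" "a \<in> carrier R" "p \<in> carrier P"
      unfolding tensor_relations_def by blast
    then have "\<Phi> c = \<zero>\<^bsub>G\<^esub>"
    proof cases
      case l
      have "\<Phi> c = (\<beta> x p \<oplus>\<^bsub>G\<^esub> \<beta> y p) \<ominus>\<^bsub>G\<^esub> \<beta> x p \<ominus>\<^bsub>G\<^esub> \<beta> y p"
        unfolding l(1) using l(2-)
        by (simp add: tensor_sum_diff F_diff fr tensor_sum_frag_of \<beta>_add_left del: carrier_free_Abelian_group_iff)
      also have "\<dots> = \<zero>\<^bsub>G\<^esub>"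
        using \<beta>_closed l(2-) by (simp add: G.add_diff_left)
      finally show ?thesis .
    next
      case r
      have "\<Phi> c = (\<beta> x p \<oplus>\<^bsub>G\<^esub> \<beta> x q) \<ominus>\<^bsub>G\<^esub> \<beta> x p \<ominus>\<^bsub>G\<^esub> \<beta> x q"
        unfolding r(1) using r(2-)
        by (simp add: tensor_sum_diff F_diff fr tensor_sum_frag_of \<beta>_add_right del: carrier_free_Abelian_group_iff)
      also have "\<dots> = \<zero>\<^bsub>G\<^esub>"
        using \<beta>_closed r(2-) by (simp add: G.add_diff_left)
      finally show ?thesis .
    next
      case b
      show ?thesis
        unfolding b(1) using b(2-)
        by (simp add: tensor_sum_diff fr tensor_sum_frag_of rsmult_closed \<beta>_balanced \<beta>_closed
            del: carrier_free_Abelian_group_iff)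
    qed
    then show "c \<in> kernel F (add_monoid G) \<Phi>" using cF by (simp add: kernel_def)
  qed
  from group.generate_subgroup_incl[OF _ this \<Phi>.subgroup_kernel]
  have "N \<subseteq> kernel F (add_monoid G) \<Phi>" by simp
  then show ?thesis using assms by (auto simp: kernel_def)
qed

lemma tensor_lift_coset:
  assumes c: "c \<in> carrier F" shows "tensor_lift G \<beta> (N #>\<^bsub>F\<^esub> c) = \<Phi> c"
proof -
  have "\<Phi> d = \<Phi> c" if d: "d \<in> N #>\<^bsub>F\<^esub> c" for d
  proof -
    obtain m where m: "m \<in> N" "d = m + c" using d by (auto simp: r_coset_def)
    have "m \<in> carrier F" using subgroup.mem_carrier[OF N_subgroup m(1)] .
    from tensor_sum_add[OF this c] show ?thesis
      using m tensor_sum_relations tensor_sum_closed[OF c] by simp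
  qed
  moreover have "c \<in> N #>\<^bsub>F\<^esub> c"
    by (rule group.rcos_self[OF _ c N_subgroup]) simp
  ultimately have "\<Phi> ` (N #>\<^bsub>F\<^esub> c) = {\<Phi> c}" by blast
  then show ?thesis unfolding tensor_lift_def tensor_sum_def by simp
qed

lemma tensor_lift_pure:
  "\<lbrakk>x \<in> carrier B; p \<in> carrier P\<rbrakk> \<Longrightarrow> tensor_lift G \<beta> (pure x p) = \<beta> x p"
  using tensor_lift_coset[of "frag_of (x, p)"] tensor_sum_frag_of by (simp add: pure_eq)

lemma tensor_lift_one: "tensor_lift G \<beta> \<one>\<^bsub>T\<^esub> = \<zero>\<^bsub>G\<^esub>"
proof -
  have z: "0 \<in> carrier F" by simp
  interpret T: comm_group T by (rule T_comm_group)
  interpret q: group_hom F T "\<lambda>c. N #>\<^bsub>F\<^esub> c"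
    by (simp add: group_hom_def group_hom_axioms_def coset_hom T.is_group)
  have "N #>\<^bsub>F\<^esub> 0 = \<one>\<^bsub>T\<^esub>" using q.hom_one by simp
  then show ?thesis using tensor_lift_coset[OF z] tensor_sum_relations[OF generate.one] by simp
qed

end

section \<open>The product of an ideal and a module\<close>

inductive_set ideal_smult :: "'a set \<Rightarrow> ('a, 'm, 's) module_scheme \<Rightarrow> 'm set"
  for \<aa> and M (structure) where
    smult: "\<lbrakk>a \<in> \<aa>; x \<in> carrier M\<rbrakk> \<Longrightarrow> a \<odot> x \<in> ideal_smult \<aa> M"
  | add: "\<lbrakk>x \<in> ideal_smult \<aa> M; y \<in> ideal_smult \<aa> M\<rbrakk> \<Longrightarrow> x \<oplus> y \<in> ideal_smult \<aa> M"

lemma ideal_smult_submodule: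
  assumes M: "left_module R M" and "ideal \<aa> R"
  shows "submodule (ideal_smult \<aa> M) R M"
proof -
  interpret M: left_module R M by fact
  interpret ideal \<aa> R by fact
  have cl: "x \<in> carrier M" if "x \<in> ideal_smult \<aa> M" for x
    using that by induction auto
  show ?thesis
  proof (rule M.submoduleI)
    show "ideal_smult \<aa> M \<subseteq> carrier M" using cl by blast
    show "\<zero>\<^bsub>M\<^esub> \<in> ideal_smult \<aa> M"
      using ideal_smult.smult[of "\<zero>\<^bsub>R\<^esub>" \<aa> "\<zero>\<^bsub>M\<^esub>" M] by simp
    fix b x assume b: "b \<in> carrier R" and "x \<in> ideal_smult \<aa> M"
    from this(2) show "b \<odot>\<^bsub>M\<^esub> x \<in> ideal_smult \<aa> M"
    proof induction
      case (smult a x)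
      then show ?case
        using ideal_smult.smult[of "b \<otimes>\<^bsub>R\<^esub> a" \<aa> x M] b I_l_closed by (simp add: M.smult_assoc)
    next
      case (add x y)
      then show ?case using b cl by (simp add: M.smult_r_distr ideal_smult.add)
    qed
  qed (rule ideal_smult.add)
qed

lemma ideal_smult_image:
  assumes h: "h \<in> lin_hom R M N" and M: "left_module R M" and \<aa>: "ideal \<aa> R" and x: "x \<in> ideal_smult \<aa> M"
  shows "h x \<in> ideal_smult \<aa> N"
  using x
proof induction
  case (smult a x)
  then show ?case
    using ideal_smult.smult[OF smult(1) lin_hom_closed[OF h smult(2)]] ideal.Icarr[OF \<aa> smult(1)]
    by (simp add: lin_hom_smult[OF h])
next
  case (add x y)
  note sub = subsetD[OF submodule_subset[OF ideal_smult_submodule[OF M \<aa>]]]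
  show ?case using ideal_smult.add[OF add(3,4)] by (simp add: lin_hom_add[OF h] sub[OF add(1)] sub[OF add(2)])
qed

text \<open>
  Since \<open>h\<close> is onto, each term \<open>ay\<close> of an element of \<open>\<aa>N\<close> comes from a term \<open>ax\<close>.
\<close>

lemma ideal_smult_image_preimage:
  assumes h: "h \<in> lin_hom R M N" and surj: "h ` carrier M = carrier N" and M: "left_module R M"
    and \<aa>: "ideal \<aa> R" and y: "y \<in> ideal_smult \<aa> N"
  shows "\<exists>x\<in>ideal_smult \<aa> M. h x = y"
  using y
proof induction
  case (smult a y)
  then obtain x where x: "x \<in> carrier M" "y = h x" using surj by blast
  then show ?case
    using ideal_smult.smult[OF smult(1) x(1)] ideal.Icarr[OF \<aa> smult(1)] lin_hom_smult[OF h, of a x] by auto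
next
  case (add y z)
  note sub = subsetD[OF submodule_subset[OF ideal_smult_submodule[OF M \<aa>]]]
  from add.IH obtain u v where uv: "u \<in> ideal_smult \<aa> M" "h u = y" "v \<in> ideal_smult \<aa> M" "h v = z" by blast
  then show ?case
    using ideal_smult.add[OF uv(1,3)] lin_hom_add[OF h sub[OF uv(1)] sub[OF uv(3)]] by auto
qed

section \<open>Tensoring with the quotient ring\<close>

definition regular_module :: "('a, 'r) ring_scheme \<Rightarrow> ('a, 'a) module"
  where "regular_module R = \<lparr>carrier = carrier R, monoid.mult = monoid.mult R, monoid.one = \<one>\<^bsub>R\<^esub>,
    ring.zero = \<zero>\<^bsub>R\<^esub>, ring.add = ring.add R, smult = monoid.mult R\<rparr>"

lemma regular_module_simps [simp]:
  "carrier (regular_module R) = carrier R" "\<zero>\<^bsub>regular_module R\<^esub> = \<zero>\<^bsub>R\<^esub>"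
  "x \<oplus>\<^bsub>regular_module R\<^esub> y = x \<oplus>\<^bsub>R\<^esub> y" "a \<odot>\<^bsub>regular_module R\<^esub> x = a \<otimes>\<^bsub>R\<^esub> x"
  by (simp_all add: regular_module_def)

lemma regular_left_module:
  assumes "ring R" shows "left_module R (regular_module R)"
proof -
  interpret ring R by fact
  have "abelian_group (regular_module R)"
  proof (rule abelian_groupI)
    fix x assume "x \<in> carrier (regular_module R)"
    then show "\<exists>y\<in>carrier (regular_module R). y \<oplus>\<^bsub>regular_module R\<^esub> x = \<zero>\<^bsub>regular_module R\<^esub>"
      by (intro bexI[of _ "\<ominus>\<^bsub>R\<^esub> x"]) (simp_all add: l_neg)
  qed (simp_all add: a_ac)
  then show ?thesis
    by (rule left_moduleI[OF assms]) (simp_all add: l_distr r_distr m_assoc)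
qed

context ideal
begin

abbreviation "cl r \<equiv> I +>\<^bsub>R\<^esub> r"

lemma cl_hom:
  "\<lbrakk>r \<in> carrier R; s \<in> carrier R\<rbrakk> \<Longrightarrow> cl (r \<oplus>\<^bsub>R\<^esub> s) = cl r \<oplus>\<^bsub>R Quot I\<^esub> cl s"
  "\<lbrakk>r \<in> carrier R; s \<in> carrier R\<rbrakk> \<Longrightarrow> cl (r \<otimes>\<^bsub>R\<^esub> s) = cl r \<otimes>\<^bsub>R Quot I\<^esub> cl s"
  "cl \<one>\<^bsub>R\<^esub> = \<one>\<^bsub>R Quot I\<^esub>"
  using rcos_ring_hom by (simp_all add: ring_hom_def)

lemma cl_closed: "r \<in> carrier R \<Longrightarrow> cl r \<in> carrier (R Quot I)"
  using rcos_ring_hom by (auto simp: ring_hom_def)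

lemma cl_surj: "carrier (R Quot I) = cl ` carrier R"
  by (auto simp: FactRing_def A_RCOSETS_def')

lemma cl_zero: "cl \<zero>\<^bsub>R\<^esub> = \<zero>\<^bsub>R Quot I\<^esub>"
  using a_rcos_const[OF additive_subgroup.zero_closed[OF is_additive_subgroup]] by (simp add: FactRing_def)

lemma cl_eq_iff: "\<lbrakk>r \<in> carrier R; s \<in> carrier R\<rbrakk> \<Longrightarrow> cl r = cl s \<longleftrightarrow> r \<ominus>\<^bsub>R\<^esub> s \<in> I"
  using a_rcos_module[of s r] a_repr_independence'[of r s] a_rcos_self[of r] by (auto simp: a_minus_def)

lemma quotient_left_simps [simp]:
  "carrier (quotient_left R I) = carrier (R Quot I)" "\<zero>\<^bsub>quotient_left R I\<^esub> = \<zero>\<^bsub>R Quot I\<^esub>"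
  "x \<oplus>\<^bsub>quotient_left R I\<^esub> y = x \<oplus>\<^bsub>R Quot I\<^esub> y" "a \<odot>\<^bsub>quotient_left R I\<^esub> x = cl a \<otimes>\<^bsub>R Quot I\<^esub> x"
  by (simp_all add: quotient_left_def)

lemma quotient_bimodule_simps [simp]:
  "carrier (quotient_bimodule R I) = carrier (R Quot I)" "\<zero>\<^bsub>quotient_bimodule R I\<^esub> = \<zero>\<^bsub>R Quot I\<^esub>"
  "x \<oplus>\<^bsub>quotient_bimodule R I\<^esub> y = x \<oplus>\<^bsub>R Quot I\<^esub> y" "a \<odot>\<^bsub>quotient_bimodule R I\<^esub> x = cl a \<otimes>\<^bsub>R Quot I\<^esub> x"
  "rsmult (quotient_bimodule R I) x a = x \<otimes>\<^bsub>R Quot I\<^esub> cl a"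
  by (simp_all add: quotient_bimodule_def)

lemma quotient_left_module:
  "left_module R (quotient_left R I)" "cl \<in> lin_hom R (regular_module R) (quotient_left R I)"
  by (rule left_module_surj_image[OF regular_left_module[OF ring_axioms], of cl];
      simp add: cl_surj cl_hom cl_zero)+

lemma quotient_bimodule_left_module: "left_module R (quotient_bimodule R I)"
  by (rule left_module_surj_image[OF regular_left_module[OF ring_axioms], of cl])
    (simp_all add: cl_surj cl_hom cl_zero)

lemma quotient_tensor_pair:
  assumes P: "left_module R P" shows "tensor_pair R (quotient_bimodule R I) P"
proof -
  interpret Q: ring "R Quot I" by (rule quotient_is_ring)
  interpret B: left_module R "quotient_bimodule R I" by (rule quotient_bimodule_left_module)
  show ?thesis
    using P B.M.abelian_group_axioms by (simp add: tensor_pair_def tensor_pair_axioms_def cl_closed)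
qed

text \<open>The canonical surjection of \<open>P\<close> onto its tensor product with the quotient ring.\<close>

definition unit_tensor :: "('a, 'm) module \<Rightarrow> 'm \<Rightarrow> ('a set \<times> 'm \<Rightarrow>\<^sub>0 int) set"
  where "unit_tensor P = pure_tensor R (quotient_bimodule R I) P (cl \<one>\<^bsub>R\<^esub>)"

lemma tensor_ab_abelian_group:
  assumes P: "left_module R P" shows "abelian_group (tensor_ab R (quotient_bimodule R I) P)"
proof -
  interpret tensor_pair R "quotient_bimodule R I" P by (rule quotient_tensor_pair[OF P])
  have "add_monoid (tensor_ab R (quotient_bimodule R I) P) = \<lparr>carrier = carrier T, monoid.mult = monoid.mult T, one = \<one>\<^bsub>T\<^esub>\<rparr>"
    by (simp add: tensor_ab_def)
  moreover have "comm_group \<lparr>carrier = carrier T, monoid.mult = monoid.mult T, one = \<one>\<^bsub>T\<^esub>\<rparr>"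
    using T_comm_group by (cases T) (simp add: T_eq FactGroup_def)
  ultimately show ?thesis by (intro comm_group_abelian_groupI) simp
qed

lemma tensor_ab_simps [simp]:
  "carrier (tensor_ab R B P) = carrier (tensor_group R B P)"
  "x \<oplus>\<^bsub>tensor_ab R B P\<^esub> y = x \<otimes>\<^bsub>tensor_group R B P\<^esub> y" "\<zero>\<^bsub>tensor_ab R B P\<^esub> = \<one>\<^bsub>tensor_group R B P\<^esub>"
  "carrier (tensor_module R B P) = carrier (tensor_group R B P)"
  "x \<oplus>\<^bsub>tensor_module R B P\<^esub> y = x \<otimes>\<^bsub>tensor_group R B P\<^esub> y" "\<zero>\<^bsub>tensor_module R B P\<^esub> = \<one>\<^bsub>tensor_group R B P\<^esub>"
  by (simp_all add: tensor_ab_def tensor_module_def)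

text \<open>
  As the quotient ring is generated by 1 as a right \<open>R\<close>-module, every pure tensor \<open>r \<otimes> p\<close> equals
  \<open>1 \<otimes> rp\<close>.
\<close>

lemma unit_tensor_scale:
  assumes P: "left_module R P" and r: "r \<in> carrier R" and p: "p \<in> carrier P"
  shows "pure_tensor R (quotient_bimodule R I) P (cl r) p = unit_tensor P (r \<odot>\<^bsub>P\<^esub> p)"
proof -
  interpret Q: ring "R Quot I" by (rule quotient_is_ring)
  interpret tensor_pair R "quotient_bimodule R I" P by (rule quotient_tensor_pair[OF P])
  show ?thesis
    using pure_balanced[of "cl \<one>\<^bsub>R\<^esub>" r p] r p cl_closed[OF r] cl_closed[OF one_closed]
    by (simp add: unit_tensor_def cl_hom(3))
qed

lemma unit_tensor_add:
  assumes P: "left_module R P" and p: "p \<in> carrier P" and q: "q \<in> carrier P"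
  shows "unit_tensor P (p \<oplus>\<^bsub>P\<^esub> q) = unit_tensor P p \<otimes>\<^bsub>tensor_group R (quotient_bimodule R I) P\<^esub> unit_tensor P q"
proof -
  interpret tensor_pair R "quotient_bimodule R I" P by (rule quotient_tensor_pair[OF P])
  show ?thesis using pure_add_right[OF _ p q, of "cl \<one>\<^bsub>R\<^esub>"] cl_closed by (simp add: unit_tensor_def)
qed

lemma unit_tensor_surj:
  assumes P: "left_module R P"
  shows "unit_tensor P ` carrier P = carrier (tensor_group R (quotient_bimodule R I) P)"
    and "unit_tensor P \<zero>\<^bsub>P\<^esub> = \<one>\<^bsub>tensor_group R (quotient_bimodule R I) P\<^esub>"
proof -
  interpret tensor_pair R "quotient_bimodule R I" P by (rule quotient_tensor_pair[OF P])
  interpret T: comm_group T by (rule T_comm_group)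
  let ?t = "unit_tensor P"
  have tc: "?t p \<in> carrier T" if "p \<in> carrier P" for p
    unfolding unit_tensor_def using that cl_closed by (intro pure_closed) simp_all
  have "?t \<zero>\<^bsub>P\<^esub> \<otimes>\<^bsub>T\<^esub> ?t \<zero>\<^bsub>P\<^esub> = ?t \<zero>\<^bsub>P\<^esub>" using unit_tensor_add[OF P, of "\<zero>\<^bsub>P\<^esub>" "\<zero>\<^bsub>P\<^esub>"] by simp
  then show t0: "?t \<zero>\<^bsub>P\<^esub> = \<one>\<^bsub>T\<^esub>" using tc T.r_cancel_one' by (metis P.M.zero_closed)
  have "Z \<in> ?t ` carrier P" if "Z \<in> carrier T" for Z
    using that
  proof (induction rule: tensor_group_induct)
    case one
    show ?case unfolding t0[symmetric] by (rule imageI) simp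
  next
    case (div Y Z)
    note 2 = this
    then obtain p q where pq: "p \<in> carrier P" "Y = ?t p" "q \<in> carrier P" "Z = ?t q" by blast
    have "?t (p \<ominus>\<^bsub>P\<^esub> q) \<otimes>\<^bsub>T\<^esub> ?t q = ?t p"
      using unit_tensor_add[OF P, of "p \<ominus>\<^bsub>P\<^esub> q" q] pq by (simp add: a_minus_def P.M.a_assoc P.M.l_neg)
    then have "?t p \<otimes>\<^bsub>T\<^esub> inv\<^bsub>T\<^esub> ?t q = ?t (p \<ominus>\<^bsub>P\<^esub> q)"
      using T.inv_solve_right[of "?t (p \<ominus>\<^bsub>P\<^esub> q)" "?t p" "?t q"] tc pq by simp
    then show ?case using pq by simp
  next
    case (pure x p)
    then obtain r where "r \<in> carrier R" "x = cl r" by (auto simp: cl_surj)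
    then show ?case using unit_tensor_scale[OF P, of r p] pure by simp
  qed
  then show "?t ` carrier P = carrier T" using tc by blast
qed

lemma tensor_quotient_left_module:
  assumes P: "left_module R P"
  shows "left_module R (tensor_module R (quotient_bimodule R I) P)"
    and "unit_tensor P \<in> lin_hom R P (tensor_module R (quotient_bimodule R I) P)"
proof -
  let ?B = "quotient_bimodule R I"
  let ?T = "tensor_module R ?B P"
  interpret Q: ring "R Quot I" by (rule quotient_is_ring)
  interpret tensor_pair R ?B P by (rule quotient_tensor_pair[OF P])
  have sm: "unit_tensor P (a \<odot>\<^bsub>P\<^esub> p) = a \<odot>\<^bsub>?T\<^esub> unit_tensor P p" if a: "a \<in> carrier R" and p: "p \<in> carrier P" for a p
  proof -
    interpret A: abelian_group "tensor_ab R ?B P" by (rule tensor_ab_abelian_group[OF P])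
    interpret balanced_map R ?B P "tensor_ab R ?B P" "\<lambda>x p. pure (a \<odot>\<^bsub>?B\<^esub> x) p"
    proof
      fix x y p q b
      assume "x \<in> carrier ?B" "y \<in> carrier ?B" "p \<in> carrier P" "q \<in> carrier P"
      then show "pure (a \<odot>\<^bsub>?B\<^esub> x) p \<in> carrier (tensor_ab R ?B P)"
        "pure (a \<odot>\<^bsub>?B\<^esub> (x \<oplus>\<^bsub>?B\<^esub> y)) p = pure (a \<odot>\<^bsub>?B\<^esub> x) p \<oplus>\<^bsub>tensor_ab R ?B P\<^esub> pure (a \<odot>\<^bsub>?B\<^esub> y) p"
        "pure (a \<odot>\<^bsub>?B\<^esub> x) (p \<oplus>\<^bsub>P\<^esub> q) = pure (a \<odot>\<^bsub>?B\<^esub> x) p \<oplus>\<^bsub>tensor_ab R ?B P\<^esub> pure (a \<odot>\<^bsub>?B\<^esub> x) q"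
        using cl_closed[OF a] pure_closed[of "cl a \<otimes>\<^bsub>R Quot I\<^esub> x" p] pure_add_left[of "cl a \<otimes>\<^bsub>R Quot I\<^esub> x" "cl a \<otimes>\<^bsub>R Quot I\<^esub> y" p]
          pure_add_right[of "cl a \<otimes>\<^bsub>R Quot I\<^esub> x" p q] by (simp_all add: Q.r_distr)
    next
      fix x p b assume "x \<in> carrier ?B" "b \<in> carrier R" "p \<in> carrier P"
      then show "pure (a \<odot>\<^bsub>?B\<^esub> rsmult ?B x b) p = pure (a \<odot>\<^bsub>?B\<^esub> x) (b \<odot>\<^bsub>P\<^esub> p)"
        using cl_closed[OF a] cl_closed[of b] pure_balanced[of "cl a \<otimes>\<^bsub>R Quot I\<^esub> x" b p] by (simp add: Q.m_assoc)
    qed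
    have "a \<odot>\<^bsub>?T\<^esub> unit_tensor P p = pure (a \<odot>\<^bsub>?B\<^esub> cl \<one>\<^bsub>R\<^esub>) p"
      unfolding unit_tensor_def using tensor_lift_pure[of "cl \<one>\<^bsub>R\<^esub>" p] cl_closed[OF one_closed] p
      by (simp add: tensor_module_def)
    also have "\<dots> = pure (cl a) p" using cl_closed[OF a] by (simp add: cl_hom(3))
    finally show ?thesis using unit_tensor_scale[OF P a p] by simp
  qed
  show "left_module R ?T" "unit_tensor P \<in> lin_hom R P ?T"
    by (rule left_module_surj_image[OF P, of "unit_tensor P"];
        simp add: unit_tensor_surj[OF P] unit_tensor_add[OF P] sm)+
qed

text \<open>
  An element of \<open>IP\<close> is killed since \<open>1 \<otimes> ax = a \<otimes> x = 0\<close>. Conversely, acting by representatives is a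
  balanced map from \<open>R / I\<close> and \<open>P\<close> to \<open>P / IP\<close>, and the map that it induces on the tensor product recovers
  the class of \<open>p\<close> from \<open>1 \<otimes> p\<close>.
\<close>

lemma unit_tensor_kernel:
  fixes P :: "('a, 'm) module"
  assumes P: "left_module R P" and p: "p \<in> carrier P"
  shows "unit_tensor P p = \<zero>\<^bsub>tensor_module R (quotient_bimodule R I) P\<^esub> \<longleftrightarrow> p \<in> ideal_smult I P"
proof
  let ?B = "quotient_bimodule R I"
  let ?T = "tensor_module R ?B P"
  note T = tensor_quotient_left_module[OF P]
  interpret P: left_module R P by (rule P)
  interpret T: left_module R ?T by (rule T(1))
  note sub = subsetD[OF submodule_subset[OF ideal_smult_submodule[OF P is_ideal]]]
  assume "p \<in> ideal_smult I P"
  then show "unit_tensor P p = \<zero>\<^bsub>?T\<^esub>"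
  proof induction
    case (smult a x)
    have a: "a \<in> carrier R" using smult(1) by (rule Icarr)
    have "unit_tensor P (a \<odot>\<^bsub>P\<^esub> x) = pure_tensor R ?B P (cl a) x" using unit_tensor_scale[OF P a smult(2)] by simp
    also have "cl a = cl \<zero>\<^bsub>R\<^esub>" using cl_eq_iff[OF a zero_closed] smult(1) a by (simp add: minus_eq)
    also have "pure_tensor R ?B P (cl \<zero>\<^bsub>R\<^esub>) x = unit_tensor P (\<zero>\<^bsub>R\<^esub> \<odot>\<^bsub>P\<^esub> x)"
      using unit_tensor_scale[OF P zero_closed smult(2)] by simp
    also have "\<dots> = \<zero>\<^bsub>?T\<^esub>" using lin_hom_zero[OF P T] smult(2) by simp
    finally show ?case .
  next
    case (add x y)
    then show ?case using lin_hom_add[OF T(2) sub[OF add(1)] sub[OF add(2)]] T.M.l_zero[OF T.M.zero_closed] by simp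
  qed
next
  let ?B = "quotient_bimodule R I"
  let ?T = "tensor_module R ?B P"
  assume t0: "unit_tensor P p = \<zero>\<^bsub>?T\<^esub>"
  interpret P: left_module R P by (rule P)
  interpret tensor_pair R ?B P by (rule quotient_tensor_pair[OF P])
  obtain Q :: "('a, 'm) module" and \<pi> where Q: "left_module R Q" and \<pi>: "\<pi> \<in> lin_hom R P Q"
    and "\<pi> ` carrier P = carrier Q" and ker: "\<forall>x\<in>carrier P. \<pi> x = \<zero>\<^bsub>Q\<^esub> \<longleftrightarrow> x \<in> ideal_smult I P"
    by (rule quotient_exists[OF P ideal_smult_submodule[OF P is_ideal]]) (rule that)
  interpret Q: left_module R Q by (rule Q)
  define rep where "rep Z = (SOME r. r \<in> carrier R \<and> Z = cl r)" for Z
  have rep: "rep Z \<in> carrier R \<and> Z = cl (rep Z)" if "Z \<in> carrier (R Quot I)" for Z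
    unfolding rep_def by (rule someI_ex) (use that in \<open>auto simp: cl_surj\<close>)
  have eq: "\<pi> (r \<odot>\<^bsub>P\<^esub> x) = \<pi> (s \<odot>\<^bsub>P\<^esub> x)"
    if "r \<in> carrier R" "s \<in> carrier R" "x \<in> carrier P" "cl r = cl s" for r s x
  proof -
    have "r \<ominus>\<^bsub>R\<^esub> s \<in> I" using that cl_eq_iff by simp
    from ideal_smult.smult[OF this that(3)]
    have "r \<odot>\<^bsub>P\<^esub> x \<ominus>\<^bsub>P\<^esub> s \<odot>\<^bsub>P\<^esub> x \<in> ideal_smult I P"
      using that by (simp add: minus_eq P.M.minus_eq P.smult_l_distr P.smult_l_minus)
    then show ?thesis using lin_hom_eq_iff_diff_kernel[OF P Q \<pi>] ker that by simp
  qed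
  \<comment> \<open>changing the representative changes the product with \<open>x\<close> by an element of \<open>IP\<close>\<close>
  interpret balanced_map R ?B P Q "\<lambda>Z x. \<pi> (rep Z \<odot>\<^bsub>P\<^esub> x)"
  proof
    fix Y Z x y assume A: "Y \<in> carrier ?B" "Z \<in> carrier ?B" "x \<in> carrier P" "y \<in> carrier P"
    have r: "rep Y \<in> carrier R" "rep Z \<in> carrier R" "cl (rep Y) = Y" "cl (rep Z) = Z"
      using rep[of Y] rep[of Z] A by simp_all
    show "\<pi> (rep Y \<odot>\<^bsub>P\<^esub> x) \<in> carrier Q" using A r by (intro lin_hom_closed[OF \<pi>]) simp
    show "\<pi> (rep Y \<odot>\<^bsub>P\<^esub> (x \<oplus>\<^bsub>P\<^esub> y)) = \<pi> (rep Y \<odot>\<^bsub>P\<^esub> x) \<oplus>\<^bsub>Q\<^esub> \<pi> (rep Y \<odot>\<^bsub>P\<^esub> y)"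
      using A r by (simp add: P.smult_r_distr lin_hom_add[OF \<pi>])
    have "Y \<oplus>\<^bsub>R Quot I\<^esub> Z = cl (rep Y \<oplus>\<^bsub>R\<^esub> rep Z)" using cl_hom(1)[OF r(1,2)] r by simp
    moreover from this have "Y \<oplus>\<^bsub>R Quot I\<^esub> Z \<in> carrier (R Quot I)" using r cl_closed by simp
    ultimately have "\<pi> (rep (Y \<oplus>\<^bsub>R Quot I\<^esub> Z) \<odot>\<^bsub>P\<^esub> x) = \<pi> ((rep Y \<oplus>\<^bsub>R\<^esub> rep Z) \<odot>\<^bsub>P\<^esub> x)"
      using r A rep[of "Y \<oplus>\<^bsub>R Quot I\<^esub> Z"] by (intro eq) simp_all
    then show "\<pi> (rep (Y \<oplus>\<^bsub>?B\<^esub> Z) \<odot>\<^bsub>P\<^esub> x) = \<pi> (rep Y \<odot>\<^bsub>P\<^esub> x) \<oplus>\<^bsub>Q\<^esub> \<pi> (rep Z \<odot>\<^bsub>P\<^esub> x)"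
      using A r by (simp add: P.smult_l_distr lin_hom_add[OF \<pi>])
  next
    fix Z a x assume A: "Z \<in> carrier ?B" "a \<in> carrier R" "x \<in> carrier P"
    have r: "rep Z \<in> carrier R" "cl (rep Z) = Z" using rep[of Z] A by simp_all
    have "Z \<otimes>\<^bsub>R Quot I\<^esub> cl a = cl (rep Z \<otimes>\<^bsub>R\<^esub> a)" using cl_hom(2)[OF r(1) A(2)] r by simp
    moreover from this have "Z \<otimes>\<^bsub>R Quot I\<^esub> cl a \<in> carrier (R Quot I)" using r A cl_closed by simp
    ultimately have "\<pi> (rep (Z \<otimes>\<^bsub>R Quot I\<^esub> cl a) \<odot>\<^bsub>P\<^esub> x) = \<pi> ((rep Z \<otimes>\<^bsub>R\<^esub> a) \<odot>\<^bsub>P\<^esub> x)"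
      using r A rep[of "Z \<otimes>\<^bsub>R Quot I\<^esub> cl a"] by (intro eq) simp_all
    then show "\<pi> (rep (rsmult ?B Z a) \<odot>\<^bsub>P\<^esub> x) = \<pi> (rep Z \<odot>\<^bsub>P\<^esub> (a \<odot>\<^bsub>P\<^esub> x))"
      using A r by (simp add: P.smult_assoc)
  qed
  have "\<pi> (rep (cl \<one>\<^bsub>R\<^esub>) \<odot>\<^bsub>P\<^esub> p) = \<zero>\<^bsub>Q\<^esub>"
    using tensor_lift_pure[of "cl \<one>\<^bsub>R\<^esub>" p] tensor_lift_one t0 p cl_closed by (simp add: unit_tensor_def)
  moreover have "\<pi> (rep (cl \<one>\<^bsub>R\<^esub>) \<odot>\<^bsub>P\<^esub> p) = \<pi> (\<one>\<^bsub>R\<^esub> \<odot>\<^bsub>P\<^esub> p)"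
    using rep[of "cl \<one>\<^bsub>R\<^esub>"] cl_closed p by (intro eq) simp_all
  ultimately show "p \<in> ideal_smult I P" using ker p by simp
qed

lemma tensor_map_unit_tensor:
  assumes P: "left_module R P" and P': "left_module R P'" and h: "h \<in> lin_hom R P P'" and p: "p \<in> carrier P"
  shows "tensor_map R (quotient_bimodule R I) P' h (unit_tensor P p) = unit_tensor P' (h p)"
proof -
  let ?B = "quotient_bimodule R I"
  interpret tensor_pair R ?B P by (rule quotient_tensor_pair[OF P])
  interpret T': tensor_pair R ?B P' by (rule quotient_tensor_pair[OF P'])
  interpret A: abelian_group "tensor_ab R ?B P'" by (rule tensor_ab_abelian_group[OF P'])
  note hc = lin_hom_closed[OF h]
  interpret balanced_map R ?B P "tensor_ab R ?B P'" "\<lambda>x p. T'.pure x (h p)"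
    by standard (use hc T'.pure_closed T'.pure_add_left T'.pure_add_right T'.pure_balanced in
        \<open>simp_all add: lin_hom_add[OF h] lin_hom_smult[OF h] del: quotient_bimodule_simps\<close>)
  show ?thesis
    unfolding tensor_map_def unit_tensor_def by (rule tensor_lift_pure) (use p cl_closed in simp_all)
qed

lemma quotient_mult_unit_tensor:
  assumes p: "p \<in> carrier (obj (stalk_complex (quotient_left R I)) n)"
  shows "quotient_mult R I (unit_tensor (obj (stalk_complex (quotient_left R I)) n) p) = p"
proof -
  let ?B = "quotient_bimodule R I" and ?P = "obj (stalk_complex (quotient_left R I)) n"
  have P: "left_module R ?P" by (rule stalk_obj_left_module[OF quotient_left_module(1)])
  interpret Q: ring "R Quot I" by (rule quotient_is_ring)
  interpret tensor_pair R ?B ?P by (rule quotient_tensor_pair[OF P])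
  have Pc: "x \<in> carrier (R Quot I)" if "x \<in> carrier ?P" for x
    using that by (cases "n = 0") simp_all
  have Pa: "x \<oplus>\<^bsub>?P\<^esub> y = x \<oplus>\<^bsub>R Quot I\<^esub> y" "a \<odot>\<^bsub>?P\<^esub> x = cl a \<otimes>\<^bsub>R Quot I\<^esub> x" for x y a
    by (cases "n = 0"; simp)+
  interpret balanced_map R ?B ?P "R Quot I" "\<lambda>Z Y. Z \<otimes>\<^bsub>R Quot I\<^esub> Y"
    by standard (use Pc cl_closed in \<open>simp_all add: Pa Q.l_distr Q.r_distr Q.m_assoc\<close>)
  have "quotient_mult R I (unit_tensor ?P p) = cl \<one>\<^bsub>R\<^esub> \<otimes>\<^bsub>R Quot I\<^esub> p"
    unfolding quotient_mult_def unit_tensor_def by (rule tensor_lift_pure) (use p cl_closed in simp_all)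
  then show ?thesis using Pc[OF p] by (simp add: cl_hom(3))
qed

end

section \<open>Extending and lifting homomorphisms\<close>

text \<open>
  Two descriptions of the vanishing of \<open>Ext\<^sup>1\<close>. If \<open>P\<close> is projective, \<open>hom_extends\<close> says that
  \<open>Ext\<^sup>1(P / K, N) = 0\<close>; if \<open>I\<close> is injective and \<open>\<pi>\<close> maps it onto \<open>C\<close> with kernel \<open>N\<close>, \<open>hom_lifts\<close> says
  that \<open>Ext\<^sup>1(M, N) = 0\<close>.
\<close>

definition hom_extends ::
  "('a, 'r) ring_scheme \<Rightarrow> 'p set \<Rightarrow> ('a, 'p) module \<Rightarrow> ('a, 'n) module \<Rightarrow> bool"
  where "hom_extends R K P N \<longleftrightarrow>
    (\<forall>h\<in>lin_hom R (P\<lparr>carrier := K\<rparr>) N. \<exists>g\<in>lin_hom R P N. \<forall>x\<in>K. g x = h x)"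

definition hom_lifts ::
  "('a, 'r) ring_scheme \<Rightarrow> ('a, 'p) module \<Rightarrow> ('i \<Rightarrow> 'n) \<Rightarrow> ('a, 'i) module \<Rightarrow> ('a, 'n) module \<Rightarrow> bool"
  where "hom_lifts R M \<pi> I C \<longleftrightarrow>
    (\<forall>h\<in>lin_hom R M C. \<exists>g\<in>lin_hom R M I. \<forall>x\<in>carrier M. \<pi> (g x) = h x)"

lemma injective_module_extends_submodule:
  fixes P I :: "('a, 'm) module"
  assumes I: "injective_module R I" and P: "left_module R P" and K: "submodule K R P"
    and h: "h \<in> lin_hom R (P\<lparr>carrier := K\<rparr>) I"
  obtains e where "e \<in> lin_hom R P I" "\<forall>x\<in>K. e x = h x"
proof -
  obtain e where "e \<in> lin_hom R P I" "\<forall>x\<in>carrier (P\<lparr>carrier := K\<rparr>). e x = h x"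
    by (rule injective_module_extends[OF I submodule_left_module[OF P K] P lin_hom_inclusion[OF submodule_subset[OF K]] _ h])
      (simp_all add: inj_on_def that)
  then show ?thesis by (intro that) simp_all
qed

text \<open>
  Both conditions say that every homomorphism \<open>K \<rightarrow> C\<close> is the restriction to \<open>K\<close> of \<open>\<pi> e\<close> for some
  \<open>e : P \<rightarrow> I\<close>: homomorphisms \<open>P \<rightarrow> C\<close> lift to \<open>I\<close> as \<open>P\<close> is projective, and homomorphisms \<open>K \<rightarrow> I\<close> extend
  to \<open>P\<close> as \<open>I\<close> is injective. This is the isomorphism
  \<open>Ext\<^sup>1(P / K, C) \<cong> Ext\<^sup>1(K, N)\<close>, both being \<open>Ext\<^sup>2(P / K, N)\<close> for the kernel \<open>N\<close> of \<open>\<pi>\<close>.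
\<close>

lemma hom_extends_iff_lifts:
  fixes P I C :: "('a, 'm) module"
  assumes P: "projective_module R P" and K: "submodule K R P"
    and I: "injective_module R I" and C: "left_module R C"
    and \<pi>: "\<pi> \<in> lin_hom R I C" and \<pi>_surj: "\<pi> ` carrier I = carrier C"
  shows "hom_extends R K P C \<longleftrightarrow> hom_lifts R (P\<lparr>carrier := K\<rparr>) \<pi> I C"
proof
  note Pm = projective_module_left_module[OF P] and Im = injective_module_left_module[OF I]
  note sub = submodule_subset[OF K]
  assume X: "hom_extends R K P C"
  show "hom_lifts R (P\<lparr>carrier := K\<rparr>) \<pi> I C"
    unfolding hom_lifts_def
  proof
    fix h assume h: "h \<in> lin_hom R (P\<lparr>carrier := K\<rparr>) C"
    obtain g where g: "g \<in> lin_hom R P C" "\<forall>x\<in>K. g x = h x"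
      using X h unfolding hom_extends_def by blast
    obtain e where e: "e \<in> lin_hom R P I" "\<forall>x\<in>carrier P. \<pi> (e x) = g x"
      by (rule projective_module_lifts[OF P Im C \<pi> \<pi>_surj g(1)]) (rule that)
    show "\<exists>g\<in>lin_hom R (P\<lparr>carrier := K\<rparr>) I. \<forall>x\<in>carrier (P\<lparr>carrier := K\<rparr>). \<pi> (g x) = h x"
      by (rule bexI[OF _ lin_hom_restrict_dom[OF e(1) sub]]) (use e(2) g(2) sub in auto)
  qed
next
  note Pm = projective_module_left_module[OF P] and Im = injective_module_left_module[OF I]
  assume L: "hom_lifts R (P\<lparr>carrier := K\<rparr>) \<pi> I C"
  show "hom_extends R K P C"
    unfolding hom_extends_def
  proof
    fix h assume h: "h \<in> lin_hom R (P\<lparr>carrier := K\<rparr>) C"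
    from bspec[OF L[unfolded hom_lifts_def] h]
    obtain g where g: "g \<in> lin_hom R (P\<lparr>carrier := K\<rparr>) I" "\<forall>x\<in>K. \<pi> (g x) = h x" by auto
    obtain e where e: "e \<in> lin_hom R P I" "\<forall>x\<in>K. e x = g x"
      by (rule injective_module_extends_submodule[OF I Pm K g(1)]) (rule that)
    show "\<exists>g\<in>lin_hom R P C. \<forall>x\<in>K. g x = h x"
      by (rule bexI[OF _ lin_hom_comp[OF e(1) \<pi>]]) (use e(2) g(2) in simp)
  qed
qed

text \<open>
  Balancing of \<open>Ext\<^sup>1\<close>. A homomorphism \<open>e : P \<rightarrow> I\<close> that maps the kernel \<open>K\<close> of \<open>p\<close> to the kernel \<open>N\<close> of \<open>\<pi>\<close>
  induces maps \<open>K \<rightarrow> N\<close> and \<open>M \<rightarrow> C\<close>, and every map of either kind arises in this way. If one of the two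
  can be lifted or extended, subtracting the result from \<open>e\<close> solves the problem for the other.
\<close>

lemma hom_lifts_iff_extends:
  fixes P I C :: "('a, 'm) module" and M :: "('a, 'b) module"
  assumes P: "projective_module R P" and M: "left_module R M"
    and p: "p \<in> lin_hom R P M" and p_surj: "p ` carrier P = carrier M"
    and I: "injective_module R I" and C: "left_module R C"
    and \<pi>: "\<pi> \<in> lin_hom R I C" and \<pi>_surj: "\<pi> ` carrier I = carrier C"
  shows "hom_lifts R M \<pi> I C \<longleftrightarrow>
    hom_extends R (lin_kernel P M p) P (I\<lparr>carrier := lin_kernel I C \<pi>\<rparr>)"
proof -
  let ?K = "lin_kernel P M p" and ?N = "lin_kernel I C \<pi>"
  note Pm = projective_module_left_module[OF P] and Im = injective_module_left_module[OF I]
  have K: "submodule ?K R P" by (rule lin_kernel_submodule[OF Pm M p])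
  have N: "submodule ?N R I" by (rule lin_kernel_submodule[OF Im C \<pi>])
  note K_sub = submodule_subset[OF K] and N_sub = submodule_subset[OF N]
  interpret I: left_module R I by (rule Im)
  interpret C: left_module R C by (rule C)
  show ?thesis
  proof
    assume L: "hom_lifts R M \<pi> I C"
    show "hom_extends R ?K P (I\<lparr>carrier := ?N\<rparr>)"
      unfolding hom_extends_def
    proof
      fix h assume h: "h \<in> lin_hom R (P\<lparr>carrier := ?K\<rparr>) (I\<lparr>carrier := ?N\<rparr>)"
      have hN: "h x \<in> ?N" if "x \<in> ?K" for x using lin_hom_closed[OF h, of x] that by simp
      obtain e where e: "e \<in> lin_hom R P I" "\<forall>x\<in>?K. e x = h x"
        by (rule injective_module_extends_submodule[OF I Pm K lin_hom_extend_cod[OF h N_sub]]) (rule that)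
      have "\<pi> (e x) = \<zero>\<^bsub>C\<^esub>" if "x \<in> carrier P" "p x = \<zero>\<^bsub>M\<^esub>" for x
        using hN[of x] e(2) that by (simp add: lin_kernel_def)
      from lin_hom_factor[OF Pm M C p p_surj lin_hom_comp[OF e(1) \<pi>] this]
      obtain q where q: "q \<in> lin_hom R M C" "\<forall>x\<in>carrier P. q (p x) = \<pi> (e x)" by blast
      obtain g where g: "g \<in> lin_hom R M I" "\<forall>y\<in>carrier M. \<pi> (g y) = q y"
        using L q(1) unfolding hom_lifts_def by blast
      have gp: "(\<lambda>x. g (p x)) \<in> lin_hom R P I" by (rule lin_hom_comp[OF p g(1)])
      let ?f = "\<lambda>x. e x \<ominus>\<^bsub>I\<^esub> g (p x)"
      have f: "?f \<in> lin_hom R P I" by (rule lin_hom_subtract[OF Pm Im e(1) gp])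
      have "?f x \<in> ?N" if x: "x \<in> carrier P" for x
      proof -
        have cl: "e x \<in> carrier I" "g (p x) \<in> carrier I" "p x \<in> carrier M" "\<pi> (e x) \<in> carrier C"
          using x lin_hom_closed[OF e(1)] lin_hom_closed[OF gp] lin_hom_closed[OF p]
            lin_hom_closed[OF lin_hom_comp[OF e(1) \<pi>]] by simp_all
        have "\<pi> (?f x) = \<zero>\<^bsub>C\<^esub>"
          using lin_hom_diff[OF Im C \<pi> cl(1,2)] g(2) q(2) cl x by simp
        then show ?thesis using lin_hom_closed[OF f x] by (simp add: lin_kernel_def)
      qed
      then have "?f \<in> lin_hom R P (I\<lparr>carrier := ?N\<rparr>)" by (rule lin_hom_restrict_cod[OF f])
      moreover have "?f x = h x" if x: "x \<in> ?K" for x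
      proof -
        have "p x = \<zero>\<^bsub>M\<^esub>" using x by (simp add: lin_kernel_def)
        then have "g (p x) = \<zero>\<^bsub>I\<^esub>" using lin_hom_zero[OF M Im g(1)] by simp
        moreover have "h x \<in> carrier I" using hN[OF x] N_sub by blast
        ultimately show ?thesis using e(2) x by simp
      qed
      ultimately show "\<exists>g\<in>lin_hom R P (I\<lparr>carrier := ?N\<rparr>). \<forall>x\<in>?K. g x = h x" by (intro bexI[of _ ?f]) simp_all
    qed
  next
    assume X: "hom_extends R ?K P (I\<lparr>carrier := ?N\<rparr>)"
    show "hom_lifts R M \<pi> I C"
      unfolding hom_lifts_def
    proof
      fix h assume h: "h \<in> lin_hom R M C"
      have hp: "(\<lambda>x. h (p x)) \<in> lin_hom R P C" by (rule lin_hom_comp[OF p h])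
      obtain e where e: "e \<in> lin_hom R P I" "\<forall>x\<in>carrier P. \<pi> (e x) = h (p x)"
        by (rule projective_module_lifts[OF P Im C \<pi> \<pi>_surj hp]) (rule that)
      have "e x \<in> ?N" if "x \<in> carrier (P\<lparr>carrier := ?K\<rparr>)" for x
      proof -
        have x: "x \<in> carrier P" "p x = \<zero>\<^bsub>M\<^esub>" using that by (simp_all add: lin_kernel_def)
        then have "\<pi> (e x) = \<zero>\<^bsub>C\<^esub>" using e(2) lin_hom_zero[OF M C h] by simp
        then show ?thesis using lin_hom_closed[OF e(1) x(1)] by (simp add: lin_kernel_def)
      qed
      then have "e \<in> lin_hom R (P\<lparr>carrier := ?K\<rparr>) (I\<lparr>carrier := ?N\<rparr>)"
        by (rule lin_hom_restrict_cod[OF lin_hom_restrict_dom[OF e(1) K_sub]])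
      then obtain g where g: "g \<in> lin_hom R P (I\<lparr>carrier := ?N\<rparr>)" "\<forall>x\<in>?K. g x = e x"
        using X unfolding hom_extends_def by blast
      have gI: "g \<in> lin_hom R P I" by (rule lin_hom_extend_cod[OF g(1) N_sub])
      have gN: "\<pi> (g x) = \<zero>\<^bsub>C\<^esub>" if "x \<in> carrier P" for x
        using lin_hom_closed[OF g(1) that] by (simp add: lin_kernel_def)
      have f: "(\<lambda>x. e x \<ominus>\<^bsub>I\<^esub> g x) \<in> lin_hom R P I" by (rule lin_hom_subtract[OF Pm Im e(1) gI])
      have "e x \<ominus>\<^bsub>I\<^esub> g x = \<zero>\<^bsub>I\<^esub>" if x: "x \<in> carrier P" "p x = \<zero>\<^bsub>M\<^esub>" for x
        using g(2) x lin_hom_closed[OF e(1) x(1)] by (simp add: lin_kernel_def)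
      from lin_hom_factor[OF Pm M Im p p_surj f this]
      obtain q where q: "q \<in> lin_hom R M I" "\<forall>x\<in>carrier P. q (p x) = e x \<ominus>\<^bsub>I\<^esub> g x" by blast
      have "\<pi> (q y) = h y" if y: "y \<in> carrier M" for y
      proof -
        obtain x where x: "x \<in> carrier P" "y = p x" using p_surj y by blast
        have "\<pi> (q y) = \<pi> (e x) \<ominus>\<^bsub>C\<^esub> \<pi> (g x)"
          using q(2) x lin_hom_diff[OF Im C \<pi> lin_hom_closed[OF e(1) x(1)] lin_hom_closed[OF gI x(1)]] by simp
        also have "\<dots> = h y" using gN[OF x(1)] e(2) x lin_hom_closed[OF hp x(1)] by simp
        finally show ?thesis .
      qed
      then show "\<exists>g\<in>lin_hom R M I. \<forall>x\<in>carrier M. \<pi> (g x) = h x" by (intro bexI[OF _ q(1)]) simp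
    qed
  qed
qed

lemma hom_extends_iso:
  assumes N: "left_module R N" and N': "left_module R N'"
    and f: "f \<in> lin_hom R N N'" and inj: "inj_on f (carrier N)" and surj: "f ` carrier N = carrier N'"
    and P: "left_module R P" and K: "submodule K R P"
  shows "hom_extends R K P N \<longleftrightarrow> hom_extends R K P N'"
proof -
  obtain g where g: "g \<in> lin_hom R N' N" "\<forall>x\<in>carrier N. g (f x) = x" "\<forall>y\<in>carrier N'. f (g y) = y"
    by (rule lin_hom_inverse[OF N N' f inj surj]) (rule that)
  show ?thesis
  proof
    assume X: "hom_extends R K P N"
    show "hom_extends R K P N'"
      unfolding hom_extends_def
    proof
      fix h assume h: "h \<in> lin_hom R (P\<lparr>carrier := K\<rparr>) N'"
      obtain k where k: "k \<in> lin_hom R P N" "\<forall>x\<in>K. k x = g (h x)"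
        using bspec[OF X[unfolded hom_extends_def] lin_hom_comp[OF h g(1)]] by blast
      show "\<exists>g\<in>lin_hom R P N'. \<forall>x\<in>K. g x = h x"
        by (rule bexI[OF _ lin_hom_comp[OF k(1) f]]) (use k(2) g(3) lin_hom_closed[OF h] in simp)
    qed
  next
    assume X: "hom_extends R K P N'"
    show "hom_extends R K P N"
      unfolding hom_extends_def
    proof
      fix h assume h: "h \<in> lin_hom R (P\<lparr>carrier := K\<rparr>) N"
      obtain k where k: "k \<in> lin_hom R P N'" "\<forall>x\<in>K. k x = f (h x)"
        using bspec[OF X[unfolded hom_extends_def] lin_hom_comp[OF h f]] by blast
      show "\<exists>g\<in>lin_hom R P N. \<forall>x\<in>K. g x = h x"
        by (rule bexI[OF _ lin_hom_comp[OF k(1) g(1)]]) (use k(2) g(2) lin_hom_closed[OF h] in simp)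
    qed
  qed
qed

section \<open>Annihilated submodules\<close>

definition annihilated :: "'a set \<Rightarrow> ('a, 'm, 's) module_scheme \<Rightarrow> 'm set"
  where "annihilated \<aa> M = {m \<in> carrier M. \<forall>a\<in>\<aa>. a \<odot>\<^bsub>M\<^esub> m = \<zero>\<^bsub>M\<^esub>}"

lemma annihilated_submodule:
  assumes M: "left_module R M" and \<aa>: "ideal \<aa> R"
  shows "submodule (annihilated \<aa> M) R M"
proof -
  interpret M: left_module R M by fact
  interpret ideal \<aa> R by fact
  show ?thesis
  proof (rule M.submoduleI)
    fix r x assume r: "r \<in> carrier R" and x: "x \<in> annihilated \<aa> M"
    have "a \<odot>\<^bsub>M\<^esub> (r \<odot>\<^bsub>M\<^esub> x) = \<zero>\<^bsub>M\<^esub>" if a: "a \<in> \<aa>" for a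
      using I_r_closed[OF a r] x r Icarr[OF a] M.smult_assoc[of a r x] by (simp add: annihilated_def)
    then show "r \<odot>\<^bsub>M\<^esub> x \<in> annihilated \<aa> M" using r x by (simp add: annihilated_def)
  qed (auto simp: annihilated_def M.smult_r_distr Icarr)
qed

lemma hom_annihilates_ideal_smult:
  assumes M: "left_module R M" and N: "left_module R N" and \<aa>: "ideal \<aa> R"
    and h: "h \<in> lin_hom R M N" and ann: "\<And>x. x \<in> carrier M \<Longrightarrow> h x \<in> annihilated \<aa> N"
    and x: "x \<in> ideal_smult \<aa> M"
  shows "h x = \<zero>\<^bsub>N\<^esub>"
  using x
proof induction
  case (smult a x)
  then show ?case
    using ann[OF smult(2)] lin_hom_smult[OF h ideal.Icarr[OF \<aa> smult(1)] smult(2)] by (simp add: annihilated_def)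
next
  case (add x y)
  interpret N: left_module R N by fact
  note sub = subsetD[OF submodule_subset[OF ideal_smult_submodule[OF M \<aa>]]]
  show ?case using add lin_hom_add[OF h sub[OF add(1)] sub[OF add(2)]] by simp
qed

text \<open>
  For a submodule \<open>K\<close> this is injectivity of \<open>K / \<aa>K \<rightarrow> P / \<aa>P\<close>; if \<open>P\<close> is projective, it means that
  the first \<open>Tor\<close> group of the quotient ring and \<open>P / K\<close> vanishes.
\<close>

definition relatively_pure :: "'a set \<Rightarrow> 'p set \<Rightarrow> ('a, 'p) module \<Rightarrow> bool"
  where "relatively_pure \<aa> K P \<longleftrightarrow> K \<inter> ideal_smult \<aa> P \<subseteq> ideal_smult \<aa> (P\<lparr>carrier := K\<rparr>)"

text \<open>
  A homomorphism from \<open>K\<close> to the part of \<open>E\<close> killed by \<open>\<aa>\<close> vanishes on \<open>\<aa>K\<close>, which contains the kernel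
  of \<open>K \<rightarrow> P / \<aa>P\<close> by assumption; so it factors through the image of \<open>K\<close> in \<open>P / \<aa>P\<close> and extends from
  there by injectivity. Being defined on \<open>P / \<aa>P\<close>, the extension has values killed by \<open>\<aa>\<close>.
\<close>

lemma relatively_pure_imp_hom_extends:
  fixes P E :: "('a, 'm) module"
  assumes P: "left_module R P" and K: "submodule K R P" and \<aa>: "ideal \<aa> R"
    and pure: "relatively_pure \<aa> K P" and E: "injective_module R E"
  shows "hom_extends R K P (E\<lparr>carrier := annihilated \<aa> E\<rparr>)"
  unfolding hom_extends_def
proof
  let ?G = "E\<lparr>carrier := annihilated \<aa> E\<rparr>" and ?K = "P\<lparr>carrier := K\<rparr>"
  note Em = injective_module_left_module[OF E]
  note Km = submodule_left_module[OF P K] and K_sub = submodule_subset[OF K]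
  note G_sub = submodule_subset[OF annihilated_submodule[OF Em \<aa>]]
  interpret E: left_module R E by (rule Em)
  fix h assume h: "h \<in> lin_hom R ?K ?G"
  have hE: "h \<in> lin_hom R ?K E" by (rule lin_hom_extend_cod[OF h G_sub])
  obtain Q :: "('a, 'm) module" and q where Q: "left_module R Q" and q: "q \<in> lin_hom R P Q"
    and "q ` carrier P = carrier Q" and q_ker: "\<forall>x\<in>carrier P. q x = \<zero>\<^bsub>Q\<^esub> \<longleftrightarrow> x \<in> ideal_smult \<aa> P"
    by (rule quotient_exists[OF P ideal_smult_submodule[OF P \<aa>]]) (rule that)
  let ?K' = "q ` K"
  have K': "submodule ?K' R Q" by (rule lin_hom_image_submodule[OF P Q q K])
  have qK: "q \<in> lin_hom R ?K (Q\<lparr>carrier := ?K'\<rparr>)"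
    by (rule lin_hom_restrict_cod[OF lin_hom_restrict_dom[OF q K_sub]]) simp
  have van: "h x = \<zero>\<^bsub>E\<^esub>" if "x \<in> carrier ?K" "q x = \<zero>\<^bsub>Q\<lparr>carrier := ?K'\<rparr>\<^esub>" for x
  proof -
    have "x \<in> K" "x \<in> ideal_smult \<aa> P" using that q_ker K_sub by auto
    then have "x \<in> ideal_smult \<aa> ?K" using pure unfolding relatively_pure_def by blast
    then show ?thesis
      by (rule hom_annihilates_ideal_smult[OF Km Em \<aa> hE, rotated]) (use lin_hom_closed[OF h] in simp)
  qed
  have surj: "q ` carrier ?K = carrier (Q\<lparr>carrier := ?K'\<rparr>)" by simp
  from lin_hom_factor[OF Km submodule_left_module[OF Q K'] Em qK surj hE van]
  obtain h' where h': "h' \<in> lin_hom R (Q\<lparr>carrier := ?K'\<rparr>) E" "\<forall>x\<in>K. h' (q x) = h x" by auto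
  obtain g where g: "g \<in> lin_hom R Q E" "\<forall>y\<in>?K'. g y = h' y"
    by (rule injective_module_extends_submodule[OF E Q K' h'(1)]) (rule that)
  have gq: "(\<lambda>x. g (q x)) \<in> lin_hom R P E" by (rule lin_hom_comp[OF q g(1)])
  have "g (q x) \<in> annihilated \<aa> E" if x: "x \<in> carrier P" for x
  proof -
    have "a \<odot>\<^bsub>E\<^esub> g (q x) = \<zero>\<^bsub>E\<^esub>" if a: "a \<in> \<aa>" for a
    proof -
      have aR: "a \<in> carrier R" by (rule ideal.Icarr[OF \<aa> a])
      have "q (a \<odot>\<^bsub>P\<^esub> x) = \<zero>\<^bsub>Q\<^esub>"
        using ideal_smult.smult[OF a x] q_ker left_module.smult_closed[OF P aR x] by simp
      then show ?thesis using lin_hom_smult[OF gq aR x] lin_hom_zero[OF Q Em g(1)] by simp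
    qed
    then show ?thesis using lin_hom_closed[OF gq x] by (simp add: annihilated_def)
  qed
  then have "(\<lambda>x. g (q x)) \<in> lin_hom R P ?G" by (rule lin_hom_restrict_cod[OF gq])
  then show "\<exists>g\<in>lin_hom R P ?G. \<forall>x\<in>K. g x = h x" by (rule bexI[rotated]) (use g(2) h'(2) in simp)
qed

text \<open>
  Embed \<open>K / \<aa>K\<close> into an injective module \<open>E\<close>. The resulting homomorphism from \<open>K\<close> has kernel \<open>\<aa>K\<close>, and its
  extension to \<open>P\<close> kills \<open>\<aa>P\<close>.
\<close>

lemma hom_extends_imp_relatively_pure:
  fixes P :: "('a, 'm) module"
  assumes U: "module_universe TYPE('a) TYPE('m)"
    and P: "left_module R P" and K: "submodule K R P" and \<aa>: "ideal \<aa> R"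
    and ext: "\<And>E :: ('a, 'm) module. injective_module R E \<Longrightarrow>
      hom_extends R K P (E\<lparr>carrier := annihilated \<aa> E\<rparr>)"
  shows "relatively_pure \<aa> K P"
  unfolding relatively_pure_def
proof
  let ?K = "P\<lparr>carrier := K\<rparr>"
  note Km = submodule_left_module[OF P K] and K_sub = submodule_subset[OF K]
  obtain Q :: "('a, 'm) module" and q where Q: "left_module R Q" and q: "q \<in> lin_hom R ?K Q"
    and "q ` carrier ?K = carrier Q" and q_ker: "\<forall>x\<in>carrier ?K. q x = \<zero>\<^bsub>Q\<^esub> \<longleftrightarrow> x \<in> ideal_smult \<aa> ?K"
    by (rule quotient_exists[OF Km ideal_smult_submodule[OF Km \<aa>]]) (rule that)
  obtain E :: "('a, 'm) module" and \<iota> where E: "injective_module R E" and \<iota>: "\<iota> \<in> lin_hom R Q E"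
    and inj: "inj_on \<iota> (carrier Q)" by (rule enough_injectives[OF U Q]) (rule that)
  note Em = injective_module_left_module[OF E]
  interpret Q: left_module R Q by (rule Q)
  let ?G = "E\<lparr>carrier := annihilated \<aa> E\<rparr>"
  note G_sub = submodule_subset[OF annihilated_submodule[OF Em \<aa>]]
  have \<iota>q: "(\<lambda>x. \<iota> (q x)) \<in> lin_hom R ?K E" by (rule lin_hom_comp[OF q \<iota>])
  have "\<iota> (q x) \<in> annihilated \<aa> E" if x: "x \<in> carrier ?K" for x
  proof -
    have "a \<odot>\<^bsub>E\<^esub> \<iota> (q x) = \<zero>\<^bsub>E\<^esub>" if a: "a \<in> \<aa>" for a
    proof -
      have aR: "a \<in> carrier R" by (rule ideal.Icarr[OF \<aa> a])
      have "q (a \<odot>\<^bsub>?K\<^esub> x) = \<zero>\<^bsub>Q\<^esub>"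
        using ideal_smult.smult[OF a x] q_ker left_module.smult_closed[OF Km aR x] by simp
      then show ?thesis using lin_hom_smult[OF \<iota>q aR x] lin_hom_zero[OF Q Em \<iota>] by simp
    qed
    then show ?thesis using lin_hom_closed[OF \<iota>q x] by (simp add: annihilated_def)
  qed
  then have "(\<lambda>x. \<iota> (q x)) \<in> lin_hom R ?K ?G" by (rule lin_hom_restrict_cod[OF \<iota>q])
  from bspec[OF ext[OF E, unfolded hom_extends_def] this]
  obtain g where g: "g \<in> lin_hom R P ?G" "\<forall>x\<in>K. g x = \<iota> (q x)" by blast
  have gE: "g \<in> lin_hom R P E" by (rule lin_hom_extend_cod[OF g(1) G_sub])
  fix x assume x: "x \<in> K \<inter> ideal_smult \<aa> P"
  then have "g x = \<zero>\<^bsub>E\<^esub>"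
    by (intro hom_annihilates_ideal_smult[OF P Em \<aa> gE]) (use lin_hom_closed[OF g(1)] in simp_all)
  then have "\<iota> (q x) = \<iota> \<zero>\<^bsub>Q\<^esub>" using g(2) x lin_hom_zero[OF Q Em \<iota>] by simp
  then have "q x = \<zero>\<^bsub>Q\<^esub>"
    using inj_on_eq_iff[OF inj, of "q x" "\<zero>\<^bsub>Q\<^esub>"] lin_hom_closed[OF q, of x] x by simp
  then show "x \<in> ideal_smult \<aa> ?K" using q_ker x by simp
qed

section \<open>Dimension shifting\<close>

text \<open>
  A projective resolution lives in degrees \<open>\<le> 0\<close>. Its \<open>k\<close>-th syzygy is a submodule of the term in
  degree \<open>-k\<close>, namely the image of the next term; so syzygy 0 is the kernel of the augmentation. The
  cocycles of an injective resolution serve as cosyzygies; number 0 is isomorphic to the resolved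
  module.
\<close>

abbreviation proj_term :: "('a, 'm) cochain \<Rightarrow> nat \<Rightarrow> ('a, 'm) module"
  where "proj_term P k \<equiv> obj P (- int k)"

abbreviation syzygy :: "('a, 'm) cochain \<Rightarrow> nat \<Rightarrow> 'm set"
  where "syzygy P k \<equiv> coboundaries P (- int k)"

abbreviation cosyzygy :: "('a, 'm) cochain \<Rightarrow> nat \<Rightarrow> ('a, 'm) module"
  where "cosyzygy I n \<equiv> (obj I (int n))\<lparr>carrier := cocycles I (int n)\<rparr>"

lemma cosyzygy_facts:
  assumes N: "left_module R N" and I: "injective_resolution R N I \<eta>"
  shows "left_module R (cosyzygy I n)"
    and "diff I (int n) \<in> lin_hom R (obj I (int n)) (cosyzygy I (Suc n))"
    and "diff I (int n) ` carrier (obj I (int n)) = carrier (cosyzygy I (Suc n))"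
    and "lin_kernel (obj I (int n)) (cosyzygy I (Suc n)) (diff I (int n)) = cocycles I (int n)"
proof -
  note cpx = injective_resolutionD(1)[OF N I]
  have e: "int (Suc n) = int n + 1" by simp
  show "left_module R (cosyzygy I n)" by (rule submodule_left_module[OF is_complexD(1)[OF cpx] cocycles_submodule[OF cpx]])
  have ZB: "cocycles I (int (Suc n)) = diff I (int n) ` carrier (obj I (int n))"
    using injective_resolutionD(6)[OF N I, of "int (Suc n)"] by (simp add: coboundaries_def)
  show "diff I (int n) ` carrier (obj I (int n)) = carrier (cosyzygy I (Suc n))" using ZB by simp
  show "diff I (int n) \<in> lin_hom R (obj I (int n)) (cosyzygy I (Suc n))"
    by (rule lin_hom_restrict_cod) (use is_complexD(2)[OF cpx, of "int n"] ZB in \<open>auto simp: add.commute\<close>)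
  show "lin_kernel (obj I (int n)) (cosyzygy I (Suc n)) (diff I (int n)) = cocycles I (int n)"
    by (simp add: cocycles_def lin_kernel_def add.commute)
qed

lemma syzygy_facts:
  fixes P :: "('a, 'm) cochain" and M :: "('a, 'b) module"
  assumes M: "left_module R M" and P: "projective_resolution R M P \<epsilon>"
  shows "left_module R (proj_term P k)"
    and "submodule (syzygy P k) R (proj_term P k)"
    and "left_module R ((proj_term P k)\<lparr>carrier := syzygy P k\<rparr>)"
    and "diff P (- int (Suc k)) \<in> lin_hom R (proj_term P (Suc k)) ((proj_term P k)\<lparr>carrier := syzygy P k\<rparr>)"
    and "diff P (- int (Suc k)) ` carrier (proj_term P (Suc k)) = syzygy P k"
    and "lin_kernel (proj_term P (Suc k)) ((proj_term P k)\<lparr>carrier := syzygy P k\<rparr>) (diff P (- int (Suc k))) = syzygy P (Suc k)"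
proof -
  note cpx = projective_resolutionD(1)[OF M P]
  have e: "- int k - 1 = - int (Suc k)" "- int (Suc k) + 1 = - int k" by simp_all
  show Pk: "left_module R (proj_term P k)" by (rule is_complexD(1)[OF cpx])
  show S: "submodule (syzygy P k) R (proj_term P k)" by (rule coboundaries_submodule[OF cpx])
  show "left_module R ((proj_term P k)\<lparr>carrier := syzygy P k\<rparr>)" by (rule submodule_left_module[OF Pk S])
  show im: "diff P (- int (Suc k)) ` carrier (proj_term P (Suc k)) = syzygy P k"
    unfolding coboundaries_def e ..
  show "diff P (- int (Suc k)) \<in> lin_hom R (proj_term P (Suc k)) ((proj_term P k)\<lparr>carrier := syzygy P k\<rparr>)"
    by (rule lin_hom_restrict_cod) (use is_complexD(2)[OF cpx, of "- int (Suc k)"] im[symmetric] e in auto)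
  have "cocycles P (- int (Suc k)) = syzygy P (Suc k)"
    by (rule projective_resolutionD(8)[OF M P]) simp
  moreover have "lin_kernel (proj_term P (Suc k)) ((proj_term P k)\<lparr>carrier := syzygy P k\<rparr>) (diff P (- int (Suc k))) = cocycles P (- int (Suc k))"
    unfolding cocycles_def e by (simp add: lin_kernel_def)
  ultimately show "lin_kernel (proj_term P (Suc k)) ((proj_term P k)\<lparr>carrier := syzygy P k\<rparr>) (diff P (- int (Suc k))) = syzygy P (Suc k)"
    by simp
qed

text \<open>
  One step down in both resolutions: pass from extension to lifting, and back to extension with the
  next syzygy in place of the quotient.
\<close>

lemma hom_extends_shift:
  fixes P I :: "('a, 'm) cochain" and M :: "('a, 'b) module"
  assumes M: "left_module R M" and P: "projective_resolution R M P \<epsilon>"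
    and N: "left_module R N" and I: "injective_resolution R N I \<eta>"
  shows "hom_extends R (syzygy P k) (proj_term P k) (cosyzygy I (Suc n)) \<longleftrightarrow>
    hom_extends R (syzygy P (Suc k)) (proj_term P (Suc k)) (cosyzygy I n)"
proof -
  note s = syzygy_facts[OF M P] and c = cosyzygy_facts[OF N I]
  note proj = projective_resolutionD(2)[OF M P] and inj = injective_resolutionD(2)[OF N I]
  have "hom_extends R (syzygy P k) (proj_term P k) (cosyzygy I (Suc n)) \<longleftrightarrow>
    hom_lifts R ((proj_term P k)\<lparr>carrier := syzygy P k\<rparr>) (diff I (int n)) (obj I (int n)) (cosyzygy I (Suc n))"
    by (rule hom_extends_iff_lifts[OF proj s(2) inj c(1) c(2) c(3)])
  also have "\<dots> \<longleftrightarrow> hom_extends R (syzygy P (Suc k)) (proj_term P (Suc k)) (cosyzygy I n)"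
    using hom_lifts_iff_extends[OF proj s(3) s(4) _ inj c(1) c(2) c(3), of k n] s(5)[of k]
    unfolding s(6) c(4) by simp
  finally show ?thesis .
qed

lemma hom_extends_shift_all:
  fixes P I :: "('a, 'm) cochain" and M :: "('a, 'b) module"
  assumes M: "left_module R M" and P: "projective_resolution R M P \<epsilon>"
    and N: "left_module R N" and I: "injective_resolution R N I \<eta>"
  shows "hom_extends R (syzygy P k) (proj_term P k) (cosyzygy I n) \<longleftrightarrow>
    hom_extends R (syzygy P (k + n)) (proj_term P (k + n)) N"
proof (induction n arbitrary: k)
  case 0
  note cpx = injective_resolutionD(1)[OF N I]
  have f: "\<eta> 0 \<in> lin_hom R N (cosyzygy I 0)"
    by (rule lin_hom_restrict_cod) (use injective_resolutionD(3,5)[OF N I] in auto)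
  have "hom_extends R (syzygy P k) (proj_term P k) N \<longleftrightarrow> hom_extends R (syzygy P k) (proj_term P k) (cosyzygy I 0)"
    by (rule hom_extends_iso[OF N cosyzygy_facts(1)[OF N I] f injective_resolutionD(4)[OF N I] _ syzygy_facts(1,2)[OF M P]])
      (use injective_resolutionD(5)[OF N I] in simp)
  then show ?case by simp
next
  case (Suc n)
  show ?case using hom_extends_shift[OF M P N I, of k n] Suc.IH[of "Suc k"] by simp
qed

text \<open>
  A homomorphism from the quotient ring \<open>B\<close> to a module is the same as an element killed by \<open>\<aa>\<close>, the
  image of 1. So exactness of the torsion subcomplex in degree \<open>n + 1\<close> says that homomorphisms from
  \<open>B\<close> to the cocycles in that degree lift along the differential, and dimension shifting applies.
\<close>

lemma derived_torsion_zero_iff: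
  fixes P I :: "('a, 'm) cochain" and N :: "('a, 'm) module"
  assumes \<aa>: "ideal \<aa> R" and P: "projective_resolution R (quotient_left R \<aa>) P \<epsilon>"
    and N: "left_module R N" and I: "injective_resolution R N I \<eta>"
    and T: "\<And>M :: ('a, 'm) module. left_module R M \<Longrightarrow> torsion_submodule R T M = M\<lparr>carrier := annihilated \<aa> M\<rparr>"
  shows "zero_module (cohomology (torsion_subcomplex R T I) (int (Suc n))) \<longleftrightarrow>
    hom_extends R (syzygy P n) (proj_term P n) N"
proof -
  interpret \<aa>: ideal \<aa> R by (rule \<aa>)
  let ?B = "quotient_left R \<aa>" and ?TI = "torsion_subcomplex R T I"
  note B = \<aa>.quotient_left_module(1)
  note cpx = injective_resolutionD(1)[OF N I] and Im = is_complexD(1)[OF injective_resolutionD(1)[OF N I]]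
  have TI: "obj ?TI m = (obj I m)\<lparr>carrier := annihilated \<aa> (obj I m)\<rparr>" "diff ?TI m = diff I m" for m
    by (simp_all add: torsion_subcomplex_def T[OF Im])
  have d_ann: "diff I m x \<in> annihilated \<aa> (obj I (m + 1))" if x: "x \<in> annihilated \<aa> (obj I m)" for m x
  proof -
    note d = is_complexD(2)[OF cpx, of m]
    have xc: "x \<in> carrier (obj I m)" using x by (simp add: annihilated_def)
    have "a \<odot>\<^bsub>obj I (m + 1)\<^esub> diff I m x = \<zero>\<^bsub>obj I (m + 1)\<^esub>" if a: "a \<in> \<aa>" for a
      using lin_hom_smult[OF d \<aa>.Icarr[OF a] xc] lin_hom_zero[OF Im Im d] x a by (simp add: annihilated_def)
    then show ?thesis using lin_hom_closed[OF d xc] by (simp add: annihilated_def)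
  qed
  have ann_sub: "annihilated \<aa> (obj I m) \<subseteq> carrier (obj I m)" for m by (auto simp: annihilated_def)
  have TI_cpx: "is_complex R ?TI"
    unfolding is_complex_def TI
  proof (intro allI conjI ballI)
    fix m
    show "left_module R ((obj I m)\<lparr>carrier := annihilated \<aa> (obj I m)\<rparr>)"
      by (rule submodule_left_module[OF Im annihilated_submodule[OF Im \<aa>]])
    show "diff I m \<in> lin_hom R ((obj I m)\<lparr>carrier := annihilated \<aa> (obj I m)\<rparr>)
      ((obj I (m + 1))\<lparr>carrier := annihilated \<aa> (obj I (m + 1))\<rparr>)"
      by (rule lin_hom_restrict_cod[OF lin_hom_restrict_dom[OF is_complexD(2)[OF cpx] ann_sub]]) (use d_ann in simp)
    fix x assume "x \<in> carrier ((obj I m)\<lparr>carrier := annihilated \<aa> (obj I m)\<rparr>)"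
    then show "diff I (m + 1) (diff I m x) = \<zero>\<^bsub>(obj I (m + 2))\<lparr>carrier := annihilated \<aa> (obj I (m + 2))\<rparr>\<^esub>"
      using is_complexD(4)[OF cpx, of x m] ann_sub by auto
  qed
  let ?I = "obj I (int n)" and ?C = "cosyzygy I (Suc n)" and ?d = "diff I (int n)"
  note c = cosyzygy_facts[OF N I, of n] and Cm = cosyzygy_facts(1)[OF N I, of "Suc n"]
  interpret I: left_module R ?I by (rule Im)
  interpret C: left_module R ?C by (rule Cm)
  have e: "int (Suc n) - 1 = int n" by simp
  have annC: "z \<in> annihilated \<aa> ?C \<longleftrightarrow> z \<in> annihilated \<aa> (obj I (int (Suc n))) \<and> z \<in> cocycles I (int (Suc n))" for z
    by (auto simp: annihilated_def cocycles_iff)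
  have "zero_module (cohomology ?TI (int (Suc n))) \<longleftrightarrow> cocycles ?TI (int (Suc n)) \<subseteq> coboundaries ?TI (int (Suc n))"
    by (rule zero_module_cohomology_iff[OF TI_cpx])
  also have "cocycles ?TI (int (Suc n)) = annihilated \<aa> ?C"
    using annC ann_sub[of "int (Suc n)"] by (auto simp: cocycles_iff TI)
  also have "coboundaries ?TI (int (Suc n)) = ?d ` annihilated \<aa> ?I"
    unfolding coboundaries_def e TI by simp
  also have "annihilated \<aa> ?C \<subseteq> ?d ` annihilated \<aa> ?I \<longleftrightarrow> hom_lifts R ?B ?d ?I ?C"
  proof
    assume L: "annihilated \<aa> ?C \<subseteq> ?d ` annihilated \<aa> ?I"
    show "hom_lifts R ?B ?d ?I ?C"
      unfolding hom_lifts_def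
    proof
      fix h assume h: "h \<in> lin_hom R ?B ?C"
      let ?h = "\<lambda>r. h (\<aa> +>\<^bsub>R\<^esub> r)"
      have hr: "?h \<in> lin_hom R (regular_module R) ?C" by (rule lin_hom_comp[OF \<aa>.quotient_left_module(2) h])
      have h_zero: "?h a = \<zero>\<^bsub>?C\<^esub>" if a: "a \<in> \<aa>" for a
        using \<aa>.cl_eq_iff[OF \<aa>.Icarr[OF a] \<aa>.zero_closed] a \<aa>.Icarr[OF a] \<aa>.cl_zero lin_hom_zero[OF B Cm h]
        by (simp add: \<aa>.minus_eq)
      have h1: "?h r = r \<odot>\<^bsub>?C\<^esub> ?h \<one>\<^bsub>R\<^esub>" if "r \<in> carrier R" for r
        using lin_hom_smult[OF hr that, of "\<one>\<^bsub>R\<^esub>"] that by simp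
      have "a \<odot>\<^bsub>?C\<^esub> ?h \<one>\<^bsub>R\<^esub> = \<zero>\<^bsub>?C\<^esub>" if "a \<in> \<aa>" for a
        using h1[OF \<aa>.Icarr[OF that], symmetric] h_zero[OF that] by (rule trans)
      moreover have "?h \<one>\<^bsub>R\<^esub> \<in> carrier ?C" by (rule lin_hom_closed[OF hr]) simp
      ultimately have "?h \<one>\<^bsub>R\<^esub> \<in> annihilated \<aa> ?C" unfolding annihilated_def by blast
      then obtain w where w: "w \<in> annihilated \<aa> ?I" "?h \<one>\<^bsub>R\<^esub> = ?d w" using L by blast
      have wc: "w \<in> carrier ?I" using w(1) by (simp add: annihilated_def)
      have wl: "(\<lambda>r. r \<odot>\<^bsub>?I\<^esub> w) \<in> lin_hom R (regular_module R) ?I"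
        by (rule lin_homI) (use wc in \<open>simp_all add: I.smult_l_distr I.smult_assoc\<close>)
      have "r \<odot>\<^bsub>?I\<^esub> w = \<zero>\<^bsub>?I\<^esub>" if r: "r \<in> carrier (regular_module R)" "\<aa> +>\<^bsub>R\<^esub> r = \<zero>\<^bsub>?B\<^esub>" for r
      proof -
        have rR: "r \<in> carrier R" using r by simp
        have "r \<in> \<aa>" using r \<aa>.cl_eq_iff[OF rR \<aa>.zero_closed] \<aa>.cl_zero by (simp add: \<aa>.minus_eq)
        then show ?thesis using w(1) by (simp add: annihilated_def)
      qed
      from lin_hom_factor[OF regular_left_module[OF \<aa>.ring_axioms] B Im \<aa>.quotient_left_module(2) _ wl this]
      obtain g where g: "g \<in> lin_hom R ?B ?I" "\<forall>r\<in>carrier R. g (\<aa> +>\<^bsub>R\<^esub> r) = r \<odot>\<^bsub>?I\<^esub> w"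
        by (auto simp: \<aa>.cl_surj)
      have "?d (g y) = h y" if "y \<in> carrier ?B" for y
      proof -
        obtain r where r: "r \<in> carrier R" "y = \<aa> +>\<^bsub>R\<^esub> r" using \<open>y \<in> carrier ?B\<close> by (auto simp: \<aa>.cl_surj)
        have "?d (r \<odot>\<^bsub>?I\<^esub> w) = r \<odot>\<^bsub>?C\<^esub> ?d w" by (rule lin_hom_smult[OF c(2) r(1) wc])
        then show ?thesis using g(2) r h1[OF r(1)] w(2) by simp
      qed
      then show "\<exists>g\<in>lin_hom R ?B ?I. \<forall>x\<in>carrier ?B. ?d (g x) = h x" using g(1) by blast
    qed
  next
    assume L: "hom_lifts R ?B ?d ?I ?C"
    show "annihilated \<aa> ?C \<subseteq> ?d ` annihilated \<aa> ?I"
    proof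
      fix z assume z: "z \<in> annihilated \<aa> ?C"
      have zc: "z \<in> carrier ?C" using z unfolding annihilated_def by blast
      have zl: "(\<lambda>r. r \<odot>\<^bsub>?C\<^esub> z) \<in> lin_hom R (regular_module R) ?C"
        by (rule lin_homI)
          (use C.smult_closed[OF _ zc] C.smult_l_distr[OF _ _ zc] C.smult_assoc[OF _ _ zc] in simp_all)
      have "r \<odot>\<^bsub>?C\<^esub> z = \<zero>\<^bsub>?C\<^esub>" if r: "r \<in> carrier (regular_module R)" "\<aa> +>\<^bsub>R\<^esub> r = \<zero>\<^bsub>?B\<^esub>" for r
      proof -
        have rR: "r \<in> carrier R" using r by simp
        have "r \<in> \<aa>" using r \<aa>.cl_eq_iff[OF rR \<aa>.zero_closed] \<aa>.cl_zero by (simp add: \<aa>.minus_eq)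
        then show ?thesis using z by (simp add: annihilated_def)
      qed
      from lin_hom_factor[OF regular_left_module[OF \<aa>.ring_axioms] B Cm \<aa>.quotient_left_module(2) _ zl this]
      obtain h where h: "h \<in> lin_hom R ?B ?C" "\<forall>r\<in>carrier R. h (\<aa> +>\<^bsub>R\<^esub> r) = r \<odot>\<^bsub>?C\<^esub> z"
        by (auto simp: \<aa>.cl_surj)
      from bspec[OF L[unfolded hom_lifts_def] h(1)]
      obtain g where g: "g \<in> lin_hom R ?B ?I" "\<forall>x\<in>carrier ?B. ?d (g x) = h x" by blast
      let ?w = "g (\<aa> +>\<^bsub>R\<^esub> \<one>\<^bsub>R\<^esub>)"
      have gr: "(\<lambda>r. g (\<aa> +>\<^bsub>R\<^esub> r)) \<in> lin_hom R (regular_module R) ?I" by (rule lin_hom_comp[OF \<aa>.quotient_left_module(2) g(1)])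
      have "a \<odot>\<^bsub>?I\<^esub> ?w = \<zero>\<^bsub>?I\<^esub>" if a: "a \<in> \<aa>" for a
        using lin_hom_smult[OF gr \<aa>.Icarr[OF a], of "\<one>\<^bsub>R\<^esub>"] \<aa>.cl_eq_iff[OF \<aa>.Icarr[OF a] \<aa>.zero_closed] a
          \<aa>.Icarr[OF a] \<aa>.cl_zero lin_hom_zero[OF B Im g(1)] by (simp add: \<aa>.minus_eq)
      then have "?w \<in> annihilated \<aa> ?I" using lin_hom_closed[OF gr, of "\<one>\<^bsub>R\<^esub>"] by (simp add: annihilated_def)
      moreover have "?d ?w = z" using g(2) h(2) \<aa>.cl_closed C.smult_one[OF zc] by simp
      ultimately show "z \<in> ?d ` annihilated \<aa> ?I" by blast
    qed
  qed
  also have "\<dots> \<longleftrightarrow> hom_extends R (syzygy P 0) (proj_term P 0) (cosyzygy I n)"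
  proof -
    note pr = projective_resolutionD[OF B P]
    have "hom_lifts R ?B ?d ?I ?C \<longleftrightarrow> hom_extends R (lin_kernel (obj P 0) ?B (\<epsilon> 0)) (obj P 0) (?I\<lparr>carrier := lin_kernel ?I ?C ?d\<rparr>)"
      by (rule hom_lifts_iff_extends[OF pr(2) B pr(5) pr(6) injective_resolutionD(2)[OF N I] Cm c(2) c(3)])
    then show ?thesis unfolding pr(7) c(4) by simp
  qed
  also have "\<dots> \<longleftrightarrow> hom_extends R (syzygy P n) (proj_term P n) N"
    using hom_extends_shift_all[OF B P N I, of 0 n] by simp
  finally show ?thesis .
qed

section \<open>Strong idempotency in terms of syzygies\<close>

context ideal
begin

lemma quotient_tensor_complex:
  fixes P :: "('a, 'm) cochain"
  assumes P: "is_complex R P"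
  defines "C \<equiv> tensor_complex R (quotient_bimodule R I) P"
  shows "\<And>n. obj C n = tensor_module R (quotient_bimodule R I) (obj P n)"
    and "\<And>n x. x \<in> carrier (obj P n) \<Longrightarrow>
      diff C n (unit_tensor (obj P n) x) = unit_tensor (obj P (n + 1)) (diff P n x)"
    and "is_complex R C"
proof -
  note Pm = is_complexD(1)[OF P]
  show obj: "obj C n = tensor_module R (quotient_bimodule R I) (obj P n)" for n
    by (simp add: C_def tensor_complex_def)
  show d: "diff C n (unit_tensor (obj P n) x) = unit_tensor (obj P (n + 1)) (diff P n x)"
    if "x \<in> carrier (obj P n)" for n x
    using tensor_map_unit_tensor[OF Pm Pm is_complexD(2)[OF P] that] by (simp add: C_def tensor_complex_def)
  note t = tensor_quotient_left_module[OF Pm, folded obj]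
  have t_surj: "unit_tensor (obj P n) ` carrier (obj P n) = carrier (obj C n)" for n
    using unit_tensor_surj(1)[OF Pm] by (simp add: obj)
  have dl: "diff C n \<in> lin_hom R (obj C n) (obj C (n + 1))" for n
    by (rule lin_hom_of_surj[OF t(2) t_surj _ Pm])
      (rule lin_hom_cong[OF lin_hom_comp[OF is_complexD(2)[OF P] t(2)] Pm], simp add: d)
  show "is_complex R C"
    unfolding is_complex_def
  proof (intro allI conjI t(1) dl ballI)
    fix n z assume "z \<in> carrier (obj C n)"
    then obtain x where x: "x \<in> carrier (obj P n)" "z = unit_tensor (obj P n) x" using t_surj[of n] by blast
    have e: "n + 1 + 1 = n + 2" by simp
    have dx: "diff P n x \<in> carrier (obj P (n + 1))" by (rule lin_hom_closed[OF is_complexD(2)[OF P] x(1)])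
    have "diff C (n + 1) (diff C n z) = unit_tensor (obj P (n + 2)) (diff P (n + 1) (diff P n x))"
      using d[OF dx] d[OF x(1)] x(2) unfolding e by simp
    also have "\<dots> = \<zero>\<^bsub>obj C (n + 2)\<^esub>"
      unfolding is_complexD(4)[OF P x(1)] by (rule lin_hom_zero[OF Pm t(1) t(2)])
    finally show "diff C (n + 1) (diff C n z) = \<zero>\<^bsub>obj C (n + 2)\<^esub>" .
  qed
qed

text \<open>
  In terms of representatives in \<open>P\<close>, a cocycle of the tensored complex is an element \<open>x\<close> with
  \<open>dx \<in> IP\<close>, and a coboundary is an element of \<open>dP + IP\<close>. As \<open>P\<close> is a resolution, \<open>x\<close> in degree
  \<open>-(k+1)\<close> is of the second kind iff \<open>dx\<close> lies in \<open>I\<close> times the \<open>k\<close>-th syzygy. Everything else that a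
  quasi-isomorphism requires holds automatically.
\<close>

lemma tensor_quasi_iso_iff:
  fixes P :: "('a, 'm) cochain"
  assumes P: "projective_resolution R (quotient_left R I) P \<epsilon>"
    and can: "\<And>n x. x \<in> carrier (obj P n) \<Longrightarrow> f n (unit_tensor (obj P n) x) = \<epsilon> n x"
  shows "quasi_iso R (tensor_complex R (quotient_bimodule R I) P) (stalk_complex (quotient_left R I)) f \<longleftrightarrow>
    (\<forall>k. relatively_pure I (syzygy P k) (proj_term P k))"
proof -
  let ?B = "quotient_left R I"
  note B = quotient_left_module(1)
  note pr = projective_resolutionD[OF B P]
  note Pm = is_complexD(1)[OF pr(1)] and dP = is_complexD(2)[OF pr(1)]
  define C where "C = tensor_complex R (quotient_bimodule R I) P"
  define S where "S = stalk_complex ?B"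
  define \<tau> where "\<tau> n = unit_tensor (obj P n)" for n
  note tc = quotient_tensor_complex[OF pr(1), folded C_def \<tau>_def]
  have cpx: "is_complex R C" by (rule tc(3))
  note Cm = is_complexD(1)[OF cpx]
  have \<tau>: "\<tau> n \<in> lin_hom R (obj P n) (obj C n)" for n
    using tensor_quotient_left_module(2)[OF Pm] by (simp add: \<tau>_def tc(1))
  have \<tau>_surj: "\<tau> n ` carrier (obj P n) = carrier (obj C n)" for n
    using unit_tensor_surj(1)[OF Pm] by (simp add: \<tau>_def tc(1))
  have \<tau>_ker: "\<tau> n x = \<zero>\<^bsub>obj C n\<^esub> \<longleftrightarrow> x \<in> ideal_smult I (obj P n)" if "x \<in> carrier (obj P n)" for n x
    using unit_tensor_kernel[OF Pm that] by (simp add: \<tau>_def tc(1))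
  have can: "f n (\<tau> n x) = \<epsilon> n x" if "x \<in> carrier (obj P n)" for n x using can[OF that] by (simp add: \<tau>_def)
  have fl: "f n \<in> lin_hom R (obj C n) (obj S n)" for n
    unfolding S_def by (rule lin_hom_of_surj[OF \<tau> \<tau>_surj _ Pm]) (rule lin_hom_cong[OF pr(4) Pm], simp add: can)
  have \<epsilon>c: "chain_map R P S \<epsilon>"
    using P by (simp add: projective_resolution_def quasi_iso_iff S_def)
  have ch: "chain_map R C S f"
    unfolding chain_map_def
  proof (intro conjI cpx allI ballI fl)
    show "is_complex R S" unfolding S_def by (rule stalk_is_complex[OF B])
    fix n z assume "z \<in> carrier (obj C n)"
    then obtain x where x: "x \<in> carrier (obj P n)" "z = \<tau> n x" using \<tau>_surj by blast
    then show "f (n + 1) (diff C n z) = diff S n (f n z)"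
      using tc(2)[OF x(1)] can[OF x(1)] can[OF lin_hom_closed[OF dP x(1)]] chain_mapD(4)[OF \<epsilon>c x(1)] by simp
  qed
  have cocycle: "z \<in> cocycles C n \<longleftrightarrow> (\<exists>x\<in>carrier (obj P n). z = \<tau> n x \<and> diff P n x \<in> ideal_smult I (obj P (n + 1)))" for n z
  proof -
    have "diff C n (\<tau> n x) = \<zero>\<^bsub>obj C (n + 1)\<^esub> \<longleftrightarrow> diff P n x \<in> ideal_smult I (obj P (n + 1))" if "x \<in> carrier (obj P n)" for x
      using tc(2)[OF that] \<tau>_ker[OF lin_hom_closed[OF dP that]] by simp
    then show ?thesis unfolding cocycles_iff \<tau>_surj[symmetric] by auto
  qed
  have coboundary: "\<tau> n x \<in> coboundaries C n \<longleftrightarrow>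
    (\<exists>y\<in>carrier (obj P (n - 1)). x \<ominus>\<^bsub>obj P n\<^esub> diff P (n - 1) y \<in> ideal_smult I (obj P n))"
    if x: "x \<in> carrier (obj P n)" for n x
  proof -
    have e: "n - 1 + 1 = n" by simp
    interpret Pn: left_module R "obj P n" by (rule Pm)
    have "\<tau> n x \<in> coboundaries C n \<longleftrightarrow> (\<exists>y\<in>carrier (obj P (n - 1)). \<tau> n x = diff C (n - 1) (\<tau> (n - 1) y))"
      unfolding coboundaries_iff \<tau>_surj[symmetric] by blast
    also have "\<dots> \<longleftrightarrow> (\<exists>y\<in>carrier (obj P (n - 1)). \<tau> n x = \<tau> n (diff P (n - 1) y))"
      using tc(2)[of _ "n - 1"] unfolding e by (intro bex_cong) simp_all
    also have "\<dots> \<longleftrightarrow> (\<exists>y\<in>carrier (obj P (n - 1)). x \<ominus>\<^bsub>obj P n\<^esub> diff P (n - 1) y \<in> ideal_smult I (obj P n))"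
    proof (intro bex_cong refl)
      fix y assume "y \<in> carrier (obj P (n - 1))"
      then have dy: "diff P (n - 1) y \<in> carrier (obj P n)" by (rule lin_hom_closed[OF is_complexD(3)[OF pr(1)]])
      show "\<tau> n x = \<tau> n (diff P (n - 1) y) \<longleftrightarrow> x \<ominus>\<^bsub>obj P n\<^esub> diff P (n - 1) y \<in> ideal_smult I (obj P n)"
        using lin_hom_eq_iff_diff_kernel[OF Pm Cm \<tau> x dy] \<tau>_ker[of "x \<ominus>\<^bsub>obj P n\<^esub> diff P (n - 1) y" n] x dy by simp
    qed
    finally show ?thesis .
  qed
  have zero_smult: "\<zero>\<^bsub>obj P n\<^esub> \<in> ideal_smult I (obj P n)" for n
    by (rule submodule_zero_closed[OF ideal_smult_submodule[OF Pm is_ideal]])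
  have zero_coc: "\<zero>\<^bsub>obj C n\<^esub> \<in> cocycles C n" for n
    by (rule submodule_zero_closed[OF cocycles_submodule[OF cpx]])
  have Sm: "left_module R (obj S n)" for n unfolding S_def by (rule stalk_obj_left_module[OF B])
  have SB: "coboundaries S n = {\<zero>\<^bsub>obj S n\<^esub>}" for n
    unfolding S_def using stalk_coboundaries[OF B, of n] by simp
  have S0: "obj S 0 = ?B" by (simp add: S_def)
  have Sn: "carrier (obj S n) = {\<zero>\<^bsub>obj S n\<^esub>}" if "n \<noteq> 0" for n using that by (simp add: S_def)
  define injective_at where "injective_at n \<longleftrightarrow> (\<forall>z\<in>cocycles C n. f n z \<in> coboundaries S n \<longrightarrow> z \<in> coboundaries C n)" for n
  define surjective_at where "surjective_at n \<longleftrightarrow> (\<forall>y\<in>cocycles S n. \<exists>z\<in>cocycles C n. y \<ominus>\<^bsub>obj S n\<^esub> f n z \<in> coboundaries S n)" for n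
  have P_pos: "carrier (obj P n) = {\<zero>\<^bsub>obj P n\<^esub>}" if "n > 0" for n using pr(3)[OF that] by (simp add: zero_module_def)
  have surj: "surjective_at n" for n
    unfolding surjective_at_def
  proof
    fix y assume y: "y \<in> cocycles S n"
    interpret S: left_module R "obj S n" by (rule Sm)
    have yc: "y \<in> carrier (obj S n)" using y by (simp add: cocycles_iff)
    show "\<exists>z\<in>cocycles C n. y \<ominus>\<^bsub>obj S n\<^esub> f n z \<in> coboundaries S n"
    proof (cases "n = 0")
      case True
      then obtain x where x: "x \<in> carrier (obj P 0)" "y = \<epsilon> 0 x" using yc pr(6) S0 by auto
      have "diff P 0 x = \<zero>\<^bsub>obj P (0 + 1)\<^esub>" using lin_hom_closed[OF dP x(1)] P_pos[of 1] by simp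
      then have "\<tau> 0 x \<in> cocycles C 0" using x(1) zero_smult[of "0 + 1"] by (auto simp: cocycle)
      moreover have "y \<ominus>\<^bsub>obj S n\<^esub> f n (\<tau> 0 x) = \<zero>\<^bsub>obj S n\<^esub>"
        using S.M.diff_self[OF yc] can[OF x(1)] x(2) True by simp
      ultimately show ?thesis using True SB by auto
    next
      case False
      have "y = \<zero>\<^bsub>obj S n\<^esub>" using yc Sn[OF False] by simp
      then have "y \<ominus>\<^bsub>obj S n\<^esub> f n \<zero>\<^bsub>obj C n\<^esub> = \<zero>\<^bsub>obj S n\<^esub>"
        using lin_hom_zero[OF Cm Sm fl] by simp
      then show ?thesis using zero_coc SB by auto
    qed
  qed
  have nonneg: "injective_at n" if n: "n \<ge> 0" for n
    unfolding injective_at_def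
  proof (intro ballI impI)
    fix z assume z: "z \<in> cocycles C n" and fz: "f n z \<in> coboundaries S n"
    from z obtain x where x: "x \<in> carrier (obj P n)" "z = \<tau> n x" by (auto simp: cocycle)
    interpret Pn: left_module R "obj P n" by (rule Pm)
    show "z \<in> coboundaries C n"
    proof (cases "n = 0")
      case True
      have "x \<in> lin_kernel (obj P 0) ?B (\<epsilon> 0)" using x fz can[OF x(1)] True SB S0 by (simp add: lin_kernel_def)
      then have "x \<in> coboundaries P n" using pr(7) True by simp
      then obtain y where y: "y \<in> carrier (obj P (n - 1))" "x = diff P (n - 1) y" by (auto simp: coboundaries_iff)
      then have "x \<ominus>\<^bsub>obj P n\<^esub> diff P (n - 1) y = \<zero>\<^bsub>obj P n\<^esub>" using Pn.M.diff_self[OF x(1)] by simp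
      then have "x \<ominus>\<^bsub>obj P n\<^esub> diff P (n - 1) y \<in> ideal_smult I (obj P n)" using zero_smult[of n] by simp
      then show ?thesis unfolding x(2) coboundary[OF x(1)] by (rule bexI) (rule y(1))
    next
      case False
      then have "x = \<zero>\<^bsub>obj P n\<^esub>" using x(1) P_pos[of n] n by simp
      then have "z = \<zero>\<^bsub>obj C n\<^esub>" using x(2) lin_hom_zero[OF Pm Cm \<tau>] by simp
      then show ?thesis using submodule_zero_closed[OF coboundaries_submodule[OF cpx]] by simp
    qed
  qed
  have neg: "injective_at (- int (Suc k)) \<longleftrightarrow> relatively_pure I (syzygy P k) (proj_term P k)" for k
  proof -
    let ?n = "- int (Suc k)" and ?Q = "proj_term P (Suc k)" and ?P = "proj_term P k" and ?d = "diff P (- int (Suc k))"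
    let ?S = "?P\<lparr>carrier := syzygy P k\<rparr>"
    note s = syzygy_facts[OF B P, of k]
    interpret Q: left_module R ?Q by (rule Pm)
    interpret Pk: left_module R ?P by (rule Pm)
    have e: "?n + 1 = - int k" by simp
    have fz: "f ?n z \<in> coboundaries S ?n" if "z \<in> cocycles C ?n" for z
      using lin_hom_closed[OF fl[of ?n], of z] that Sn[of ?n] SB[of ?n] by (simp add: cocycles_iff)
    have "injective_at ?n \<longleftrightarrow> (\<forall>z\<in>cocycles C ?n. z \<in> coboundaries C ?n)"
      unfolding injective_at_def using fz by blast
    also have "\<dots> \<longleftrightarrow> (\<forall>x\<in>carrier ?Q. ?d x \<in> ideal_smult I ?P \<longrightarrow>
        (\<exists>y\<in>carrier (obj P (?n - 1)). x \<ominus>\<^bsub>?Q\<^esub> diff P (?n - 1) y \<in> ideal_smult I ?Q))" (is "_ \<longleftrightarrow> ?R")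
      using coboundary[of _ ?n] cocycle[of _ ?n] unfolding e by metis
    also have "?R \<longleftrightarrow> relatively_pure I (syzygy P k) ?P"
    proof
      assume R: ?R
      show "relatively_pure I (syzygy P k) ?P"
        unfolding relatively_pure_def
      proof
        fix w assume w: "w \<in> syzygy P k \<inter> ideal_smult I ?P"
        then obtain x where x: "x \<in> carrier ?Q" "w = ?d x" using s(5) by auto
        then obtain y where y: "y \<in> carrier (obj P (?n - 1))" "x \<ominus>\<^bsub>?Q\<^esub> diff P (?n - 1) y \<in> ideal_smult I ?Q"
          using R w by blast
        let ?y = "diff P (?n - 1) y"
        have yc: "?y \<in> carrier ?Q" by (rule lin_hom_closed[OF is_complexD(3)[OF pr(1)] y(1)])
        have dy: "?d ?y = \<zero>\<^bsub>?S\<^esub>" using is_complexD(5)[OF pr(1) y(1)] unfolding e by simp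
        have "?d (x \<ominus>\<^bsub>?Q\<^esub> ?y) = w \<ominus>\<^bsub>?S\<^esub> \<zero>\<^bsub>?S\<^esub>"
          using lin_hom_diff[OF Pm s(3) s(4) x(1) yc] x(2) unfolding dy by simp
        also have "\<dots> = w"
        proof -
          interpret S: left_module R ?S by (rule s(3))
          show ?thesis by (rule S.M.diff_zero) (use w in simp)
        qed
        finally have "?d (x \<ominus>\<^bsub>?Q\<^esub> ?y) = w" .
        with ideal_smult_image[OF s(4) Pm is_ideal y(2)] show "w \<in> ideal_smult I ?S" by simp
      qed
    next
      assume p: "relatively_pure I (syzygy P k) ?P"
      show ?R
      proof (intro ballI impI)
        fix x assume x: "x \<in> carrier ?Q" and dx: "?d x \<in> ideal_smult I ?P"
        have "?d x \<in> syzygy P k" using s(5) x by blast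
        then have "?d x \<in> ideal_smult I ?S" using p dx unfolding relatively_pure_def by blast
        from ideal_smult_image_preimage[OF s(4) _ Pm is_ideal this] s(5)
        obtain u where u: "u \<in> ideal_smult I ?Q" "?d u = ?d x" by auto
        have uc: "u \<in> carrier ?Q" using u(1) submodule_subset[OF ideal_smult_submodule[OF Pm is_ideal]] by blast
        have "?d (x \<ominus>\<^bsub>?Q\<^esub> u) = \<zero>\<^bsub>?S\<^esub>"
          using lin_hom_eq_iff_diff_kernel[OF Pm s(3) s(4) x uc] u(2) by simp
        then have "x \<ominus>\<^bsub>?Q\<^esub> u \<in> lin_kernel ?Q ?S ?d"
          using Q.M.minus_closed[OF x uc] unfolding lin_kernel_def by blast
        then have "x \<ominus>\<^bsub>?Q\<^esub> u \<in> syzygy P (Suc k)" unfolding s(6) .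
        then obtain y where y: "y \<in> carrier (obj P (?n - 1))" "x \<ominus>\<^bsub>?Q\<^esub> u = diff P (?n - 1) y"
          unfolding coboundaries_iff by blast
        have "x \<ominus>\<^bsub>?Q\<^esub> (x \<ominus>\<^bsub>?Q\<^esub> u) = u" by (rule Q.M.diff_diff_self[OF x uc])
        then have "x \<ominus>\<^bsub>?Q\<^esub> diff P (?n - 1) y \<in> ideal_smult I ?Q" unfolding y(2) using u(1) by simp
        then show "\<exists>y\<in>carrier (obj P (?n - 1)). x \<ominus>\<^bsub>?Q\<^esub> diff P (?n - 1) y \<in> ideal_smult I ?Q"
          using y(1) by (rule bexI)
      qed
    qed
    finally show ?thesis .
  qed
  have "quasi_iso R C S f \<longleftrightarrow> (\<forall>n. injective_at n)"
    unfolding quasi_iso_iff using ch surj by (simp add: injective_at_def surjective_at_def)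
  also have "\<dots> \<longleftrightarrow> (\<forall>k. injective_at (- int (Suc k)))"
  proof
    assume *: "\<forall>k. injective_at (- int (Suc k))"
    show "\<forall>n. injective_at n"
    proof
      fix n :: int
      show "injective_at n"
      proof (cases "n \<ge> 0")
        case False
        then have "n = - int (Suc (nat (- n - 1)))" by simp
        then show ?thesis using * by metis
      qed (rule nonneg)
    qed
  qed blast
  finally show ?thesis unfolding neg C_def S_def .
qed

lemma quotient_carrier_embeds:
  assumes U: "module_universe TYPE('a) TYPE('m)"
  obtains j :: "'a set \<Rightarrow> 'm" where "inj_on j (carrier (quotient_left R I))"
proof -
  obtain i :: "'a \<Rightarrow> 'm" where i: "inj i" using module_universe_embeddings(2)[OF U] by (elim exE)
  have "inj_on (\<lambda>Z. i (SOME r. Z = cl r)) (carrier (quotient_left R I))"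
  proof (rule inj_onI)
    fix Y Z assume YZ: "Y \<in> carrier (quotient_left R I)" "Z \<in> carrier (quotient_left R I)"
      and eq: "i (SOME r. Y = cl r) = i (SOME r. Z = cl r)"
    have "\<exists>r. Y = cl r" "\<exists>r. Z = cl r" using YZ by (auto simp: cl_surj)
    from this[THEN someI_ex] have "Y = cl (SOME r. Y = cl r)" "Z = cl (SOME r. Z = cl r)" .
    moreover have "(SOME r. Y = cl r) = (SOME r. Z = cl r)" by (rule injD[OF i, OF eq])
    ultimately show "Y = Z" by simp
  qed
  then show thesis by (rule that)
qed

lemma chosen_projective_resolution_resolves:
  assumes U: "module_universe TYPE('a) TYPE('m)"
  shows "projective_resolution R (quotient_left R I)
    (fst (chosen_projective_resolution TYPE('m) R (quotient_left R I)))
    (snd (chosen_projective_resolution TYPE('m) R (quotient_left R I)))"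
proof -
  obtain j :: "'a set \<Rightarrow> 'm" where "inj_on j (carrier (quotient_left R I))"
    by (rule quotient_carrier_embeds[OF U])
  from projective_resolution_exists[OF U quotient_left_module(1) this]
  obtain P :: "('a, 'm) cochain" and \<epsilon> where "projective_resolution R (quotient_left R I) P \<epsilon>" by blast
  then have "\<exists>t :: ('a, 'm) cochain \<times> (int \<Rightarrow> 'm \<Rightarrow> 'a set). case t of (P, \<epsilon>) \<Rightarrow> projective_resolution R (quotient_left R I) P \<epsilon>"
    by auto
  from someI_ex[OF this] show ?thesis
    by (simp add: chosen_projective_resolution_def case_prod_unfold)
qed

lemma strongly_idempotent_iff:
  assumes U: "module_universe TYPE('a) TYPE('m)"
    and PP: "chosen_projective_resolution TYPE('m) R (quotient_left R I) = (P, \<epsilon>)"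
  shows "strongly_idempotent TYPE('m) R I \<longleftrightarrow> (\<forall>k. relatively_pure I (syzygy P k) (proj_term P k))"
proof -
  have P: "projective_resolution R (quotient_left R I) P \<epsilon>"
    using chosen_projective_resolution_resolves[OF U] PP by simp
  note B = quotient_left_module(1)
  note pr = projective_resolutionD[OF B P] and Pm = is_complexD(1)[OF projective_resolutionD(1)[OF B P]]
  have "canonical_mult TYPE('m) R I n (unit_tensor (obj P n) x) = \<epsilon> n x" if x: "x \<in> carrier (obj P n)" for n x
    using tensor_map_unit_tensor[OF Pm stalk_obj_left_module[OF B] pr(4) x]
      quotient_mult_unit_tensor[OF lin_hom_closed[OF pr(4) x]]
    by (simp add: canonical_mult_def PP)
  from tensor_quasi_iso_iff[OF P this] show ?thesis
    by (simp add: strongly_idempotent_def derived_tensor_def PP)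
qed

text \<open>
  Lift the augmentation \<open>\<epsilon>\<close> to \<open>\<phi> : P \<rightarrow> R\<close>, and choose \<open>p\<close> with \<open>\<epsilon>(p) = 1\<close>, so that \<open>\<phi>(p) \<in> 1 + I\<close>. For
  \<open>x \<in> I\<close> the element \<open>xp\<close> lies in both \<open>IP\<close> and the kernel \<open>K\<close> of \<open>\<epsilon>\<close>, hence in \<open>IK\<close>, and \<open>\<phi>(IK) \<subseteq> I\<^sup>2\<close>
  because \<open>\<phi>(K) \<subseteq> I\<close>. Thus \<open>x \<phi>(p) \<in> I\<^sup>2\<close>, and it differs from \<open>x\<close> by an element of \<open>I\<^sup>2\<close>.
\<close>

lemma relatively_pure_first_syzygy_imp_idempotent:
  fixes P :: "('a, 'm) module"
  assumes U: "module_universe TYPE('a) TYPE('m)" and P: "projective_module R P"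
    and \<epsilon>: "\<epsilon> \<in> lin_hom R P (quotient_left R I)" and \<epsilon>_surj: "\<epsilon> ` carrier P = carrier (quotient_left R I)"
    and pure: "relatively_pure I (lin_kernel P (quotient_left R I) \<epsilon>) P"
  shows "idempotent_ideal R I"
proof -
  let ?A = "regular_module R" and ?B = "quotient_left R I" and ?K = "lin_kernel P (quotient_left R I) \<epsilon>"
  note A = regular_left_module[OF ring_axioms] and B = quotient_left_module
  note Pm = projective_module_left_module[OF P]
  interpret P: left_module R P by (rule Pm)
  obtain i :: "'a \<Rightarrow> 'm" where "inj i" using module_universe_embeddings(2)[OF U] by (elim exE)
  then have i: "inj_on i (carrier ?A)" by (rule inj_on_subset) simp
  obtain j :: "'a set \<Rightarrow> 'm" where j: "inj_on j (carrier ?B)" by (rule quotient_carrier_embeds[OF U])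
  obtain A' :: "('a, 'm) module" where A': "left_module R A'" "i \<in> lin_hom R ?A A'" "i ` carrier ?A = carrier A'"
    by (rule transport_module[OF A i])
  obtain B' :: "('a, 'm) module" where B': "left_module R B'" "j \<in> lin_hom R ?B B'" "j ` carrier ?B = carrier B'"
    by (rule transport_module[OF B(1) j])
  obtain i' where i': "i' \<in> lin_hom R A' ?A" "\<forall>x\<in>carrier ?A. i' (i x) = x" "\<forall>y\<in>carrier A'. i (i' y) = y"
    by (rule lin_hom_inverse[OF A A'(1,2) i A'(3)]) (rule that)
  have q: "(\<lambda>y. j (cl (i' y))) \<in> lin_hom R A' B'" by (rule lin_hom_comp[OF lin_hom_comp[OF i'(1) B(2)] B'(2)])
  have "(\<lambda>y. j (cl (i' y))) ` carrier A' = j ` cl ` i' ` i ` carrier ?A" by (simp only: image_image A'(3)[symmetric])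
  also have "i' ` i ` carrier ?A = carrier ?A" using i'(2) by (simp add: image_image)
  also have "j ` cl ` carrier ?A = carrier B'" using B'(3) by (simp add: cl_surj)
  finally have q_surj: "(\<lambda>y. j (cl (i' y))) ` carrier A' = carrier B'" .
  obtain h where h: "h \<in> lin_hom R P A'" "\<forall>x\<in>carrier P. j (cl (i' (h x))) = j (\<epsilon> x)"
    by (rule projective_module_lifts[OF P A'(1) B'(1) q q_surj lin_hom_comp[OF \<epsilon> B'(2)]]) (rule that)
  define \<phi> where "\<phi> x = i' (h x)" for x
  have "\<phi> = (\<lambda>x. i' (h x))" by (simp add: \<phi>_def fun_eq_iff)
  then have \<phi>: "\<phi> \<in> lin_hom R P ?A" using lin_hom_comp[OF h(1) i'(1)] by simp
  have \<phi>c: "\<phi> x \<in> carrier R" if "x \<in> carrier P" for x using lin_hom_closed[OF \<phi> that] by simp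
  have cl_\<phi>: "cl (\<phi> x) = \<epsilon> x" if x: "x \<in> carrier P" for x
    using h(2) x lin_hom_closed[OF \<epsilon> x] cl_closed[OF \<phi>c[OF x]] inj_onD[OF j, of "cl (\<phi> x)" "\<epsilon> x"]
    by (simp add: \<phi>_def)
  have \<phi>I: "\<phi> x \<in> I" if "x \<in> ?K" for x
  proof -
    have x: "x \<in> carrier P" "\<epsilon> x = cl \<zero>\<^bsub>R\<^esub>" using that by (simp_all add: lin_kernel_def cl_zero)
    then have "cl (\<phi> x) = cl \<zero>\<^bsub>R\<^esub>" using cl_\<phi> by simp
    then show ?thesis using cl_eq_iff[OF \<phi>c[OF x(1)] zero_closed] \<phi>c[OF x(1)] by (simp add: minus_eq)
  qed
  have K: "submodule ?K R P" by (rule lin_kernel_submodule[OF Pm B(1) \<epsilon>])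
  have II: "ideal (ideal_prod R I I) R" by (rule ideal_prod_is_ideal[OF is_ideal is_ideal])
  have \<phi>II: "\<phi> x \<in> ideal_prod R I I" if "x \<in> ideal_smult I (P\<lparr>carrier := ?K\<rparr>)" for x
    using that
  proof induction
    case (smult a x)
    then have "x \<in> carrier P" "\<phi> x \<in> I" using \<phi>I by (simp_all add: lin_kernel_def)
    then show ?case using ideal_prod.prod[OF smult(1) \<open>\<phi> x \<in> I\<close>] lin_hom_smult[OF \<phi> Icarr[OF smult(1)]] by simp
  next
    case (add x y)
    have "x \<in> ?K" "y \<in> ?K"
      using add(1,2) submodule_subset[OF ideal_smult_submodule[OF submodule_left_module[OF Pm K] is_ideal]] by auto
    then have "x \<in> carrier P" "y \<in> carrier P" by (simp_all add: lin_kernel_def)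
    then show ?case using ideal_prod.sum[OF add(3,4)] lin_hom_add[OF \<phi>] by simp
  qed
  obtain p where p: "p \<in> carrier P" "\<epsilon> p = cl \<one>\<^bsub>R\<^esub>"
  proof -
    have "cl \<one>\<^bsub>R\<^esub> \<in> \<epsilon> ` carrier P" using cl_closed \<epsilon>_surj by simp
    then show thesis using that by auto
  qed
  have u: "\<phi> p \<ominus>\<^bsub>R\<^esub> \<one>\<^bsub>R\<^esub> \<in> I" using cl_\<phi>[OF p(1)] p(2) cl_eq_iff[OF \<phi>c[OF p(1)] one_closed] by simp
  have "x \<in> ideal_prod R I I" if x: "x \<in> I" for x
  proof -
    have xR: "x \<in> carrier R" by (rule Icarr[OF x])
    have "\<epsilon> (x \<odot>\<^bsub>P\<^esub> p) = cl x \<otimes>\<^bsub>R Quot I\<^esub> cl \<one>\<^bsub>R\<^esub>" using lin_hom_smult[OF \<epsilon> xR p(1)] p(2) by simp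
    also have "\<dots> = cl (x \<otimes>\<^bsub>R\<^esub> \<one>\<^bsub>R\<^esub>)" using cl_hom(2)[OF xR one_closed] by simp
    also have "\<dots> = cl \<zero>\<^bsub>R\<^esub>" using cl_eq_iff[OF xR zero_closed] x xR by (simp add: minus_eq)
    finally have "x \<odot>\<^bsub>P\<^esub> p \<in> ?K" using xR p(1) by (simp add: lin_kernel_def cl_zero)
    moreover have "x \<odot>\<^bsub>P\<^esub> p \<in> ideal_smult I P" by (rule ideal_smult.smult[OF x p(1)])
    ultimately have "\<phi> (x \<odot>\<^bsub>P\<^esub> p) \<in> ideal_prod R I I" using pure \<phi>II unfolding relatively_pure_def by blast
    then have xp: "x \<otimes>\<^bsub>R\<^esub> \<phi> p \<in> ideal_prod R I I" using lin_hom_smult[OF \<phi> xR p(1)] by simp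
    have xu: "x \<otimes>\<^bsub>R\<^esub> (\<phi> p \<ominus>\<^bsub>R\<^esub> \<one>\<^bsub>R\<^esub>) \<in> ideal_prod R I I" by (rule ideal_prod.prod[OF x u])
    have "x \<otimes>\<^bsub>R\<^esub> \<phi> p \<ominus>\<^bsub>R\<^esub> x \<otimes>\<^bsub>R\<^esub> (\<phi> p \<ominus>\<^bsub>R\<^esub> \<one>\<^bsub>R\<^esub>) \<in> ideal_prod R I I"
      unfolding a_minus_def
      by (rule additive_subgroup.a_closed[OF ideal.axioms(1)[OF II] xp])
        (rule additive_subgroup.a_inv_closed[OF ideal.axioms(1)[OF II] xu[unfolded a_minus_def]])
    also have "x \<otimes>\<^bsub>R\<^esub> \<phi> p \<ominus>\<^bsub>R\<^esub> x \<otimes>\<^bsub>R\<^esub> (\<phi> p \<ominus>\<^bsub>R\<^esub> \<one>\<^bsub>R\<^esub>) = x"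
    proof -
      have "x \<otimes>\<^bsub>R\<^esub> (\<phi> p \<ominus>\<^bsub>R\<^esub> \<one>\<^bsub>R\<^esub>) = x \<otimes>\<^bsub>R\<^esub> \<phi> p \<ominus>\<^bsub>R\<^esub> x"
        using xR \<phi>c[OF p(1)] by (simp add: minus_eq r_distr r_minus)
      then show ?thesis using diff_diff_left[of "x \<otimes>\<^bsub>R\<^esub> \<phi> p" x "\<zero>\<^bsub>R\<^esub>"] xR \<phi>c[OF p(1)] by simp
    qed
    finally show ?thesis .
  qed
  moreover have "ideal_prod R I I \<subseteq> I" using ideal_prod_inter[OF is_ideal is_ideal] by blast
  ultimately show ?thesis unfolding idempotent_ideal_def by blast
qed

section \<open>The torsion class of an idempotent ideal\<close>

lemma ideal_pow_idempotent:
  assumes "idempotent_ideal R I" shows "ideal_pow R I (Suc n) = I"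
proof (induction n)
  case 0
  have "ideal_prod R I (carrier R) = I"
  proof
    show "ideal_prod R I (carrier R) \<subseteq> I" using ideal_prod_inter[OF is_ideal oneideal] by blast
    show "I \<subseteq> ideal_prod R I (carrier R)"
    proof
      fix a assume "a \<in> I"
      from ideal_prod.prod[OF this one_closed, of R] show "a \<in> ideal_prod R I (carrier R)"
        using Icarr[OF \<open>a \<in> I\<close>] by simp
    qed
  qed
  then show ?case by simp
next
  case (Suc n)
  then show ?case using assms by (simp add: idempotent_ideal_def)
qed

lemma ideal_torsion_class_idempotent:
  assumes "idempotent_ideal R I"
  shows "M \<in> ideal_torsion_class R I \<longleftrightarrow>
    left_module R M \<and> (\<forall>m\<in>carrier M. \<forall>a\<in>I. a \<odot>\<^bsub>M\<^esub> m = \<zero>\<^bsub>M\<^esub>)"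
proof (cases "left_module R M")
  case True
  interpret M: left_module R M by (rule True)
  have "(\<exists>n. \<forall>x\<in>ideal_pow R I n. x \<odot>\<^bsub>M\<^esub> m = \<zero>\<^bsub>M\<^esub>) \<longleftrightarrow> (\<forall>a\<in>I. a \<odot>\<^bsub>M\<^esub> m = \<zero>\<^bsub>M\<^esub>)" for m
  proof
    assume "\<exists>n. \<forall>x\<in>ideal_pow R I n. x \<odot>\<^bsub>M\<^esub> m = \<zero>\<^bsub>M\<^esub>"
    then obtain n where n: "\<forall>x\<in>ideal_pow R I n. x \<odot>\<^bsub>M\<^esub> m = \<zero>\<^bsub>M\<^esub>" by blast
    have "I \<subseteq> ideal_pow R I n"
      using a_subset ideal_pow_idempotent[OF assms, of "n - 1"] by (cases n) simp_all
    then show "\<forall>a\<in>I. a \<odot>\<^bsub>M\<^esub> m = \<zero>\<^bsub>M\<^esub>" using n by blast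
  next
    assume "\<forall>a\<in>I. a \<odot>\<^bsub>M\<^esub> m = \<zero>\<^bsub>M\<^esub>"
    then show "\<exists>n. \<forall>x\<in>ideal_pow R I n. x \<odot>\<^bsub>M\<^esub> m = \<zero>\<^bsub>M\<^esub>"
      using ideal_pow_idempotent[OF assms, of 0] by (intro exI[of _ "Suc 0"]) (simp del: ideal_pow.simps)
  qed
  then show ?thesis by (simp add: ideal_torsion_class_def True)
qed (simp add: ideal_torsion_class_def)

lemma torsion_submodule_idempotent:
  assumes id: "idempotent_ideal R I" and M: "left_module R M"
  shows "torsion_submodule R (ideal_torsion_class R I) M = M\<lparr>carrier := annihilated I M\<rparr>"
proof -
  note T = ideal_torsion_class_idempotent[OF id]
  have "(GREATEST N. submodule N R M \<and> M\<lparr>carrier := N\<rparr> \<in> ideal_torsion_class R I) = annihilated I M"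
  proof (rule Greatest_equality)
    show "submodule (annihilated I M) R M \<and> M\<lparr>carrier := annihilated I M\<rparr> \<in> ideal_torsion_class R I"
      using annihilated_submodule[OF M is_ideal] submodule_left_module[OF M annihilated_submodule[OF M is_ideal]]
      by (simp add: T annihilated_def)
    fix N assume N: "submodule N R M \<and> M\<lparr>carrier := N\<rparr> \<in> ideal_torsion_class R I"
    then show "N \<le> annihilated I M"
      using submodule_subset[of N R M] by (auto simp: T annihilated_def)
  qed
  then show ?thesis by (simp add: torsion_submodule_def)
qed

text \<open>
  Idempotency gives closure under extensions: elements of \<open>I\<close> map the middle term into the submodule,
  which is killed by \<open>I\<close>, so \<open>I\<^sup>2 = I\<close> kills the middle term.
\<close>

lemma torsion_class_idempotent:
  assumes id: "idempotent_ideal R I"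
  shows "torsion_class R (ideal_torsion_class R I :: ('a, 'm) module set)"
proof -
  note T = ideal_torsion_class_idempotent[OF id]
  show ?thesis
    unfolding torsion_class_def
  proof (intro conjI ballI allI impI)
    fix M :: "('a, 'm) module" assume "M \<in> ideal_torsion_class R I"
    then show "left_module R M" by (simp add: T)
  next
    fix M N :: "('a, 'm) module" and f
    assume M: "M \<in> ideal_torsion_class R I" and N: "left_module R N \<and> f \<in> lin_hom R N M \<and> inj_on f (carrier N)"
    interpret N: left_module R N using N by simp
    have Mm: "left_module R M" using M by (simp add: T)
    have f: "f \<in> lin_hom R N M" and inj: "inj_on f (carrier N)" using N by simp_all
    have "a \<odot>\<^bsub>N\<^esub> x = \<zero>\<^bsub>N\<^esub>" if x: "x \<in> carrier N" and a: "a \<in> I" for a x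
    proof -
      have "f (a \<odot>\<^bsub>N\<^esub> x) = f \<zero>\<^bsub>N\<^esub>"
        using lin_hom_smult[OF f Icarr[OF a] x] M a lin_hom_closed[OF f x] lin_hom_zero[OF N.left_module_axioms Mm f]
        by (simp add: T)
      then show ?thesis using inj_onD[OF inj, of "a \<odot>\<^bsub>N\<^esub> x" "\<zero>\<^bsub>N\<^esub>"] x Icarr[OF a] by simp
    qed
    then show "N \<in> ideal_torsion_class R I" using N by (simp add: T)
  next
    fix M N :: "('a, 'm) module" and f
    assume M: "M \<in> ideal_torsion_class R I" and N: "left_module R N \<and> f \<in> lin_hom R M N \<and> f ` carrier M = carrier N"
    have Mm: "left_module R M" using M by (simp add: T)
    have f: "f \<in> lin_hom R M N" and Nm: "left_module R N" using N by simp_all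
    have "a \<odot>\<^bsub>N\<^esub> y = \<zero>\<^bsub>N\<^esub>" if y: "y \<in> carrier N" and a: "a \<in> I" for a y
    proof -
      have "y \<in> f ` carrier M" using y N by simp
      then obtain x where x: "x \<in> carrier M" "y = f x" by blast
      then show ?thesis using lin_hom_smult[OF f Icarr[OF a] x(1)] M a lin_hom_zero[OF Mm Nm f] by (simp add: T)
    qed
    then show "N \<in> ideal_torsion_class R I" using Nm by (simp add: T)
  next
    fix L N M :: "('a, 'm) module" and f g
    assume L: "L \<in> ideal_torsion_class R I" and N: "N \<in> ideal_torsion_class R I"
      and H: "left_module R M \<and> f \<in> lin_hom R L M \<and> inj_on f (carrier L) \<and> g \<in> lin_hom R M N \<and>
        g ` carrier M = carrier N \<and> f ` carrier L = lin_kernel M N g"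
    have Lm: "left_module R L" using L by (simp add: T)
    have Mm: "left_module R M" and f: "f \<in> lin_hom R L M" and g: "g \<in> lin_hom R M N"
      and ker: "f ` carrier L = lin_kernel M N g" using H by simp_all
    interpret M: left_module R M by (rule Mm)
    have b: "b \<odot>\<^bsub>M\<^esub> m = \<zero>\<^bsub>M\<^esub>" if m: "m \<in> f ` carrier L" and b: "b \<in> I" for b m
    proof -
      obtain l where l: "l \<in> carrier L" "m = f l" using m by blast
      then show ?thesis using lin_hom_smult[OF f Icarr[OF b] l(1)] L b lin_hom_zero[OF Lm Mm f] by (simp add: T)
    qed
    have k: "c \<odot>\<^bsub>M\<^esub> m \<in> f ` carrier L" if m: "m \<in> carrier M" and c: "c \<in> I" for c m
      using lin_hom_smult[OF g Icarr[OF c] m] N c lin_hom_closed[OF g m] m Icarr[OF c]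
      unfolding ker by (simp add: T lin_kernel_def)
    have "a \<odot>\<^bsub>M\<^esub> m = \<zero>\<^bsub>M\<^esub>" if m: "m \<in> carrier M" and a: "a \<in> I" for a m
    proof -
      have "a \<in> ideal_prod R I I" using a id by (simp add: idempotent_ideal_def)
      then have "a \<in> carrier R \<and> a \<odot>\<^bsub>M\<^esub> m = \<zero>\<^bsub>M\<^esub>"
      proof induction
        case (prod b c)
        then show ?case using b[OF k[OF m prod(2)] prod(1)] Icarr[OF prod(1)] Icarr[OF prod(2)] m
          by (simp add: M.smult_assoc)
      next
        case (sum s t)
        then show ?case using m by (simp add: M.smult_l_distr)
      qed
      then show ?thesis by simp
    qed
    then show "M \<in> ideal_torsion_class R I" using Mm by (simp add: T)
  next
    fix M :: "('a, 'm) module" and J :: "'m set" and N \<iota>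
    assume H: "direct_sum_of R M J N \<iota> \<and> (\<forall>i\<in>J. N i \<in> ideal_torsion_class R I)"
    then have Mm: "left_module R M" by (simp add: direct_sum_of_def)
    interpret M: left_module R M by (rule Mm)
    have \<iota>: "\<iota> i \<in> lin_hom R (N i) M" and Nm: "left_module R (N i)" if "i \<in> J" for i
      using H that by (simp_all add: direct_sum_of_def)
    have "a \<odot>\<^bsub>M\<^esub> m = \<zero>\<^bsub>M\<^esub>" if m: "m \<in> carrier M" and a: "a \<in> I" for a m
    proof -
      have "\<exists>x. x \<in> (\<Pi>\<^sub>E i\<in>J. carrier (N i)) \<and> finite {i\<in>J. x i \<noteq> \<zero>\<^bsub>N i\<^esub>} \<and>
        m = (\<Oplus>\<^bsub>M\<^esub>i\<in>{i\<in>J. x i \<noteq> \<zero>\<^bsub>N i\<^esub>}. \<iota> i (x i))"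
        using H m unfolding direct_sum_of_def by (blast dest: ex1_implies_ex)
      then obtain x where x: "x \<in> (\<Pi>\<^sub>E i\<in>J. carrier (N i))" and fin: "finite {i\<in>J. x i \<noteq> \<zero>\<^bsub>N i\<^esub>}"
        and m_eq: "m = (\<Oplus>\<^bsub>M\<^esub>i\<in>{i\<in>J. x i \<noteq> \<zero>\<^bsub>N i\<^esub>}. \<iota> i (x i))" by blast
      let ?A = "{i\<in>J. x i \<noteq> \<zero>\<^bsub>N i\<^esub>}"
      have xc: "x i \<in> carrier (N i)" if "i \<in> ?A" for i using x that by auto
      have cl: "\<iota> i (x i) \<in> carrier M" if "i \<in> ?A" for i using lin_hom_closed[OF \<iota> xc[OF that]] that by simp
      have z: "a \<odot>\<^bsub>M\<^esub> \<iota> i (x i) = \<zero>\<^bsub>M\<^esub>" if i: "i \<in> ?A" for i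
      proof -
        have iJ: "i \<in> J" using i by simp
        have "a \<odot>\<^bsub>N i\<^esub> x i = \<zero>\<^bsub>N i\<^esub>" using H iJ a xc[OF i] by (simp add: T)
        then show ?thesis
          using lin_hom_smult[OF \<iota>[OF iJ] Icarr[OF a] xc[OF i]] lin_hom_zero[OF Nm[OF iJ] Mm \<iota>[OF iJ]] by simp
      qed
      have "a \<odot>\<^bsub>M\<^esub> m = (\<Oplus>\<^bsub>M\<^esub>i\<in>?A. a \<odot>\<^bsub>M\<^esub> \<iota> i (x i))"
        unfolding m_eq by (rule M.finsum_smult_r[OF fin Icarr[OF a]]) (use cl in auto)
      also have "\<dots> = (\<Oplus>\<^bsub>M\<^esub>i\<in>?A. \<zero>\<^bsub>M\<^esub>)" by (rule M.M.finsum_cong') (use z in auto)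
      also have "\<dots> = \<zero>\<^bsub>M\<^esub>" by simp
      finally show ?thesis .
    qed
    then show "M \<in> ideal_torsion_class R I" using Mm by (simp add: T)
  qed
qed

text \<open>
  By dimension shifting, acyclicity of the torsion part of \<open>E\<close> is an extension property of all syzygies
  in their projective terms; over all injective \<open>E\<close> this amounts to relative purity.
\<close>

lemma weakly_stable_iff:
  fixes P :: "('a, 'm) cochain"
  assumes U: "module_universe TYPE('a) TYPE('m)" and id: "idempotent_ideal R I"
    and P: "projective_resolution R (quotient_left R I) P \<epsilon>"
  shows "weakly_stable R (ideal_torsion_class R I :: ('a, 'm) module set) \<longleftrightarrow>
    (\<forall>k. relatively_pure I (syzygy P k) (proj_term P k))"
proof -
  let ?T = "ideal_torsion_class R I :: ('a, 'm) module set"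
  note B = quotient_left_module(1)
  note s = syzygy_facts(1,2)[OF B P]
  note T = torsion_submodule_idempotent[OF id]
  have acyclic: "right_torsion_acyclic R ?T (torsion_submodule R ?T E) \<longleftrightarrow>
    (\<forall>n. hom_extends R (syzygy P n) (proj_term P n) (E\<lparr>carrier := annihilated I E\<rparr>))"
    if E: "injective_module R E" for E :: "('a, 'm) module"
  proof -
    let ?N = "E\<lparr>carrier := annihilated I E\<rparr>"
    note Em = injective_module_left_module[OF E]
    have N: "left_module R ?N" by (rule submodule_left_module[OF Em annihilated_submodule[OF Em is_ideal]])
    from someI_ex[OF injective_resolution_exists[OF U N]]
    obtain \<eta> where J: "injective_resolution R ?N (chosen_injective_resolution R ?N) \<eta>"
      unfolding chosen_injective_resolution_def by blast
    have "right_torsion_acyclic R ?T ?N \<longleftrightarrow> (\<forall>n. zero_module (right_derived_torsion R ?T (int (Suc n)) ?N))"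
      unfolding right_torsion_acyclic_def
    proof
      assume *: "\<forall>n. zero_module (right_derived_torsion R ?T (int (Suc n)) ?N)"
      show "\<forall>i\<ge>1. zero_module (right_derived_torsion R ?T i ?N)"
      proof (intro allI impI)
        fix i :: int assume "1 \<le> i"
        then have "i = int (Suc (nat (i - 1)))" by simp
        then show "zero_module (right_derived_torsion R ?T i ?N)" using * by metis
      qed
    qed simp
    also have "\<dots> \<longleftrightarrow> (\<forall>n. hom_extends R (syzygy P n) (proj_term P n) ?N)"
      unfolding right_derived_torsion_def using derived_torsion_zero_iff[OF is_ideal P N J T] by simp
    finally show ?thesis using T[OF Em] by simp
  qed
  show ?thesis
  proof
    assume ws: "weakly_stable R ?T"
    show "\<forall>k. relatively_pure I (syzygy P k) (proj_term P k)"
    proof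
      fix k
      show "relatively_pure I (syzygy P k) (proj_term P k)"
        by (rule hom_extends_imp_relatively_pure[OF U s(1) s(2) is_ideal])
          (use ws acyclic in \<open>simp add: weakly_stable_def\<close>)
    qed
  next
    assume pure: "\<forall>k. relatively_pure I (syzygy P k) (proj_term P k)"
    show "weakly_stable R ?T"
      unfolding weakly_stable_def
    proof (intro allI impI)
      fix E :: "('a, 'm) module" assume E: "injective_module R E"
      show "right_torsion_acyclic R ?T (torsion_submodule R ?T E)"
        unfolding acyclic[OF E] using relatively_pure_imp_hom_extends[OF s(1) s(2) is_ideal _ E] pure by blast
    qed
  qed
qed

end

theorem proposition4p10:
  fixes R :: "('a, 'r) ring_scheme" and \<aa> :: "'a set"
  assumes "module_universe TYPE('a) TYPE('m)"
    and "ring R"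
    and "ideal \<aa> R"
  shows "strongly_idempotent TYPE('m) R \<aa> \<longleftrightarrow>
    idempotent_ideal R \<aa> \<and>
    torsion_class R (ideal_torsion_class R \<aa> :: ('a, 'm) module set) \<and>
    weakly_stable R (ideal_torsion_class R \<aa> :: ('a, 'm) module set)"
proof -
  interpret ideal \<aa> R by fact
  note U = assms(1)
  obtain P :: "('a, 'm) cochain" and \<epsilon> where PP: "chosen_projective_resolution TYPE('m) R (quotient_left R \<aa>) = (P, \<epsilon>)"
    by (cases "chosen_projective_resolution TYPE('m) R (quotient_left R \<aa>)")
  have P: "projective_resolution R (quotient_left R \<aa>) P \<epsilon>"
    using chosen_projective_resolution_resolves[OF U] PP by simp
  note pr = projective_resolutionD[OF quotient_left_module(1) P]
  have "idempotent_ideal R \<aa>" if "\<forall>k. relatively_pure \<aa> (syzygy P k) (proj_term P k)"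
    using relatively_pure_first_syzygy_imp_idempotent[OF U pr(2)[of 0] pr(5) pr(6)] spec[OF that, of 0] pr(7) by simp
  then show ?thesis
    unfolding strongly_idempotent_iff[OF U PP]
    using weakly_stable_iff[OF U _ P] torsion_class_idempotent by blast
qed

end
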